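(* Let $\mathbb{K}$ be a field. Given integers $a\ge 2$ and $b\ge 1$, there exists a Cohen--Macaulay positively graded $\mathbb{K}$-algebra $R$ with Cohen--Macaulay type $\mathrm{t}(R)=a$ and residue $\mathrm{res}(R)=b$.
   Context: A positively graded $\mathbb{K}$-algebra is a finitely generated commutative $\mathbb{K}$-algebra $R=\bigoplus_{i\ge 0}R_i$ with $R_0=\mathbb{K}$ (not necessarily generated in degree $1$); $\mathbb{K}$ is viewed as the $R$-module $R/\mathfrak{m}$, where $\mathfrak{m}=\bigoplus_{i>0}R_i$. For a Cohen--Macaulay positively graded $\mathbb{K}$-algebra $R$, the Cohen--Macaulay type is $$\mathrm{t}(R)=\dim_{\mathbb{K}}\mathrm{Ext}_R^{\dim R}(\mathbb{K},R),$$ and the residue is the length $$\mathrm{res}(R)=\ell_R\big(R/\mathrm{tr}(\omega_R)\big),$$ where $\omega_R$ is the canonical module of $R$ and the canonical trace ideal $\mathrm{tr}(\omega_R)\subseteq R$ is the sum of the ideals $\varphi(\omega_R)$ over all $\varphi\in\mathrm{Hom}_R(\omega_R,R)$. *)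

theory Defs
  imports
    "Jordan_Normal_Form.Missing_VectorSpace"
    "HOL-Algebra.Ring_Divisibility"
    "HOL-Algebra.Generated_Rings"
    "HOL-Library.Extended_Nat"
begin

hide_const (open) Multiset.mult Modules.module_hom

section \<open>Modules over a commutative ring\<close>

text \<open>
  A \<^typ>\<open>('a, 'b) module\<close> record extends the ring record.  For records that only carry a module,
  the fields \<^const>\<open>mult\<close> and \<^const>\<open>one\<close> are meaningless.
\<close>

definition regular_module :: "('r, 'm) ring_scheme \<Rightarrow> ('r, 'r) module" where
  "regular_module R = \<lparr>carrier = carrier R, mult = mult R, one = one R,
     zero = zero R, add = add R, smult = mult R\<rparr>"

definition quotient_module ::
  "('r, 'a, 'm) module_scheme \<Rightarrow> 'a set \<Rightarrow> ('r, 'a set) module" where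
  "quotient_module M N = \<lparr>carrier = a_rcosets\<^bsub>M\<^esub> N, mult = (\<lambda>X Y. N), one = N,
     zero = N, add = set_add M, smult = (\<lambda>r X. \<Union>x\<in>X. N +>\<^bsub>M\<^esub> (r \<odot>\<^bsub>M\<^esub> x))\<rparr>"

text \<open>
  Elements of \<^const>\<open>module_hom\<close> are unconstrained outside the carrier, so the module
  \<open>Hom\<^sub>R(M, N)\<close> is formed from the extensional ones.
\<close>

definition Hom_module ::
  "('r, 'l) ring_scheme \<Rightarrow> ('r, 'a, 'm) module_scheme \<Rightarrow> ('r, 'b, 'n) module_scheme
    \<Rightarrow> ('r, 'a \<Rightarrow> 'b) module" where
  "Hom_module R M N = \<lparr>carrier = module_hom R M N \<inter> extensional (carrier M),
     mult = (\<lambda>f g. \<lambda>x\<in>carrier M. \<zero>\<^bsub>N\<^esub>), one = (\<lambda>x\<in>carrier M. \<zero>\<^bsub>N\<^esub>),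
     zero = (\<lambda>x\<in>carrier M. \<zero>\<^bsub>N\<^esub>),
     add = (\<lambda>f g. \<lambda>x\<in>carrier M. f x \<oplus>\<^bsub>N\<^esub> g x),
     smult = (\<lambda>r f. \<lambda>x\<in>carrier M. r \<odot>\<^bsub>N\<^esub> f x)\<rparr>"

definition module_isomorphic ::
  "('r, 'l) ring_scheme \<Rightarrow> ('r, 'a, 'm) module_scheme \<Rightarrow> ('r, 'b, 'n) module_scheme \<Rightarrow> bool" where
  "module_isomorphic R M N \<longleftrightarrow>
     (\<exists>f \<in> module_hom R M N. bij_betw f (carrier M) (carrier N))"

definition finitely_generated_module ::
  "('r, 'l) ring_scheme \<Rightarrow> ('r, 'a, 'm) module_scheme \<Rightarrow> bool" where
  "finitely_generated_module R M \<longleftrightarrow>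
     Module.module R M \<and> (\<exists>S \<subseteq> carrier M. finite S \<and> LinearCombinations.module.span R M S = carrier M)"

definition module_length :: "('r, 'l) ring_scheme \<Rightarrow> ('r, 'a, 'm) module_scheme \<Rightarrow> enat" where
  "module_length R M = Sup {enat n | n. \<exists>N :: nat \<Rightarrow> 'a set.
     (\<forall>i\<le>n. submodule R (N i) M) \<and> (\<forall>i<n. N i \<subset> N (Suc i))}"

definition vector_dim :: "('k, 'l) ring_scheme \<Rightarrow> ('k, 'a, 'm) module_scheme \<Rightarrow> enat" where
  "vector_dim K V =
     (if vectorspace.fin_dim K V then enat (vectorspace.dim K V) else \<infinity>)"


section \<open>Ext modules\<close>

abbreviation free_module :: "('r, 'l) ring_scheme \<Rightarrow> nat \<Rightarrow> ('r, nat \<Rightarrow> 'r) module" where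
  "free_module R n \<equiv> ring.func_space R {..<n}"

text \<open>
  A resolution \<open>\<dots> \<rightarrow> R\<^sup>b\<^sup>(\<^sup>2\<^sup>) \<rightarrow> R\<^sup>b\<^sup>(\<^sup>1\<^sup>) \<rightarrow> R\<^sup>b\<^sup>(\<^sup>0\<^sup>) \<rightarrow> M \<rightarrow> 0\<close> with augmentation \<open>e\<close> and
  differentials \<open>d i : R\<^sup>b\<^sup>(\<^sup>i\<^sup>+\<^sup>1\<^sup>) \<rightarrow> R\<^sup>b\<^sup>(\<^sup>i\<^sup>)\<close>.
\<close>

definition free_resolution ::
  "('r, 'l) ring_scheme \<Rightarrow> ('r, 'a, 'm) module_scheme \<Rightarrow> (nat \<Rightarrow> nat)
    \<Rightarrow> ((nat \<Rightarrow> 'r) \<Rightarrow> 'a) \<Rightarrow> (nat \<Rightarrow> (nat \<Rightarrow> 'r) \<Rightarrow> (nat \<Rightarrow> 'r)) \<Rightarrow> bool" where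
  "free_resolution R M b e d \<longleftrightarrow>
     e \<in> module_hom R (free_module R (b 0)) M \<and>
     (\<forall>i. d i \<in> module_hom R (free_module R (b (Suc i))) (free_module R (b i))) \<and>
     e ` carrier (free_module R (b 0)) = carrier M \<and>
     d 0 ` carrier (free_module R (b 1)) =
       {x \<in> carrier (free_module R (b 0)). e x = \<zero>\<^bsub>M\<^esub>} \<and>
     (\<forall>i. d (Suc i) ` carrier (free_module R (b (Suc (Suc i)))) =
       {x \<in> carrier (free_module R (b (Suc i))). d i x = \<zero>\<^bsub>free_module R (b i)\<^esub>})"

definition Ext_cocycles ::
  "('r, 'l) ring_scheme \<Rightarrow> (nat \<Rightarrow> nat) \<Rightarrow> (nat \<Rightarrow> (nat \<Rightarrow> 'r) \<Rightarrow> (nat \<Rightarrow> 'r)) \<Rightarrow> nat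
    \<Rightarrow> ('r, 'b, 'n) module_scheme \<Rightarrow> ((nat \<Rightarrow> 'r) \<Rightarrow> 'b) set" where
  "Ext_cocycles R b d i N =
     {f \<in> carrier (Hom_module R (free_module R (b i)) N).
        \<forall>x \<in> carrier (free_module R (b (Suc i))). f (d i x) = \<zero>\<^bsub>N\<^esub>}"

fun Ext_coboundaries ::
  "('r, 'l) ring_scheme \<Rightarrow> (nat \<Rightarrow> nat) \<Rightarrow> (nat \<Rightarrow> (nat \<Rightarrow> 'r) \<Rightarrow> (nat \<Rightarrow> 'r)) \<Rightarrow> nat
    \<Rightarrow> ('r, 'b, 'n) module_scheme \<Rightarrow> ((nat \<Rightarrow> 'r) \<Rightarrow> 'b) set" where
  "Ext_coboundaries R b d 0 N = {\<zero>\<^bsub>Hom_module R (free_module R (b 0)) N\<^esub>}"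
| "Ext_coboundaries R b d (Suc i) N =
     (\<lambda>g. compose (carrier (free_module R (b (Suc i)))) g (d i)) `
       carrier (Hom_module R (free_module R (b i)) N)"

definition Ext_of_resolution ::
  "('r, 'l) ring_scheme \<Rightarrow> (nat \<Rightarrow> nat) \<Rightarrow> (nat \<Rightarrow> (nat \<Rightarrow> 'r) \<Rightarrow> (nat \<Rightarrow> 'r)) \<Rightarrow> nat
    \<Rightarrow> ('r, 'b, 'n) module_scheme \<Rightarrow> ('r, ((nat \<Rightarrow> 'r) \<Rightarrow> 'b) set) module" where
  "Ext_of_resolution R b d i N =
     quotient_module
       ((Hom_module R (free_module R (b i)) N)\<lparr>carrier := Ext_cocycles R b d i N\<rparr>)
       (Ext_coboundaries R b d i N)"

text \<open>
  The \<open>i\<close>-th Ext module, computed from a chosen resolution of \<open>M\<close> by free modules of finite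
  rank.  Such a resolution exists whenever \<open>R\<close> is Noetherian and \<open>M\<close> is finitely generated, which
  is the only case in which the definition is meaningful.
\<close>

definition Ext ::
  "('r, 'l) ring_scheme \<Rightarrow> nat \<Rightarrow> ('r, 'a, 'm) module_scheme \<Rightarrow> ('r, 'b, 'n) module_scheme
    \<Rightarrow> ('r, ((nat \<Rightarrow> 'r) \<Rightarrow> 'b) set) module" where
  "Ext R i M N =
     (case SOME (b, e, d). free_resolution R M b e d of
        (b, e, d) \<Rightarrow> Ext_of_resolution R b d i N)"


section \<open>Dimension, grade and the Cohen--Macaulay property\<close>

definition krull_dim :: "('r, 'l) ring_scheme \<Rightarrow> enat" where
  "krull_dim R = Sup {enat n | n. \<exists>P :: nat \<Rightarrow> 'r set.
     (\<forall>i\<le>n. primeideal (P i) R) \<and> (\<forall>i<n. P i \<subset> P (Suc i))}"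

definition height :: "('r, 'l) ring_scheme \<Rightarrow> 'r set \<Rightarrow> enat" where
  "height R Q = Sup {enat n | n. \<exists>P :: nat \<Rightarrow> 'r set.
     (\<forall>i\<le>n. primeideal (P i) R) \<and> (\<forall>i<n. P i \<subset> P (Suc i)) \<and> P n = Q}"

definition regular_sequence :: "('r, 'l) ring_scheme \<Rightarrow> 'r list \<Rightarrow> bool" where
  "regular_sequence R xs \<longleftrightarrow>
     set xs \<subseteq> carrier R \<and> Idl\<^bsub>R\<^esub> (set xs) \<noteq> carrier R \<and>
     (\<forall>i < length xs. \<forall>y \<in> carrier R.
        xs ! i \<otimes>\<^bsub>R\<^esub> y \<in> Idl\<^bsub>R\<^esub> (set (take i xs)) \<longrightarrow> y \<in> Idl\<^bsub>R\<^esub> (set (take i xs)))"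

definition grade :: "('r, 'l) ring_scheme \<Rightarrow> 'r set \<Rightarrow> enat" where
  "grade R I = Sup {enat (length xs) | xs. set xs \<subseteq> I \<and> regular_sequence R xs}"

text \<open>
  For a maximal ideal \<open>P\<close> of a Noetherian ring, the grade and the height of \<open>P\<close> are the depth and
  the dimension of the localization at \<open>P\<close>.
\<close>

definition cohen_macaulay :: "('r, 'l) ring_scheme \<Rightarrow> bool" where
  "cohen_macaulay R \<longleftrightarrow>
     cring R \<and> noetherian_ring R \<and> (\<forall>P. maximalideal P R \<longrightarrow> grade R P = height R P)"


section \<open>Positively graded algebras and graded modules\<close>

definition is_direct_sum :: "('a, 'l) ring_scheme \<Rightarrow> ('i \<Rightarrow> 'a set) \<Rightarrow> bool" where
  "is_direct_sum M D \<longleftrightarrow>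
     (\<forall>i. additive_subgroup (D i) M) \<and>
     (\<forall>x \<in> carrier M. \<exists>!f. (\<forall>i. f i \<in> D i) \<and> finite {i. f i \<noteq> \<zero>\<^bsub>M\<^esub>} \<and>
        x = (\<Oplus>\<^bsub>M\<^esub>i\<in>{i. f i \<noteq> \<zero>\<^bsub>M\<^esub>}. f i))"

definition structure_map :: "('k, 'r, 'l) module_scheme \<Rightarrow> 'k \<Rightarrow> 'r" where
  "structure_map R c = c \<odot>\<^bsub>R\<^esub> \<one>\<^bsub>R\<^esub>"

definition positively_graded_algebra ::
  "('k, 'm) ring_scheme \<Rightarrow> ('k, 'r, 'l) module_scheme \<Rightarrow> (nat \<Rightarrow> 'r set) \<Rightarrow> bool" where
  "positively_graded_algebra K R D \<longleftrightarrow>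
     field K \<and> Module.algebra K R \<and>
     (\<exists>S \<subseteq> carrier R. finite S \<and>
        generate_ring R (structure_map R ` carrier K \<union> S) = carrier R) \<and>
     is_direct_sum R D \<and>
     (\<forall>i j. \<forall>x \<in> D i. \<forall>y \<in> D j. x \<otimes>\<^bsub>R\<^esub> y \<in> D (i + j)) \<and>
     bij_betw (structure_map R) (carrier K) (D 0)"

text \<open>
  Such an algebra, and any finitely generated graded module over it, has countable dimension over
  \<open>\<bbbK>\<close>.  It is therefore isomorphic to one whose carrier consists of functions from \<^typ>\<open>nat\<close>
  to \<open>\<bbbK>\<close>, so an existence claim may quantify over records on that type without loss.
\<close>

definition irrelevant_ideal :: "('r, 'l) ring_scheme \<Rightarrow> (nat \<Rightarrow> 'r set) \<Rightarrow> 'r set" where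
  "irrelevant_ideal R D =
     {(\<Oplus>\<^bsub>R\<^esub>i\<in>A. f i) | A f. finite A \<and> A \<subseteq> {0<..} \<and> f \<in> (\<Pi> i\<in>A. D i)}"

definition residue_module :: "('r, 'l) ring_scheme \<Rightarrow> (nat \<Rightarrow> 'r set) \<Rightarrow> ('r, 'r set) module" where
  "residue_module R D = quotient_module (regular_module R) (irrelevant_ideal R D)"

definition graded_module ::
  "('r, 'l) ring_scheme \<Rightarrow> (nat \<Rightarrow> 'r set) \<Rightarrow> ('r, 'a, 'm) module_scheme \<Rightarrow> (int \<Rightarrow> 'a set) \<Rightarrow> bool"
  where
  "graded_module R D M E \<longleftrightarrow>
     Module.module R M \<and> is_direct_sum M E \<and>
     (\<forall>i j. \<forall>r \<in> D i. \<forall>x \<in> E j. r \<odot>\<^bsub>M\<^esub> x \<in> E (int i + j))"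


section \<open>Type, canonical module and residue\<close>

definition restrict_scalars ::
  "('k, 'r, 'l) module_scheme \<Rightarrow> ('r, 'a, 'm) module_scheme \<Rightarrow> ('k, 'a) module" where
  "restrict_scalars R M = \<lparr>carrier = carrier M, mult = mult M, one = one M,
     zero = zero M, add = add M, smult = (\<lambda>c x. structure_map R c \<odot>\<^bsub>M\<^esub> x)\<rparr>"

definition cm_type ::
  "('k, 'm) ring_scheme \<Rightarrow> ('k, 'r, 'l) module_scheme \<Rightarrow> (nat \<Rightarrow> 'r set) \<Rightarrow> enat" where
  "cm_type K R D = vector_dim K (restrict_scalars R
     (Ext R (the_enat (krull_dim R)) (residue_module R D) (regular_module R)))"

text \<open>
  The canonical module of a Cohen--Macaulay positively graded algebra \<open>R\<close> with \<open>\<bbbK> = R/\<mm>\<close>: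
  a finitely generated graded module \<open>C\<close> with \<open>Ext\<^sup>i(\<bbbK>, C) \<cong> \<bbbK>\<close> for \<open>i = dim R\<close> and
  \<open>Ext\<^sup>i(\<bbbK>, C) = 0\<close> otherwise.  The usual normalization, that the first isomorphism is
  homogeneous of degree \<open>0\<close>, is left out: it only selects one of the degree shifts of \<open>C\<close>, all of
  which have the same underlying module and hence the same trace.
\<close>

definition canonical_module ::
  "('r, 'l) ring_scheme \<Rightarrow> (nat \<Rightarrow> 'r set) \<Rightarrow> ('r, 'a, 'm) module_scheme \<Rightarrow> bool" where
  "canonical_module R D C \<longleftrightarrow>
     finitely_generated_module R C \<and> (\<exists>E. graded_module R D C E) \<and>
     (\<forall>i. if enat i = krull_dim R
          then module_isomorphic R (Ext R i (residue_module R D) C) (residue_module R D)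
          else carrier (Ext R i (residue_module R D) C) =
                 {\<zero>\<^bsub>Ext R i (residue_module R D) C\<^esub>})"

text \<open>The ideal generated by the union of the ideals \<open>\<phi>(M)\<close> is their sum.\<close>

definition trace_ideal :: "('r, 'l) ring_scheme \<Rightarrow> ('r, 'a, 'm) module_scheme \<Rightarrow> 'r set" where
  "trace_ideal R M =
     Idl\<^bsub>R\<^esub> (\<Union>\<phi> \<in> module_hom R M (regular_module R). \<phi> ` carrier M)"

text \<open>
  The residue of \<open>R\<close>, as a function of \<open>R\<close> and of a canonical module \<open>C\<close> of \<open>R\<close>.  As \<open>C\<close> is unique
  up to isomorphism (and shift), the value depends only on \<open>R\<close>.
\<close>

definition residue_via :: "('r, 'l) ring_scheme \<Rightarrow> ('r, 'a, 'm) module_scheme \<Rightarrow> enat" where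
  "residue_via R C =
     module_length R (quotient_module (regular_module R) (trace_ideal R C))"

end

theory Submission
  imports Defs
begin

text \<open>
  The algebra is \<open>R = \<bbbK>[x\<^sub>1, \<dots>, x\<^sub>a] / (x\<^sub>1, \<dots>, x\<^sub>a)\<^sup>2 \<otimes> \<bbbK>[y] / (y\<^sup>b)\<close>.  It is finite-dimensional
  over \<open>\<bbbK>\<close> and local, so its dimension is \<open>0\<close> and it is Cohen--Macaulay.  The type is the dimension
  of the socle, which is spanned by \<open>x\<^sub>i y\<^sup>b\<^sup>-\<^sup>1\<close> for \<open>1 \<le> i \<le> a\<close>.  The canonical module is the vector
  space dual \<open>\<omega> = Hom\<^sub>\<bbbK>(R, \<bbbK>)\<close>.  Its trace is the ideal \<open>J = (x\<^sub>1, \<dots>, x\<^sub>a)\<close>.  As \<open>a \<ge> 2\<close>, every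
  functional is the sum of one killed by \<open>x\<^sub>1\<close> and one killed by \<open>x\<^sub>a\<close>, and a homomorphism
  \<open>\<omega> \<rightarrow> R\<close> sends the two into the annihilators of \<open>x\<^sub>1\<close> and \<open>x\<^sub>a\<close> in \<open>R\<close>, both of which are \<open>J\<close>; in the
  other direction one explicit homomorphism has image \<open>J\<close>.  Hence \<open>R / J = \<bbbK>[y] / (y\<^sup>b)\<close> has length \<open>b\<close>.

  The basis is numbered so that multiplication becomes addition: with \<open>t\<^sup>n = x\<^sub>i y\<^sup>j\<close> for
  \<open>n = i b + j\<close>, \<open>x\<^sub>0 = 1\<close> and \<open>n < N = (a + 1) b\<close>, a product \<open>t\<^sup>m t\<^sup>n\<close> is either \<open>t\<^sup>m\<^sup>+\<^sup>n\<close> or \<open>0\<close>.  Giving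
  \<open>t\<^sup>n\<close> the degree \<open>n\<close> grades the algebra.  Everything but the computation of the trace and the
  socle is done for all algebras of this shape, from a predicate that tells which products survive.  Their
  elements are functions on \<open>{..<N}\<close> under a truncated convolution, and reversing the numbering turns
  the dual into functions on \<open>{..<N}\<close> under a convolution of the same kind.

  The homological input is elementary.  Linear algebra over \<open>\<bbbK>\<close> comes from the leading positions of
  the elements of a subspace (\<open>leading_strict_mono\<close>, \<open>extend_functional\<close>): they yield noetherianity,
  resolutions by free modules of finite rank, the length of a quotient and the extension of linear
  functionals.  The latter makes the dual injective, so \<open>Ext\<^sup>i(\<bbbK>, \<omega>) = 0\<close> for \<open>i > 0\<close>
  (\<open>Ext_\<Omega>_vanishes\<close>).  In degree \<open>0\<close> the definition of Ext unfolds to the socle (\<open>Ext_0_socle\<close>),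
  which determines both the type of \<open>R\<close> and \<open>Ext\<^sup>0(\<bbbK>, \<omega>)\<close>.
\<close>

section \<open>Spaces with finitely many separating coordinates\<close>

text \<open>
  Finite-dimensional spaces are given by coordinates instead of a basis: those below consist of
  functions, and the coordinates are values of these functions.
\<close>

locale coordinate_space = Module.module K V + field K for K and V (structure) +
  fixes M :: nat and \<kappa> :: "nat \<Rightarrow> 'c \<Rightarrow> 'a"
  assumes coord_closed: "\<lbrakk>m < M; v \<in> carrier V\<rbrakk> \<Longrightarrow> \<kappa> m v \<in> carrier K"
    and coord_add: "\<lbrakk>m < M; v \<in> carrier V; w \<in> carrier V\<rbrakk> \<Longrightarrow> \<kappa> m (v \<oplus>\<^bsub>V\<^esub> w) = \<kappa> m v \<oplus>\<^bsub>K\<^esub> \<kappa> m w"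
    and coord_smult: "\<lbrakk>m < M; r \<in> carrier K; v \<in> carrier V\<rbrakk> \<Longrightarrow> \<kappa> m (r \<odot>\<^bsub>V\<^esub> v) = r \<otimes>\<^bsub>K\<^esub> \<kappa> m v"
    and coord_separating: "\<lbrakk>v \<in> carrier V; \<And>m. m < M \<Longrightarrow> \<kappa> m v = \<zero>\<^bsub>K\<^esub>\<rbrakk> \<Longrightarrow> v = \<zero>\<^bsub>V\<^esub>"
begin

lemma coord_zero: "m < M \<Longrightarrow> \<kappa> m \<zero>\<^bsub>V\<^esub> = \<zero>\<^bsub>K\<^esub>"
  using coord_smult[of m "\<zero>\<^bsub>K\<^esub>" "\<zero>\<^bsub>V\<^esub>"] coord_closed[of m "\<zero>\<^bsub>V\<^esub>"] by simp

lemma coord_minus: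
  assumes "m < M" "v \<in> carrier V" shows "\<kappa> m (\<ominus>\<^bsub>V\<^esub> v) = \<ominus>\<^bsub>K\<^esub> \<kappa> m v"
proof -
  have "\<kappa> m v \<oplus>\<^bsub>K\<^esub> \<kappa> m (\<ominus>\<^bsub>V\<^esub> v) = \<zero>\<^bsub>K\<^esub>"
    using assms coord_add[of m v "\<ominus>\<^bsub>V\<^esub> v"] by (simp add: M.r_neg coord_zero)
  then show ?thesis
    using assms coord_closed by (metis M.a_inv_closed R.minus_equality R.a_comm)
qed

lemma coord_diff:
  assumes "m < M" "v \<in> carrier V" "w \<in> carrier V"
  shows "\<kappa> m (v \<ominus>\<^bsub>V\<^esub> w) = \<kappa> m v \<ominus>\<^bsub>K\<^esub> \<kappa> m w"
  using assms by (simp add: a_minus_def coord_add coord_minus)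

lemma submoduleD:
  assumes "submodule K S V"
  shows "S \<subseteq> carrier V" "\<zero>\<^bsub>V\<^esub> \<in> S" "\<And>v w. v \<in> S \<Longrightarrow> w \<in> S \<Longrightarrow> v \<oplus>\<^bsub>V\<^esub> w \<in> S"
    "\<And>r v. r \<in> carrier K \<Longrightarrow> v \<in> S \<Longrightarrow> r \<odot>\<^bsub>V\<^esub> v \<in> S"
    "\<And>v. v \<in> S \<Longrightarrow> \<ominus>\<^bsub>V\<^esub> v \<in> S" "\<And>v w. v \<in> S \<Longrightarrow> w \<in> S \<Longrightarrow> v \<ominus>\<^bsub>V\<^esub> w \<in> S"
proof -
  interpret S: submodule K S V by fact
  show sub: "S \<subseteq> carrier V" by (rule S.subset)
  show "\<zero>\<^bsub>V\<^esub> \<in> S" and add: "\<And>v w. v \<in> S \<Longrightarrow> w \<in> S \<Longrightarrow> v \<oplus>\<^bsub>V\<^esub> w \<in> S"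
    and smult: "\<And>r v. r \<in> carrier K \<Longrightarrow> v \<in> S \<Longrightarrow> r \<odot>\<^bsub>V\<^esub> v \<in> S"
    by auto
  show neg: "\<ominus>\<^bsub>V\<^esub> v \<in> S" if "v \<in> S" for v
  proof -
    have "(\<ominus>\<^bsub>K\<^esub> \<one>\<^bsub>K\<^esub>) \<odot>\<^bsub>V\<^esub> v \<in> S" by (rule smult) (simp_all add: that)
    then show ?thesis using that sub smult_minus_1[of v] by (metis subsetD)
  qed
  show "v \<ominus>\<^bsub>V\<^esub> w \<in> S" if "v \<in> S" "w \<in> S" for v w
    using that by (simp add: a_minus_def add neg)
qed

text \<open>
  The positions of the pivots in an echelon form of the subspace \<open>S\<close>; their number is its dimension.
\<close>

definition leading :: "'c set \<Rightarrow> nat set" where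
  "leading S = {m. m < M \<and> (\<exists>s\<in>S. \<kappa> m s \<noteq> \<zero>\<^bsub>K\<^esub> \<and> (\<forall>l<m. \<kappa> l s = \<zero>\<^bsub>K\<^esub>))}"

lemma finite_leading: "finite (leading S)"
  by (rule finite_subset[of _ "{..<M}"]) (auto simp: leading_def)

lemma leading_mono: "S \<subseteq> T \<Longrightarrow> leading S \<subseteq> leading T"
  by (auto simp: leading_def)

lemma leading_nonzero:
  assumes "s \<in> S" "s \<in> carrier V" "s \<noteq> \<zero>\<^bsub>V\<^esub>"
  shows "\<exists>m\<in>leading S. \<kappa> m s \<noteq> \<zero>\<^bsub>K\<^esub>"
proof -
  have ex: "\<exists>m. m < M \<and> \<kappa> m s \<noteq> \<zero>\<^bsub>K\<^esub>" using assms coord_separating by blast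
  define m where "m = (LEAST m. m < M \<and> \<kappa> m s \<noteq> \<zero>\<^bsub>K\<^esub>)"
  have m: "m < M \<and> \<kappa> m s \<noteq> \<zero>\<^bsub>K\<^esub>" unfolding m_def using ex by (rule LeastI_ex)
  have "\<kappa> l s = \<zero>\<^bsub>K\<^esub>" if "l < m" for l
    using that m not_less_Least[of l "\<lambda>m. m < M \<and> \<kappa> m s \<noteq> \<zero>\<^bsub>K\<^esub>"] unfolding m_def by auto
  then show ?thesis using m assms by (auto simp: leading_def)
qed

text \<open>
  Gaussian elimination: subtracting multiples of elements with the right leading position clears the
  coordinates at the pivots one after the other, and later steps do not disturb earlier ones.
\<close>

lemma reduce_modulo_submodule:
  assumes S: "submodule K S V" and v: "v \<in> carrier V"
  shows "\<exists>s\<in>S. \<forall>l\<in>leading S. \<kappa> l (v \<ominus>\<^bsub>V\<^esub> s) = \<zero>\<^bsub>K\<^esub>"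
proof -
  note S' = submoduleD[OF S]
  have "\<exists>s\<in>S. \<forall>l\<in>leading S. l < m \<longrightarrow> \<kappa> l (v \<ominus>\<^bsub>V\<^esub> s) = \<zero>\<^bsub>K\<^esub>" for m
  proof (induction m)
    case 0
    then show ?case using S'(2) by auto
  next
    case (Suc m)
    then obtain s where s: "s \<in> S" "\<And>l. l \<in> leading S \<Longrightarrow> l < m \<Longrightarrow> \<kappa> l (v \<ominus>\<^bsub>V\<^esub> s) = \<zero>\<^bsub>K\<^esub>" by auto
    show ?case
    proof (cases "m \<in> leading S")
      case False
      then show ?thesis using s less_Suc_eq by auto
    next
      case True
      then obtain p where p: "m < M" "p \<in> S" "\<kappa> m p \<noteq> \<zero>\<^bsub>K\<^esub>" "\<And>l. l < m \<Longrightarrow> \<kappa> l p = \<zero>\<^bsub>K\<^esub>"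
        by (auto simp: leading_def)
      have car: "p \<in> carrier V" "s \<in> carrier V" "v \<ominus>\<^bsub>V\<^esub> s \<in> carrier V" using S'(1) p s v by auto
      \<comment> \<open>the multiple of the pivot element \<open>p\<close> that agrees with \<open>v - s\<close> at position \<open>m\<close>\<close>
      define c where "c = \<kappa> m (v \<ominus>\<^bsub>V\<^esub> s) \<otimes>\<^bsub>K\<^esub> inv\<^bsub>K\<^esub> (\<kappa> m p)"
      have pK: "\<kappa> m p \<in> carrier K" "\<kappa> m (v \<ominus>\<^bsub>V\<^esub> s) \<in> carrier K" using p car by (auto simp: coord_closed)
      then have u: "\<kappa> m p \<in> Units K" using p(3) field_Units by auto
      then have c: "c \<in> carrier K" using pK by (simp add: c_def)
      have cm: "c \<otimes>\<^bsub>K\<^esub> \<kappa> m p = \<kappa> m (v \<ominus>\<^bsub>V\<^esub> s)"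
        using u pK by (simp add: c_def R.m_assoc)
      define t where "t = s \<oplus>\<^bsub>V\<^esub> c \<odot>\<^bsub>V\<^esub> p"
      have t: "t \<in> S" using S' s p c by (auto simp: t_def)
      have diff: "v \<ominus>\<^bsub>V\<^esub> t = (v \<ominus>\<^bsub>V\<^esub> s) \<ominus>\<^bsub>V\<^esub> c \<odot>\<^bsub>V\<^esub> p"
        using v car c unfolding t_def a_minus_def by (simp add: M.minus_add M.a_ac)
      have "\<kappa> l (v \<ominus>\<^bsub>V\<^esub> t) = \<zero>\<^bsub>K\<^esub>" if l: "l \<in> leading S" "l < Suc m" for l
      proof (cases "l = m")
        case True
        then show ?thesis unfolding diff using p car c cm pK
          by (simp add: coord_diff coord_smult R.minus_other_side)
      next
        case False
        then have "l < m" "l < M" using l p by auto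
        then show ?thesis unfolding diff using p(4) s(2)[OF l(1)] car c
          by (simp add: coord_diff coord_smult R.minus_other_side)
      qed
      then show ?thesis using t by auto
    qed
  qed
  from this[of M] show ?thesis by (auto simp: leading_def)
qed

lemma zero_if_leading_coords_vanish:
  assumes "submodule K S V" "s \<in> S" "\<And>l. l \<in> leading S \<Longrightarrow> \<kappa> l s = \<zero>\<^bsub>K\<^esub>"
  shows "s = \<zero>\<^bsub>V\<^esub>"
  using assms leading_nonzero[of s S] submoduleD(1)[OF assms(1)] by blast

text \<open>
  Reducing an element of \<open>T\<close> modulo \<open>S\<close> leaves an element of \<open>T\<close> that vanishes at all pivots of \<open>T\<close>,
  hence zero.
\<close>

lemma submodule_eq_if_leading_eq:
  assumes S: "submodule K S V" and T: "submodule K T V" and sub: "S \<subseteq> T" "leading T \<subseteq> leading S"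
  shows "S = T"
proof
  show "T \<subseteq> S"
  proof
    fix v assume v: "v \<in> T"
    then have vV: "v \<in> carrier V" using submoduleD(1)[OF T] by auto
    obtain s where s: "s \<in> S" "\<And>l. l \<in> leading S \<Longrightarrow> \<kappa> l (v \<ominus>\<^bsub>V\<^esub> s) = \<zero>\<^bsub>K\<^esub>"
      using reduce_modulo_submodule[OF S vV] by auto
    have "v \<ominus>\<^bsub>V\<^esub> s = \<zero>\<^bsub>V\<^esub>"
      by (rule zero_if_leading_coords_vanish[OF T]) (use v s sub submoduleD(6)[OF T] in auto)
    then have "v = s" using vV s submoduleD(1)[OF S] by (auto simp: M.minus_other_side)
    then show "v \<in> S" using s by simp
  qed
qed (rule sub)

lemma leading_strict_mono:
  assumes "submodule K S V" "submodule K T V" "S \<subset> T"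
  shows "leading S \<subset> leading T"
  using submodule_eq_if_leading_eq[OF assms(1,2)] leading_mono[of S T] assms(3) by auto

text \<open>
  The ascending chain condition as an induction rule.  A class of subspaces that contains some
  subspace of \<open>S\<close>, and together with each proper subspace of \<open>S\<close> a larger one inside \<open>S\<close>, contains \<open>S\<close>,
  because the number of pivots grows and is bounded.  All finite generation results below are
  instances, with \<open>Q\<close> the class of the subspaces that are finitely generated over a larger ring.
\<close>

lemma submodule_growth_induct:
  assumes S: "submodule K S V"
    and sub: "\<And>T. Q T \<Longrightarrow> submodule K T V"
    and start: "Q T0" "T0 \<subseteq> S"
    and step: "\<And>T s. \<lbrakk>Q T; T \<subseteq> S; s \<in> S; s \<notin> T\<rbrakk> \<Longrightarrow> \<exists>T'. Q T' \<and> T \<subset> T' \<and> T' \<subseteq> S"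
  shows "Q S"
proof -
  have "Q T \<Longrightarrow> T \<subseteq> S \<Longrightarrow> Q S" for T
  proof (induction "card (leading S) - card (leading T)" arbitrary: T rule: less_induct)
    case less
    show ?case
    proof (cases "S \<subseteq> T")
      case True
      then have "T = S" using less.prems(2) by simp
      then show ?thesis using less.prems(1) by simp
    next
      case False
      then obtain s where s: "s \<in> S" "s \<notin> T" by blast
      obtain T' where T': "Q T'" "T \<subset> T'" "T' \<subseteq> S" using step[OF less.prems s] by (elim exE conjE)
      have "card (leading T) < card (leading T')"
        by (rule psubset_card_mono[OF finite_leading
              leading_strict_mono[OF sub[OF less.prems(1)] sub[OF T'(1)] T'(2)]])
      moreover have "card (leading T') \<le> card (leading S)"
        by (rule card_mono[OF finite_leading leading_mono[OF T'(3)]])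
      ultimately have "card (leading S) - card (leading T') < card (leading S) - card (leading T)"
        by linarith
      then show ?thesis using T'(1,3) by (rule less.hyps)
    qed
  qed
  then show ?thesis using start .
qed

text \<open>
  The vectors that vanish at the pivots of \<open>S\<close> form a complement of \<open>S\<close>.  The extension is \<open>h\<close> composed
  with the projection \<open>\<pi>\<close> along this complement.
\<close>

lemma extend_functional:
  assumes S: "submodule K S V"
    and h: "\<And>s. s \<in> S \<Longrightarrow> h s \<in> carrier K"
      "\<And>s t. \<lbrakk>s \<in> S; t \<in> S\<rbrakk> \<Longrightarrow> h (s \<oplus>\<^bsub>V\<^esub> t) = h s \<oplus>\<^bsub>K\<^esub> h t"
      "\<And>r s. \<lbrakk>r \<in> carrier K; s \<in> S\<rbrakk> \<Longrightarrow> h (r \<odot>\<^bsub>V\<^esub> s) = r \<otimes>\<^bsub>K\<^esub> h s"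
  obtains g where "\<And>v. v \<in> carrier V \<Longrightarrow> g v \<in> carrier K"
    "\<And>v w. \<lbrakk>v \<in> carrier V; w \<in> carrier V\<rbrakk> \<Longrightarrow> g (v \<oplus>\<^bsub>V\<^esub> w) = g v \<oplus>\<^bsub>K\<^esub> g w"
    "\<And>r v. \<lbrakk>r \<in> carrier K; v \<in> carrier V\<rbrakk> \<Longrightarrow> g (r \<odot>\<^bsub>V\<^esub> v) = r \<otimes>\<^bsub>K\<^esub> g v"
    "\<And>s. s \<in> S \<Longrightarrow> g s = h s"
proof -
  note S' = submoduleD[OF S]
  have Lt: "l < M" if "l \<in> leading S" for l using that by (simp add: leading_def)
  define \<pi> where "\<pi> v = (SOME s. s \<in> S \<and> (\<forall>l\<in>leading S. \<kappa> l (v \<ominus>\<^bsub>V\<^esub> s) = \<zero>\<^bsub>K\<^esub>))" for v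
  have \<pi>: "\<pi> v \<in> S \<and> (\<forall>l\<in>leading S. \<kappa> l (v \<ominus>\<^bsub>V\<^esub> \<pi> v) = \<zero>\<^bsub>K\<^esub>)" if "v \<in> carrier V" for v
    unfolding \<pi>_def by (rule someI_ex) (use reduce_modulo_submodule[OF S that] in blast)
  have \<pi>S: "\<pi> v \<in> S" and \<pi>V: "\<pi> v \<in> carrier V" if "v \<in> carrier V" for v using \<pi>[OF that] S'(1) by auto
  have \<pi>l: "\<kappa> l (\<pi> v) = \<kappa> l v" if "v \<in> carrier V" "l \<in> leading S" for v l
  proof -
    have "\<kappa> l v \<ominus>\<^bsub>K\<^esub> \<kappa> l (\<pi> v) = \<zero>\<^bsub>K\<^esub>"
      using \<pi>[OF that(1)] that Lt[OF that(2)] \<pi>V[OF that(1)] by (simp flip: coord_diff)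
    then show ?thesis using that Lt[OF that(2)] \<pi>V[OF that(1)] by (simp add: coord_closed)
  qed
  have uniq: "\<pi> v = s" if "v \<in> carrier V" "s \<in> S" "\<And>l. l \<in> leading S \<Longrightarrow> \<kappa> l s = \<kappa> l v" for v s
  proof -
    have sV: "s \<in> carrier V" using that S' by auto
    have "\<pi> v \<ominus>\<^bsub>V\<^esub> s = \<zero>\<^bsub>V\<^esub>"
      by (rule zero_if_leading_coords_vanish[OF S])
        (use that sV \<pi>V in \<open>simp_all add: S'(6) \<pi>S \<pi>l Lt coord_diff coord_closed\<close>)
    then show ?thesis using that sV \<pi>V by (simp add: M.minus_other_side)
  qed
  show thesis
  proof (rule that[of "\<lambda>v. h (\<pi> v)"])
    show "h (\<pi> v) \<in> carrier K" if "v \<in> carrier V" for v using that by (simp add: h \<pi>S)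
    show "h (\<pi> (v \<oplus>\<^bsub>V\<^esub> w)) = h (\<pi> v) \<oplus>\<^bsub>K\<^esub> h (\<pi> w)" if "v \<in> carrier V" "w \<in> carrier V" for v w
    proof -
      have "\<pi> (v \<oplus>\<^bsub>V\<^esub> w) = \<pi> v \<oplus>\<^bsub>V\<^esub> \<pi> w"
        by (rule uniq) (use that in \<open>simp_all add: S'(3) \<pi>S \<pi>V \<pi>l Lt coord_add\<close>)
      then show ?thesis using that by (simp add: h \<pi>S)
    qed
    show "h (\<pi> (r \<odot>\<^bsub>V\<^esub> v)) = r \<otimes>\<^bsub>K\<^esub> h (\<pi> v)" if "r \<in> carrier K" "v \<in> carrier V" for r v
    proof -
      have "\<pi> (r \<odot>\<^bsub>V\<^esub> v) = r \<odot>\<^bsub>V\<^esub> \<pi> v"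
        by (rule uniq) (use that in \<open>simp_all add: S'(4) \<pi>S \<pi>V \<pi>l Lt coord_smult\<close>)
      then show ?thesis using that by (simp add: h \<pi>S)
    qed
    show "h (\<pi> s) = h s" if "s \<in> S" for s
    proof -
      have "\<pi> s = s" by (rule uniq) (use that S' in auto)
      then show ?thesis by simp
    qed
  qed
qed

end

section \<open>Coefficient vectors and truncated convolution\<close>

text \<open>
  The product of two polynomials truncated at degree \<open>N\<close>, from which the terms of bidegree \<open>(i, j)\<close>
  with \<open>w i j\<close> false are dropped.
\<close>

definition conv :: "('k, 'm) ring_scheme \<Rightarrow> nat \<Rightarrow> (nat \<Rightarrow> nat \<Rightarrow> bool) \<Rightarrow> (nat \<Rightarrow> 'k) \<Rightarrow> (nat \<Rightarrow> 'k) \<Rightarrow> nat \<Rightarrow> 'k"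
  where "conv K N w f g =
    (\<lambda>k\<in>{..<N}. \<Oplus>\<^bsub>K\<^esub>i\<in>{..k}. if w i (k - i) then f i \<otimes>\<^bsub>K\<^esub> g (k - i) else \<zero>\<^bsub>K\<^esub>)"

locale coefficient_space = field K for K (structure) + fixes N :: nat
begin

abbreviation V where "V \<equiv> func_space {..<N}"

definition monom :: "nat \<Rightarrow> nat \<Rightarrow> 'a" where
  "monom n = (\<lambda>k\<in>{..<N}. if k = n then \<one> else \<zero>)"

lemma carrier_V: "carrier V = {..<N} \<rightarrow>\<^sub>E carrier K"
  by (simp add: func_space_def)

lemma coeff_closed [simp]: "f \<in> carrier V \<Longrightarrow> k < N \<Longrightarrow> f k \<in> carrier K"
  by (auto simp: carrier_V)

lemma V_eqI: "\<lbrakk>f \<in> carrier V; g \<in> carrier V; \<And>k. k < N \<Longrightarrow> f k = g k\<rbrakk> \<Longrightarrow> f = g"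
  unfolding carrier_V by (rule PiE_ext) auto

lemma V_memI: "(\<And>k. k < N \<Longrightarrow> f k \<in> carrier K) \<Longrightarrow> (\<lambda>k\<in>{..<N}. f k) \<in> carrier V"
  by (auto simp: carrier_V)

lemma V_add [simp]: "k < N \<Longrightarrow> (f \<oplus>\<^bsub>V\<^esub> g) k = f k \<oplus> g k"
  and V_smult [simp]: "k < N \<Longrightarrow> (a \<odot>\<^bsub>V\<^esub> f) k = a \<otimes> f k"
  and V_zero [simp]: "k < N \<Longrightarrow> \<zero>\<^bsub>V\<^esub> k = \<zero>"
  by (auto simp: func_space_def)

sublocale V: Module.module K V
  by (rule func_space_is_module)

lemma V_uminus: "f \<in> carrier V \<Longrightarrow> k < N \<Longrightarrow> (\<ominus>\<^bsub>V\<^esub> f) k = \<ominus> f k"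
  by (simp add: func_space_neg)

lemma monom_closed [simp]: "monom n \<in> carrier V"
  by (auto simp: monom_def carrier_V)

lemma monom_coeff [simp]: "k < N \<Longrightarrow> monom n k = (if k = n then \<one> else \<zero>)"
  by (simp add: monom_def)

text \<open>
  Identities that are linear in a vector need to be checked on the basis only; this replaces most
  manipulations of iterated sums.
\<close>

lemma monom_induct [consumes 1, case_names zero add monom]:
  assumes f: "f \<in> carrier V"
    and zero: "P \<zero>\<^bsub>V\<^esub>"
    and add: "\<And>f g. \<lbrakk>f \<in> carrier V; g \<in> carrier V; P f; P g\<rbrakk> \<Longrightarrow> P (f \<oplus>\<^bsub>V\<^esub> g)"
    and monom: "\<And>a n. \<lbrakk>a \<in> carrier K; n < N\<rbrakk> \<Longrightarrow> P (a \<odot>\<^bsub>V\<^esub> monom n)"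
  shows "P f"
proof -
  have "P f" if "f \<in> carrier V" "\<And>k. m \<le> k \<Longrightarrow> k < N \<Longrightarrow> f k = \<zero>" for f m
    using that
  proof (induction m arbitrary: f)
    case 0
    then have "f = \<zero>\<^bsub>V\<^esub>" by (intro V_eqI) auto
    then show ?case using zero by simp
  next
    case (Suc m)
    show ?case
    proof (cases "m < N")
      case False
      then show ?thesis using Suc by auto
    next
      case True
      define g where "g = (\<lambda>k\<in>{..<N}. if k = m then \<zero> else f k)"
      have g: "g \<in> carrier V" unfolding g_def using Suc.prems(1) by (intro V_memI) auto
      have "g k = \<zero>" if "m \<le> k" "k < N" for k using Suc.prems that by (auto simp: g_def)
      then have "P g" using g by (intro Suc.IH) auto
      moreover have "f = g \<oplus>\<^bsub>V\<^esub> f m \<odot>\<^bsub>V\<^esub> monom m"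
        using Suc.prems g True by (intro V_eqI) (auto simp: g_def)
      moreover have "P (f m \<odot>\<^bsub>V\<^esub> monom m)" "f m \<odot>\<^bsub>V\<^esub> monom m \<in> carrier V"
        using True Suc.prems(1) by (auto intro: monom)
      ultimately show ?thesis using add[OF g] by metis
    qed
  qed
  from this[of f N] f show ?thesis by simp
qed

abbreviation cnv where "cnv \<equiv> conv K N"

lemma conv_coeff:
  "k < N \<Longrightarrow> cnv w f g k = (\<Oplus>i\<in>{..k}. if w i (k - i) then f i \<otimes> g (k - i) else \<zero>)"
  by (simp add: conv_def)

lemma conv_closed [simp]: "f \<in> carrier V \<Longrightarrow> g \<in> carrier V \<Longrightarrow> cnv w f g \<in> carrier V"
  unfolding conv_def by (rule V_memI) (auto intro!: finsum_closed)

lemma conv_add_left: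
  assumes "f \<in> carrier V" "f' \<in> carrier V" "g \<in> carrier V"
  shows "cnv w (f \<oplus>\<^bsub>V\<^esub> f') g = cnv w f g \<oplus>\<^bsub>V\<^esub> cnv w f' g"
proof (rule V_eqI)
  fix k assume k: "k < N"
  have "cnv w (f \<oplus>\<^bsub>V\<^esub> f') g k = (\<Oplus>i\<in>{..k}. (if w i (k - i) then f i \<otimes> g (k - i) else \<zero>) \<oplus>
      (if w i (k - i) then f' i \<otimes> g (k - i) else \<zero>))"
    unfolding conv_coeff[OF k] using assms k
    by (intro finsum_cong') (auto simp: l_distr)
  also have "\<dots> = cnv w f g k \<oplus> cnv w f' g k"
    unfolding conv_coeff[OF k] using assms k by (intro finsum_addf) auto
  finally show "cnv w (f \<oplus>\<^bsub>V\<^esub> f') g k = (cnv w f g \<oplus>\<^bsub>V\<^esub> cnv w f' g) k" using k by simp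
qed (use assms in auto)

lemma conv_smult_left:
  assumes "a \<in> carrier K" "f \<in> carrier V" "g \<in> carrier V"
  shows "cnv w (a \<odot>\<^bsub>V\<^esub> f) g = a \<odot>\<^bsub>V\<^esub> cnv w f g"
proof (rule V_eqI)
  fix k assume k: "k < N"
  have "cnv w (a \<odot>\<^bsub>V\<^esub> f) g k = (\<Oplus>i\<in>{..k}. a \<otimes> (if w i (k - i) then f i \<otimes> g (k - i) else \<zero>))"
    unfolding conv_coeff[OF k] using assms k
    by (intro finsum_cong') (auto simp: m_assoc)
  also have "\<dots> = a \<otimes> cnv w f g k"
    unfolding conv_coeff[OF k] using assms k by (intro finsum_rdistr[symmetric]) auto
  finally show "cnv w (a \<odot>\<^bsub>V\<^esub> f) g k = (a \<odot>\<^bsub>V\<^esub> cnv w f g) k" using k by simp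
qed (use assms in auto)

lemma conv_commute:
  assumes "f \<in> carrier V" "g \<in> carrier V" "\<And>i j. i + j < N \<Longrightarrow> w i j = w' j i"
  shows "cnv w f g = cnv w' g f"
proof (rule V_eqI)
  fix k assume k: "k < N"
  have inj: "inj_on (\<lambda>i. k - i) {..k}" by (auto simp: inj_on_def)
  have img: "(\<lambda>i. k - i) ` {..k} = {..k}" 
  proof (intro equalityI subsetI)
    show "i \<in> (\<lambda>i. k - i) ` {..k}" if "i \<in> {..k}" for i
      using that by (intro image_eqI[of _ _ "k - i"]) auto
  qed auto
  have "cnv w' g f k = (\<Oplus>i\<in>(\<lambda>i. k - i) ` {..k}. if w' i (k - i) then g i \<otimes> f (k - i) else \<zero>)"
    by (simp only: img conv_coeff[OF k])
  also have "\<dots> = (\<Oplus>i\<in>{..k}. if w' (k - i) (k - (k - i)) then g (k - i) \<otimes> f (k - (k - i)) else \<zero>)"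
    using assms k by (intro finsum_reindex inj) auto
  also have "\<dots> = cnv w f g k"
    unfolding conv_coeff[OF k]
  proof (intro finsum_cong')
    fix i assume "i \<in> {..k}"
    then show "(if w' (k - i) (k - (k - i)) then g (k - i) \<otimes> f (k - (k - i)) else \<zero>) =
        (if w i (k - i) then f i \<otimes> g (k - i) else \<zero>)"
      using assms(1,2) assms(3)[of i "k - i"] k by (simp add: m_comm)
  qed (use assms(1,2) k in auto)
  finally show "cnv w f g k = cnv w' g f k" by simp
qed (use assms in auto)

lemma conv_add_right:
  assumes "f \<in> carrier V" "g \<in> carrier V" "g' \<in> carrier V"
  shows "cnv w f (g \<oplus>\<^bsub>V\<^esub> g') = cnv w f g \<oplus>\<^bsub>V\<^esub> cnv w f g'"
  using assms by (simp add: conv_commute[of f _ w "\<lambda>i j. w j i"] conv_add_left)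

lemma conv_smult_right:
  assumes "a \<in> carrier K" "f \<in> carrier V" "g \<in> carrier V"
  shows "cnv w f (a \<odot>\<^bsub>V\<^esub> g) = a \<odot>\<^bsub>V\<^esub> cnv w f g"
  using assms by (simp add: conv_commute[of f _ w "\<lambda>i j. w j i"] conv_smult_left)

lemma conv_monom_coeff:
  assumes "g \<in> carrier V" "k < N" "n < N"
  shows "cnv w (monom n) g k = (if n \<le> k \<and> w n (k - n) then g (k - n) else \<zero>)"
proof -
  have "cnv w (monom n) g k = (\<Oplus>i\<in>{..k}. if n = i then (if w i (k - i) then g (k - i) else \<zero>) else \<zero>)"
    unfolding conv_coeff[OF assms(2)] using assms by (intro finsum_cong') auto
  also have "\<dots> = (if n \<le> k \<and> w n (k - n) then g (k - n) else \<zero>)"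
  proof (cases "n \<le> k")
    case True
    then show ?thesis using assms by (subst finsum_singleton) auto
  next
    case False
    then have "(\<Oplus>i\<in>{..k}. if n = i then (if w i (k - i) then g (k - i) else \<zero>) else \<zero>) = (\<Oplus>i\<in>{..k}. \<zero>)"
      by (intro finsum_cong') auto
    then show ?thesis using False by simp
  qed
  finally show ?thesis .
qed

lemma conv_coeff_zeroI:
  assumes "f \<in> carrier V" "g \<in> carrier V" "k < N"
    and "\<And>i. i \<le> k \<Longrightarrow> w i (k - i) \<Longrightarrow> f i = \<zero> \<or> g (k - i) = \<zero>"
  shows "cnv w f g k = \<zero>"
proof -
  have "(if w i (k - i) then f i \<otimes> g (k - i) else \<zero>) = \<zero>" if "i \<in> {..k}" for i
    using assms(4)[of i] assms(1-3) that by auto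
  then have "cnv w f g k = (\<Oplus>i\<in>{..k}. \<zero>)"
    unfolding conv_coeff[OF assms(3)] by (intro finsum_cong') auto
  then show ?thesis by simp
qed

lemma conv_zero_left [simp]: "g \<in> carrier V \<Longrightarrow> cnv w \<zero>\<^bsub>V\<^esub> g = \<zero>\<^bsub>V\<^esub>"
  using conv_smult_left[of \<zero> "\<zero>\<^bsub>V\<^esub>" g w] by (simp add: V.smult_l_null)

lemma conv_zero_right [simp]: "f \<in> carrier V \<Longrightarrow> cnv w f \<zero>\<^bsub>V\<^esub> = \<zero>\<^bsub>V\<^esub>"
  using conv_smult_right[of \<zero> f "\<zero>\<^bsub>V\<^esub>" w] by (simp add: V.smult_l_null)

lemma conv_one:
  assumes "g \<in> carrier V" "\<And>j. j < N \<Longrightarrow> w 0 j"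
  shows "cnv w (monom 0) g = g"
proof (cases "N = 0")
  case True
  then show ?thesis using conv_closed[OF monom_closed assms(1)] assms(1) by (intro V_eqI) simp_all
next
  case False
  then show ?thesis using assms by (intro V_eqI) (auto simp: conv_monom_coeff)
qed

text \<open>
  The weights are allowed to differ because the same statement, with suitable weights, is the
  associative law of the algebra and the compatibility of its action on the dual.
\<close>

lemma conv_assoc:
  assumes carr: "f \<in> carrier V" "g \<in> carrier V" "h \<in> carrier V"
    and w: "\<And>i j k. i + j + k < N \<Longrightarrow> w1 i j \<and> w2 (i + j) k \<longleftrightarrow> w3 j k \<and> w4 i (j + k)"
  shows "cnv w2 (cnv w1 f g) h = cnv w4 f (cnv w3 g h)"
proof -
  have mm: "cnv w2 (cnv w1 (monom i) (monom j)) h = cnv w4 (monom i) (cnv w3 (monom j) h)"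
    if ij: "i < N" "j < N" for i j
  proof (rule V_eqI)
    fix k assume k: "k < N"
    show "cnv w2 (cnv w1 (monom i) (monom j)) h k = cnv w4 (monom i) (cnv w3 (monom j) h) k"
    proof (cases "i + j < N \<and> w1 i j")
      case True
      then have "cnv w1 (monom i) (monom j) = monom (i + j)"
        using ij by (intro V_eqI) (auto simp: conv_monom_coeff)
      then show ?thesis using True ij k carr w[of i j "k - i - j"]
        by (auto simp: conv_monom_coeff)
    next
      case False
      then have "cnv w1 (monom i) (monom j) = \<zero>\<^bsub>V\<^esub>"
        using ij by (intro V_eqI) (auto simp: conv_monom_coeff)
      then show ?thesis using False ij k carr w[of i j "k - i - j"]
        by (auto simp: conv_monom_coeff)
    qed
  qed (use carr in auto)
  have "cnv w2 (cnv w1 (monom i) g) h = cnv w4 (monom i) (cnv w3 g h)" if "i < N" for i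
    using carr(2)
    by (induction g rule: monom_induct)
      (use that carr in \<open>simp_all add: mm conv_add_left conv_add_right conv_smult_left conv_smult_right\<close>)
  with carr(1) show ?thesis
    by (induction f rule: monom_induct)
      (use carr in \<open>simp_all add: conv_add_left conv_add_right conv_smult_left conv_smult_right\<close>)
qed

text \<open>
  The degree is an arbitrary function of the position since the algebra is graded by natural numbers
  but its modules by integers.
\<close>

definition degree_part :: "(nat \<Rightarrow> 'i) \<Rightarrow> 'i \<Rightarrow> (nat \<Rightarrow> 'a) set" where
  "degree_part \<delta> d = {f \<in> carrier V. \<forall>k<N. \<delta> k \<noteq> d \<longrightarrow> f k = \<zero>}"

lemma finsum_V_closed: "F \<in> I \<rightarrow> carrier V \<Longrightarrow> (\<Oplus>\<^bsub>V\<^esub>i\<in>I. F i) \<in> carrier V"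
  by (rule V.M.finsum_closed)

lemma finsum_V_coeff:
  assumes "finite I" "F \<in> I \<rightarrow> carrier V" "k < N"
  shows "(\<Oplus>\<^bsub>V\<^esub>i\<in>I. F i) k = (\<Oplus>i\<in>I. F i k)"
  using assms
proof (induction I)
  case (insert x I)
  then have "(\<Oplus>\<^bsub>V\<^esub>i\<in>insert x I. F i) = F x \<oplus>\<^bsub>V\<^esub> (\<Oplus>\<^bsub>V\<^esub>i\<in>I. F i)"
    by (intro V.M.finsum_insert) auto
  moreover have "(\<Oplus>i\<in>insert x I. F i k) = F x k \<oplus> (\<Oplus>i\<in>I. F i k)"
    using insert by (intro finsum_insert) (auto intro!: coeff_closed simp: Pi_iff)
  ultimately show ?case using insert by auto
qed auto

lemma degree_part_subgroup: "additive_subgroup (degree_part \<delta> d) V"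
proof (rule additive_subgroup.intro, rule V.add.subgroupI)
  show "degree_part \<delta> d \<noteq> {}" using V.M.zero_closed V_zero by (fastforce simp: degree_part_def)
  fix f assume f: "f \<in> degree_part \<delta> d"
  then show "\<ominus>\<^bsub>V\<^esub> f \<in> degree_part \<delta> d" by (auto simp: degree_part_def V_uminus)
  fix g assume "g \<in> degree_part \<delta> d"
  then show "f \<oplus>\<^bsub>V\<^esub> g \<in> degree_part \<delta> d" using f by (auto simp: degree_part_def)
qed (auto simp: degree_part_def)

lemma V_direct_sum:
  assumes inj: "inj_on \<delta> {..<N}"
  shows "is_direct_sum V (degree_part \<delta>)"
  unfolding is_direct_sum_def
proof (intro conjI allI ballI)
  show "additive_subgroup (degree_part \<delta> d) V" for d by (rule degree_part_subgroup)
  fix x assume x: "x \<in> carrier V"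
  have coeff: "(\<Oplus>\<^bsub>V\<^esub>i\<in>{i. F i \<noteq> \<zero>\<^bsub>V\<^esub>}. F i) k = F (\<delta> k) k"
    if F: "\<forall>i. F i \<in> degree_part \<delta> i" "finite {i. F i \<noteq> \<zero>\<^bsub>V\<^esub>}" and k: "k < N" for F k
  proof -
    have FV: "F i \<in> carrier V" for i using F(1) by (simp add: degree_part_def)
    have F0: "F i k = \<zero>" if "i \<noteq> \<delta> k" for i using F(1) that k by (simp add: degree_part_def)
    have "(\<Oplus>\<^bsub>V\<^esub>i\<in>{i. F i \<noteq> \<zero>\<^bsub>V\<^esub>}. F i) k = (\<Oplus>i\<in>{i. F i \<noteq> \<zero>\<^bsub>V\<^esub>}. F i k)"
      by (rule finsum_V_coeff[OF F(2) _ k]) (simp add: FV)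
    also have "\<dots> = (\<Oplus>i\<in>{i. F i \<noteq> \<zero>\<^bsub>V\<^esub>}. if \<delta> k = i then F i k else \<zero>)"
      using FV F0 k by (intro finsum_cong') (simp_all add: eq_commute)
    also have "\<dots> = F (\<delta> k) k"
    proof (cases "F (\<delta> k) = \<zero>\<^bsub>V\<^esub>")
      case True
      then have "(\<Oplus>i\<in>{i. F i \<noteq> \<zero>\<^bsub>V\<^esub>}. if \<delta> k = i then F i k else \<zero>) = (\<Oplus>i\<in>{i. F i \<noteq> \<zero>\<^bsub>V\<^esub>}. \<zero>)"
        by (intro finsum_cong') auto
      then show ?thesis using True k by simp
    next
      case False
      then show ?thesis using FV F(2) k by (subst finsum_singleton) auto
    qed
    finally show ?thesis .
  qed
  define F where "F i = (\<lambda>k\<in>{..<N}. if \<delta> k = i then x k else \<zero>)" for i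
  have F: "\<forall>i. F i \<in> degree_part \<delta> i"
    unfolding degree_part_def F_def using x by (auto intro!: V_memI)
  have fin: "finite {i. F i \<noteq> \<zero>\<^bsub>V\<^esub>}"
  proof (rule finite_subset)
    show "{i. F i \<noteq> \<zero>\<^bsub>V\<^esub>} \<subseteq> \<delta> ` {..<N}"
    proof
      fix i assume i: "i \<in> {i. F i \<noteq> \<zero>\<^bsub>V\<^esub>}"
      show "i \<in> \<delta> ` {..<N}"
      proof (rule ccontr)
        assume "i \<notin> \<delta> ` {..<N}"
        then have "F i = \<zero>\<^bsub>V\<^esub>" using spec[OF F, of i]
          by (intro V_eqI) (auto simp: F_def degree_part_def)
        then show False using i by simp
      qed
    qed
  qed simp
  have FC: "F \<in> I \<rightarrow> carrier V" for I using F by (simp add: degree_part_def)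
  show "\<exists>!F. (\<forall>i. F i \<in> degree_part \<delta> i) \<and> finite {i. F i \<noteq> \<zero>\<^bsub>V\<^esub>} \<and> x = (\<Oplus>\<^bsub>V\<^esub>i\<in>{i. F i \<noteq> \<zero>\<^bsub>V\<^esub>}. F i)"
  proof (rule ex1I[of _ F])
    have "x k = (\<Oplus>\<^bsub>V\<^esub>i\<in>{i. F i \<noteq> \<zero>\<^bsub>V\<^esub>}. F i) k" if "k < N" for k
      using coeff[of F k, OF F fin that] that by (simp add: F_def)
    then have "x = (\<Oplus>\<^bsub>V\<^esub>i\<in>{i. F i \<noteq> \<zero>\<^bsub>V\<^esub>}. F i)"
      by (rule V_eqI[OF x finsum_V_closed[OF FC]])
    then show "(\<forall>i. F i \<in> degree_part \<delta> i) \<and> finite {i. F i \<noteq> \<zero>\<^bsub>V\<^esub>} \<and> x = (\<Oplus>\<^bsub>V\<^esub>i\<in>{i. F i \<noteq> \<zero>\<^bsub>V\<^esub>}. F i)"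
      using F fin by (intro conjI)
    fix G assume G: "(\<forall>i. G i \<in> degree_part \<delta> i) \<and> finite {i. G i \<noteq> \<zero>\<^bsub>V\<^esub>} \<and> x = (\<Oplus>\<^bsub>V\<^esub>i\<in>{i. G i \<noteq> \<zero>\<^bsub>V\<^esub>}. G i)"
    note G' = spec[OF conjunct1[OF G]] conjunct1[OF conjunct2[OF G]] conjunct2[OF conjunct2[OF G]]
    show "G = F"
    proof
      fix i
      have eq: "G i k = F i k" if "k < N" for k
      proof (cases "\<delta> k = i")
        case True
        have "x k = G (\<delta> k) k" using coeff[of G k, OF conjunct1[OF G] G'(2) that] by (subst G'(3))
        then show ?thesis using True that by (simp add: F_def)
      next
        case False
        then show ?thesis using G'(1)[of i] spec[OF F, of i] that by (simp add: degree_part_def)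
      qed
      have "G i \<in> carrier V" "F i \<in> carrier V"
        using G'(1)[of i] spec[OF F, of i] by (simp_all add: degree_part_def)
      then show "G i = F i" by (rule V_eqI) (rule eq)
    qed
  qed
qed

lemma vectorspace_V: "vectorspace K V"
  by (simp add: vectorspace_def V.module_axioms field_axioms)

lemma dim_V: "vectorspace.fin_dim K V" "vectorspace.dim K V = N"
proof -
  interpret W: vectorspace K V by (rule vectorspace_V)
  let ?B = "monom ` {..<N}"
  have inj: "inj_on monom {..<N}"
  proof (rule inj_onI)
    fix i j assume ij: "i \<in> {..<N}" "j \<in> {..<N}" "monom i = monom j"
    have "monom i i = monom j i" by (rule fun_cong[OF ij(3)])
    then show "i = j" using ij(1,2) by (simp split: if_splits)
  qed
  have fin: "finite ?B" by simp
  have sub: "?B \<subseteq> carrier V" by (rule image_subsetI) simp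
  have coeff: "V.lincomb x ?B k = x (monom k)" if x: "x \<in> ?B \<rightarrow> carrier K" and k: "k < N" for x k
  proof -
    have xc: "x v \<in> carrier K" "v \<in> carrier V" if "v \<in> ?B" for v using x sub that by blast+
    have "V.lincomb x ?B k = (\<Oplus>v\<in>?B. (x v \<odot>\<^bsub>V\<^esub> v) k)"
      unfolding V.lincomb_def by (rule finsum_V_coeff[OF fin _ k]) (simp add: Pi_iff xc)
    also have "\<dots> = (\<Oplus>v\<in>?B. if monom k = v then x v else \<zero>)"
    proof (rule finsum_cong')
      fix v assume v: "v \<in> ?B"
      then obtain i where i: "i < N" "v = monom i" by auto
      show "(x v \<odot>\<^bsub>V\<^esub> v) k = (if monom k = v then x v else \<zero>)"
        using xc[OF v] i k inj_onD[OF inj, of k i] by auto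
    qed (use xc in auto)
    also have "\<dots> = x (monom k)" using k xc by (subst finsum_singleton) auto
    finally show ?thesis .
  qed
  have "W.basis ?B"
    unfolding W.basis_criterion[OF fin sub]
  proof (intro allI impI ex1I conjI)
    fix v assume v: "v \<in> carrier V"
    define x where "x = (\<lambda>w\<in>?B. v (inv_into {..<N} monom w))"
    have xm: "x (monom i) = v i" if "i < N" for i using that inj by (simp add: x_def)
    show xB: "x \<in> ?B \<rightarrow>\<^sub>E carrier K"
    proof (rule PiE_I)
      fix w assume "w \<in> ?B"
      then obtain i where "i < N" "w = monom i" by auto
      then show "x w \<in> carrier K" using xm v by simp
    qed (simp add: x_def)
    then have xP: "x \<in> ?B \<rightarrow> carrier K" by (simp add: PiE_def)
    show "V.lincomb x ?B = v"
      by (rule V_eqI) (simp_all add: coeff[OF xP] xm v V.lincomb_closed[OF sub xP])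
    fix y assume y: "y \<in> ?B \<rightarrow>\<^sub>E carrier K \<and> V.lincomb y ?B = v"
    then have yP: "y \<in> ?B \<rightarrow> carrier K" by (simp add: PiE_def)
    show "y = x"
    proof (rule PiE_ext[OF conjunct1[OF y] xB])
      fix w assume "w \<in> ?B"
      then obtain i where i: "i < N" "w = monom i" by auto
      then show "y w = x w" using coeff[OF yP i(1)] y xm by simp
    qed
  qed
  then show "W.dim = N" using W.dim_basis[OF fin] card_image[OF inj] by simp
  show "W.fin_dim"
    using \<open>W.basis ?B\<close> fin unfolding W.fin_dim_def W.basis_def by blast
qed

end

section \<open>Quotients, restriction of scalars and homomorphisms of modules\<close>

text \<open>
  Module laws are equations, so they pass to surjective images.  Quotients, and structures that are
  only known to be isomorphic to a module, are recognized as modules in this way.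
\<close>

lemma module_of_surjective_image:
  assumes M: "Module.module R M"
    and onto: "\<pi> ` carrier M = carrier Q"
    and add: "\<And>x y. \<lbrakk>x \<in> carrier M; y \<in> carrier M\<rbrakk> \<Longrightarrow> \<pi> (x \<oplus>\<^bsub>M\<^esub> y) = \<pi> x \<oplus>\<^bsub>Q\<^esub> \<pi> y"
    and smult: "\<And>r x. \<lbrakk>r \<in> carrier R; x \<in> carrier M\<rbrakk> \<Longrightarrow> \<pi> (r \<odot>\<^bsub>M\<^esub> x) = r \<odot>\<^bsub>Q\<^esub> \<pi> x"
    and zero: "\<pi> \<zero>\<^bsub>M\<^esub> = \<zero>\<^bsub>Q\<^esub>"
  shows "Module.module R Q"
proof -
  interpret M: Module.module R M by fact
  have ex: "\<exists>x\<in>carrier M. v = \<pi> x" if "v \<in> carrier Q" for v using that onto by blast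
  have im: "\<pi> x \<in> carrier Q" if "x \<in> carrier M" for x using that onto by blast
  note rules = add[symmetric] smult[symmetric] zero[symmetric]
  show ?thesis
  proof (rule module_criteria; (intro allI ballI impI)?; (elim conjE)?)
    show "cring R" ..
    show "\<zero>\<^bsub>Q\<^esub> \<in> carrier Q" using im[of "\<zero>\<^bsub>M\<^esub>"] zero by simp
    fix v assume v: "v \<in> carrier Q"
    then obtain x where x: "x \<in> carrier M" "v = \<pi> x" using ex by blast
    show "\<exists>u\<in>carrier Q. v \<oplus>\<^bsub>Q\<^esub> u = \<zero>\<^bsub>Q\<^esub>"
      using x by (intro bexI[of _ "\<pi> (\<ominus>\<^bsub>M\<^esub> x)"] im) (simp_all add: rules M.M.r_neg)
    show "v \<oplus>\<^bsub>Q\<^esub> \<zero>\<^bsub>Q\<^esub> = v" using x by (simp add: rules)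
    show "\<one>\<^bsub>R\<^esub> \<odot>\<^bsub>Q\<^esub> v = v" using x by (simp add: rules)
    fix c assume c: "c \<in> carrier R"
    show "c \<odot>\<^bsub>Q\<^esub> v \<in> carrier Q" using x c by (simp add: rules im)
    fix w assume w: "w \<in> carrier Q"
    then obtain y where y: "y \<in> carrier M" "w = \<pi> y" using ex by blast
    show "c \<odot>\<^bsub>Q\<^esub> (v \<oplus>\<^bsub>Q\<^esub> w) = c \<odot>\<^bsub>Q\<^esub> v \<oplus>\<^bsub>Q\<^esub> c \<odot>\<^bsub>Q\<^esub> w"
      using x y c by (simp add: rules M.smult_r_distr)
  next
    fix v w assume "v \<in> carrier Q" "w \<in> carrier Q"
    then obtain x y where x: "x \<in> carrier M" "v = \<pi> x" "y \<in> carrier M" "w = \<pi> y" using ex by metis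
    show "v \<oplus>\<^bsub>Q\<^esub> w \<in> carrier Q" using x by (simp add: rules im)
    show "v \<oplus>\<^bsub>Q\<^esub> w = w \<oplus>\<^bsub>Q\<^esub> v" using x by (simp add: rules M.M.a_comm)
    fix u assume "u \<in> carrier Q"
    then obtain z where z: "z \<in> carrier M" "u = \<pi> z" using ex by metis
    show "v \<oplus>\<^bsub>Q\<^esub> w \<oplus>\<^bsub>Q\<^esub> u = v \<oplus>\<^bsub>Q\<^esub> (w \<oplus>\<^bsub>Q\<^esub> u)" using x z by (simp add: rules M.M.a_assoc)
  next
    fix a b v assume v: "v \<in> carrier Q" and ab: "a \<in> carrier R" "b \<in> carrier R"
    then obtain x where x: "x \<in> carrier M" "v = \<pi> x" using ex by metis
    show "(a \<otimes>\<^bsub>R\<^esub> b) \<odot>\<^bsub>Q\<^esub> v = a \<odot>\<^bsub>Q\<^esub> (b \<odot>\<^bsub>Q\<^esub> v)" using x ab by (simp add: rules M.smult_assoc1)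
    show "(a \<oplus>\<^bsub>R\<^esub> b) \<odot>\<^bsub>Q\<^esub> v = a \<odot>\<^bsub>Q\<^esub> v \<oplus>\<^bsub>Q\<^esub> b \<odot>\<^bsub>Q\<^esub> v"
      using x ab by (simp add: rules M.smult_l_distr)
  qed
qed

lemma submodule_minus:
  assumes "Module.module R M" "submodule R N M" "x \<in> N"
  shows "\<ominus>\<^bsub>M\<^esub> x \<in> N"
proof -
  interpret M: Module.module R M by fact
  interpret N: submodule R N M by fact
  have "(\<ominus>\<^bsub>R\<^esub> \<one>\<^bsub>R\<^esub>) \<odot>\<^bsub>M\<^esub> x \<in> N" by (rule N.smult_closed) (simp_all add: assms)
  then show ?thesis using N.subset assms(3) M.smult_minus_1[of x] by (metis subsetD)
qed

lemma submodule_abelian_subgroup: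
  assumes M: "Module.module R M" and N: "submodule R N M"
  shows "abelian_subgroup N M"
proof -
  interpret M: Module.module R M by fact
  interpret N: submodule R N M by fact
  have "additive_subgroup N M"
  proof (rule additive_subgroup.intro, rule M.add.subgroupI)
    show "N \<noteq> {}" using N.zero_closed by blast
    show "\<ominus>\<^bsub>M\<^esub> x \<in> N" if "x \<in> N" for x by (rule submodule_minus[OF M N that])
  qed (use N.subset in auto)
  then show ?thesis by (rule abelian_subgroupI3) (rule M.M.abelian_group_axioms)
qed

context
  fixes R :: "('r, 'l) ring_scheme" and M :: "('r, 'a, 'm) module_scheme" and N
  assumes M: "Module.module R M" and N: "submodule R N M"
begin

interpretation M: Module.module R M by (rule M)
interpretation S: submodule R N M by (rule N)
interpretation N: abelian_subgroup N M by (rule submodule_abelian_subgroup[OF M N])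

lemma quotient_map_onto: "(\<lambda>x. N +>\<^bsub>M\<^esub> x) ` carrier M = carrier (quotient_module M N)"
  by (auto simp: quotient_module_def A_RCOSETS_def')

lemma quotient_map_zero: "N +>\<^bsub>M\<^esub> \<zero>\<^bsub>M\<^esub> = \<zero>\<^bsub>quotient_module M N\<^esub>"
  using S.subset by (simp add: quotient_module_def)

lemma quotient_map_add:
  "\<lbrakk>x \<in> carrier M; y \<in> carrier M\<rbrakk> \<Longrightarrow>
    N +>\<^bsub>M\<^esub> (x \<oplus>\<^bsub>M\<^esub> y) = (N +>\<^bsub>M\<^esub> x) \<oplus>\<^bsub>quotient_module M N\<^esub> (N +>\<^bsub>M\<^esub> y)"
  by (simp add: quotient_module_def N.a_rcos_sum)

lemma quotient_map_eq_iff: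
  assumes "x \<in> carrier M" "y \<in> carrier M"
  shows "N +>\<^bsub>M\<^esub> x = N +>\<^bsub>M\<^esub> y \<longleftrightarrow> x \<ominus>\<^bsub>M\<^esub> y \<in> N"
proof
  assume "N +>\<^bsub>M\<^esub> x = N +>\<^bsub>M\<^esub> y"
  then have "x \<in> N +>\<^bsub>M\<^esub> y" using N.a_rcos_self[OF assms(1)] by simp
  then show "x \<ominus>\<^bsub>M\<^esub> y \<in> N" using N.a_rcos_module[OF assms(2,1)] by (simp add: a_minus_def)
next
  assume "x \<ominus>\<^bsub>M\<^esub> y \<in> N"
  then have "x \<in> N +>\<^bsub>M\<^esub> y" using N.a_rcos_module[OF assms(2,1)] by (simp add: a_minus_def)
  then show "N +>\<^bsub>M\<^esub> x = N +>\<^bsub>M\<^esub> y" using M.M.a_repr_independence[OF _ assms(2) N.a_subgroup] by simp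
qed

lemma quotient_map_smult:
  assumes r: "r \<in> carrier R" and x: "x \<in> carrier M"
  shows "N +>\<^bsub>M\<^esub> (r \<odot>\<^bsub>M\<^esub> x) = r \<odot>\<^bsub>quotient_module M N\<^esub> (N +>\<^bsub>M\<^esub> x)"
proof -
  have eq: "N +>\<^bsub>M\<^esub> (r \<odot>\<^bsub>M\<^esub> z) = N +>\<^bsub>M\<^esub> (r \<odot>\<^bsub>M\<^esub> x)" if "z \<in> N +>\<^bsub>M\<^esub> x" for z
  proof -
    obtain n where n: "n \<in> N" "z = n \<oplus>\<^bsub>M\<^esub> x" using \<open>z \<in> N +>\<^bsub>M\<^esub> x\<close> by (auto simp: a_r_coset_def')
    have nM: "n \<in> carrier M" using n S.subset by auto
    have rn: "r \<odot>\<^bsub>M\<^esub> n \<in> N" using r n by auto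
    have "r \<odot>\<^bsub>M\<^esub> z \<ominus>\<^bsub>M\<^esub> r \<odot>\<^bsub>M\<^esub> x = r \<odot>\<^bsub>M\<^esub> n"
      using nM r x n by (simp add: M.smult_r_distr a_minus_def M.M.a_assoc M.M.r_neg)
    then show ?thesis using rn nM r x n by (subst quotient_map_eq_iff) auto
  qed
  have "(\<Union>z\<in>N +>\<^bsub>M\<^esub> x. N +>\<^bsub>M\<^esub> (r \<odot>\<^bsub>M\<^esub> z)) = N +>\<^bsub>M\<^esub> (r \<odot>\<^bsub>M\<^esub> x)"
    by (rule UN_constant_eq[OF N.a_rcos_self[OF x]]) (intro ballI eq)
  then show ?thesis by (simp add: quotient_module_def)
qed

lemma quotient_is_module: "Module.module R (quotient_module M N)"
  by (rule module_of_surjective_image[OF M quotient_map_onto quotient_map_add quotient_map_smult quotient_map_zero])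

end

lemma abelian_group_cong:
  assumes "abelian_group M" "carrier M' = carrier M" "add M' = add M" "zero M' = zero M"
  shows "abelian_group M'"
proof -
  interpret M: abelian_group M by fact
  show ?thesis
    by (rule abelian_groupI) (use M.l_neg in \<open>auto simp: assms M.a_ac intro!: bexI[of _ "\<ominus>\<^bsub>M\<^esub> _"]\<close>)
qed

lemma restrict_scalars_is_module:
  assumes alg: "Module.algebra K R" and M: "Module.module R M"
  shows "Module.module K (restrict_scalars R M)"
proof -
  interpret A: Module.algebra K R by fact
  interpret M: Module.module R M by fact
  have s: "structure_map R c \<in> carrier R" if "c \<in> carrier K" for c
    using that by (simp add: structure_map_def)
  have sm: "structure_map R (c \<otimes>\<^bsub>K\<^esub> d) = structure_map R c \<otimes>\<^bsub>R\<^esub> structure_map R d"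
    if "c \<in> carrier K" "d \<in> carrier K" for c d
    using that by (simp add: structure_map_def A.smult_assoc1 A.smult_assoc2)
  have sa: "structure_map R (c \<oplus>\<^bsub>K\<^esub> d) = structure_map R c \<oplus>\<^bsub>R\<^esub> structure_map R d"
    if "c \<in> carrier K" "d \<in> carrier K" for c d
    using that by (simp add: structure_map_def A.smult_l_distr)
  have s1: "structure_map R \<one>\<^bsub>K\<^esub> = \<one>\<^bsub>R\<^esub>" by (simp add: structure_map_def)
  show ?thesis
  proof (rule Module.moduleI)
    show "cring K" ..
    show "abelian_group (restrict_scalars R M)"
      by (rule abelian_group_cong[OF M.M.abelian_group_axioms]) (simp_all add: restrict_scalars_def)
  qed (simp_all add: restrict_scalars_def s sm sa s1 M.smult_l_distr M.smult_r_distr M.smult_assoc1)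
qed

lemma submodule_restrict_scalars:
  assumes alg: "Module.algebra K R" and M: "Module.module R M" and N: "submodule R N M"
  shows "submodule K N (restrict_scalars R M)"
proof -
  interpret A: Module.algebra K R by fact
  interpret N: submodule R N M by fact
  show ?thesis
    by (rule submodule.intro[OF restrict_scalars_is_module[OF alg M]])
      (use N.subset in \<open>auto simp: restrict_scalars_def structure_map_def\<close>)
qed

text \<open>
  The unqualified names of these facts denote their counterparts for modules over type classes.
\<close>

lemmas hom_def = LinearCombinations.module_hom_def
lemmas hom_closed = LinearCombinations.module_hom_closed
lemmas hom_add = LinearCombinations.module_hom_add
lemmas hom_smult = LinearCombinations.module_hom_smult

lemma inverse_module_hom:
  assumes f: "f \<in> module_hom R A B" and bij: "bij_betw f (carrier A) (carrier B)"
    and A: "Module.module R A"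
  shows "inv_into (carrier A) f \<in> module_hom R B A"
proof -
  interpret A: Module.module R A by fact
  let ?g = "inv_into (carrier A) f"
  have g: "?g y \<in> carrier A" "f (?g y) = y" if "y \<in> carrier B" for y
    using that bij by (auto simp: bij_betw_def inv_into_into f_inv_into_f)
  have gf: "?g (f x) = x" if "x \<in> carrier A" for x using that bij by (simp add: bij_betw_def)
  have "?g (x \<oplus>\<^bsub>B\<^esub> y) = ?g x \<oplus>\<^bsub>A\<^esub> ?g y" if xy: "x \<in> carrier B" "y \<in> carrier B" for x y
  proof -
    have "?g (x \<oplus>\<^bsub>B\<^esub> y) = ?g (f (?g x \<oplus>\<^bsub>A\<^esub> ?g y))"
      using xy g by (simp add: hom_add[OF f])
    then show ?thesis using xy g by (simp add: gf)
  qed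
  moreover have "?g (r \<odot>\<^bsub>B\<^esub> x) = r \<odot>\<^bsub>A\<^esub> ?g x" if rx: "r \<in> carrier R" "x \<in> carrier B" for r x
  proof -
    have "?g (r \<odot>\<^bsub>B\<^esub> x) = ?g (f (r \<odot>\<^bsub>A\<^esub> ?g x))"
      using rx g by (simp add: hom_smult[OF f])
    then show ?thesis using rx g by (simp add: gf)
  qed
  ultimately show ?thesis using g(1) by (simp add: hom_def)
qed

lemma hom_compose:
  assumes "f \<in> module_hom R A B" "g \<in> module_hom R B C"
  shows "(\<lambda>x. g (f x)) \<in> module_hom R A C"
  using assms by (auto simp: hom_def Pi_iff)

lemma Hom_is_module:
  assumes M: "Module.module R M" and N: "Module.module R N"
  shows "Module.module R (Hom_module R M N)"
proof -
  interpret M: Module.module R M by fact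
  interpret N: Module.module R N by fact
  let ?H = "Hom_module R M N"
  have carrier: "f \<in> carrier ?H \<longleftrightarrow> f \<in> module_hom R M N \<and> f \<in> extensional (carrier M)" for f
    by (simp add: Hom_module_def)
  have add: "(f \<oplus>\<^bsub>?H\<^esub> g) = (\<lambda>x\<in>carrier M. f x \<oplus>\<^bsub>N\<^esub> g x)"
    and smult: "r \<odot>\<^bsub>?H\<^esub> f = (\<lambda>x\<in>carrier M. r \<odot>\<^bsub>N\<^esub> f x)"
    and zero: "\<zero>\<^bsub>?H\<^esub> = (\<lambda>x\<in>carrier M. \<zero>\<^bsub>N\<^esub>)" for f g r
    by (simp_all add: Hom_module_def)
  note ext = extensionalityI[of _ "carrier M"]
  show ?thesis
  proof (rule module_criteria; (intro allI ballI impI)?; (elim conjE)?)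
    show "cring R" ..
    show "\<zero>\<^bsub>?H\<^esub> \<in> carrier ?H" by (simp add: carrier zero hom_def)
    fix f assume f: "f \<in> carrier ?H"
    then have fh: "f \<in> module_hom R M N" "f \<in> extensional (carrier M)" by (simp_all add: carrier)
    then have fc: "x \<in> carrier M \<Longrightarrow> f x \<in> carrier N" for x using hom_closed by blast
    show "f \<oplus>\<^bsub>?H\<^esub> \<zero>\<^bsub>?H\<^esub> = f"
      by (rule ext) (simp_all add: add zero fc fh)
    show "\<one>\<^bsub>R\<^esub> \<odot>\<^bsub>?H\<^esub> f = f"
      by (rule ext) (simp_all add: smult fc fh)
    have n: "(\<lambda>x\<in>carrier M. \<ominus>\<^bsub>N\<^esub> f x) \<in> carrier ?H"
      by (simp add: carrier hom_def Pi_iff fc hom_add[OF fh(1)] hom_smult[OF fh(1)] N.M.minus_add N.smult_r_minus)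
    show "\<exists>g\<in>carrier ?H. f \<oplus>\<^bsub>?H\<^esub> g = \<zero>\<^bsub>?H\<^esub>"
      by (rule bexI[OF _ n], rule ext) (simp_all add: add zero fc N.M.r_neg)
  next
    fix r f assume r: "r \<in> carrier R" and f: "f \<in> carrier ?H"
    then have fh: "f \<in> module_hom R M N" by (simp add: carrier)
    then have fc: "x \<in> carrier M \<Longrightarrow> f x \<in> carrier N" for x using hom_closed by blast
    show "r \<odot>\<^bsub>?H\<^esub> f \<in> carrier ?H"
      by (simp add: carrier smult hom_def Pi_iff fc r hom_add[OF fh] hom_smult[OF fh] N.smult_r_distr
          N.smult_assoc1[symmetric] M.m_comm)
  next
    fix f g assume "f \<in> carrier ?H" "g \<in> carrier ?H"
    then have fg: "f \<in> module_hom R M N" "g \<in> module_hom R M N" by (simp_all add: carrier)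
    then have c: "x \<in> carrier M \<Longrightarrow> f x \<in> carrier N" "x \<in> carrier M \<Longrightarrow> g x \<in> carrier N" for x
      using hom_closed by blast+
    show "f \<oplus>\<^bsub>?H\<^esub> g \<in> carrier ?H"
      by (simp add: carrier add hom_def Pi_iff c hom_add[OF fg(1)] hom_smult[OF fg(1)]
          hom_add[OF fg(2)] hom_smult[OF fg(2)] N.smult_r_distr N.M.a_ac)
    show "f \<oplus>\<^bsub>?H\<^esub> g = g \<oplus>\<^bsub>?H\<^esub> f"
      by (rule ext) (simp_all add: add c N.M.a_comm)
    fix r assume r: "r \<in> carrier R"
    show "r \<odot>\<^bsub>?H\<^esub> (f \<oplus>\<^bsub>?H\<^esub> g) = r \<odot>\<^bsub>?H\<^esub> f \<oplus>\<^bsub>?H\<^esub> r \<odot>\<^bsub>?H\<^esub> g"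
      by (rule ext) (simp_all add: add smult c r N.smult_r_distr)
  next
    fix f g h assume "f \<in> carrier ?H" "g \<in> carrier ?H" "h \<in> carrier ?H"
    then have "f \<in> carrier M \<rightarrow> carrier N" "g \<in> carrier M \<rightarrow> carrier N" "h \<in> carrier M \<rightarrow> carrier N"
      unfolding carrier by (blast dest: hom_closed)+
    then have c: "x \<in> carrier M \<Longrightarrow> f x \<in> carrier N" "x \<in> carrier M \<Longrightarrow> g x \<in> carrier N"
        "x \<in> carrier M \<Longrightarrow> h x \<in> carrier N" for x
      by blast+
    show "f \<oplus>\<^bsub>?H\<^esub> g \<oplus>\<^bsub>?H\<^esub> h = f \<oplus>\<^bsub>?H\<^esub> (g \<oplus>\<^bsub>?H\<^esub> h)"
      by (rule ext) (simp_all add: add c N.M.a_assoc)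
  next
    fix r s f assume rs: "r \<in> carrier R" "s \<in> carrier R" and "f \<in> carrier ?H"
    then have "f \<in> carrier M \<rightarrow> carrier N" unfolding carrier by (blast dest: hom_closed)
    then have c: "x \<in> carrier M \<Longrightarrow> f x \<in> carrier N" for x by blast
    show "(r \<otimes>\<^bsub>R\<^esub> s) \<odot>\<^bsub>?H\<^esub> f = r \<odot>\<^bsub>?H\<^esub> (s \<odot>\<^bsub>?H\<^esub> f)"
      by (rule ext) (simp_all add: smult c rs N.smult_assoc1)
    show "(r \<oplus>\<^bsub>R\<^esub> s) \<odot>\<^bsub>?H\<^esub> f = r \<odot>\<^bsub>?H\<^esub> f \<oplus>\<^bsub>?H\<^esub> s \<odot>\<^bsub>?H\<^esub> f"
      by (rule ext) (simp_all add: add smult c rs N.smult_l_distr)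
  qed
qed

lemma vector_dim_iso:
  assumes K: "field K" and A: "Module.module K A" and fd: "vectorspace.fin_dim K A"
    and f: "f \<in> module_hom K A B" and bij: "bij_betw f (carrier A) (carrier B)"
    and zero: "f \<zero>\<^bsub>A\<^esub> = \<zero>\<^bsub>B\<^esub>"
  shows "vector_dim K B = enat (vectorspace.dim K A)" "Module.module K B" "vectorspace.fin_dim K B"
proof -
  show B: "Module.module K B"
    by (rule module_of_surjective_image[OF A, of f])
      (use f bij zero in \<open>auto simp: hom_def bij_betw_def\<close>)
  interpret linear_map K A B f
    using K A B f by (simp add: linear_map_def vectorspace_def mod_hom_def mod_hom_axioms_def)
  have surj: "f ` carrier A = carrier B" and inj: "inj_on f (carrier A)" using bij by (auto simp: bij_betw_def)
  show W: "W.fin_dim" by (rule surj_fin_dim[OF fd surj])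
  show "vector_dim K B = enat V.dim"
    using dim_eq[OF fd inj surj] W by (simp add: vector_dim_def)
qed

text \<open>
  The records \<open>M\<close> and \<open>M'\<close> may have different further fields, in particular different scalar
  multiplications.
\<close>

lemma is_direct_sum_cong:
  fixes M :: "('a, 'm) ring_scheme" and M' :: "('a, 'n) ring_scheme" and D :: "'i \<Rightarrow> 'a set"
  assumes eq: "carrier M = carrier M'" "add M = add M'" "zero M = zero M'"
  shows "is_direct_sum M D \<longleftrightarrow> is_direct_sum M' D"
proof -
  have "additive_subgroup S M \<longleftrightarrow> additive_subgroup S M'" for S
    by (simp only: additive_subgroup_def subgroup_def m_inv_def eq monoid.simps partial_object.simps)
  moreover have "finsum M f S = finsum M' f S" for f :: "'i \<Rightarrow> 'a" and S
    by (simp only: finsum_def finprod_def eq monoid.simps partial_object.simps)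
  ultimately show ?thesis by (simp only: is_direct_sum_def eq)
qed

lemma restrict_hom:
  assumes f: "f \<in> module_hom R M N" and M: "Module.module R M"
  shows "restrict f (carrier M) \<in> module_hom R M N"
proof -
  interpret M: Module.module R M by fact
  show ?thesis
    using hom_closed[OF f] by (simp add: hom_def Pi_iff hom_add[OF f] hom_smult[OF f])
qed

lemma regular_module_is_module:
  assumes "cring R" shows "Module.module R (regular_module R)"
proof -
  interpret R: cring R by fact
  show ?thesis
  proof (rule Module.moduleI)
    show "abelian_group (regular_module R)"
      by (rule abelian_group_cong[OF R.abelian_group_axioms]) (simp_all add: regular_module_def)
  qed (simp_all add: regular_module_def assms R.l_distr R.r_distr R.m_assoc)
qed

lemma ideal_iff_submodule_regular:
  assumes "cring R" shows "ideal I R \<longleftrightarrow> submodule R I (regular_module R)"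
proof -
  interpret R: cring R by fact
  interpret M: Module.module R "regular_module R" by (rule regular_module_is_module[OF assms])
  show ?thesis
  proof
    assume "ideal I R"
    then interpret I: ideal I R .
    show "submodule R I (regular_module R)"
      by (rule submodule.intro[OF M.module_axioms])
        (use I.a_subset I.I_l_closed in \<open>auto simp: regular_module_def\<close>)
  next
    assume S: "submodule R I (regular_module R)"
    then interpret S: submodule R I "regular_module R" .
    have sub: "I \<subseteq> carrier R" using S.subset by (simp add: regular_module_def)
    have neg: "\<ominus>\<^bsub>R\<^esub> x \<in> I" if "x \<in> I" for x
    proof -
      have "(\<ominus>\<^bsub>R\<^esub> \<one>\<^bsub>R\<^esub>) \<otimes>\<^bsub>R\<^esub> x \<in> I"
        using S.smult_closed[of "\<ominus>\<^bsub>R\<^esub> \<one>\<^bsub>R\<^esub>" x] that by (simp add: regular_module_def)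
      then show ?thesis using that sub by (simp add: subsetD R.l_minus)
    qed
    have zero: "\<zero>\<^bsub>R\<^esub> \<in> I" using S.zero_closed by (simp add: regular_module_def)
    have add: "x \<oplus>\<^bsub>R\<^esub> y \<in> I" if "x \<in> I" "y \<in> I" for x y
      using S.m_closed[OF that] by (simp add: regular_module_def)
    have mult: "r \<otimes>\<^bsub>R\<^esub> x \<in> I" if "r \<in> carrier R" "x \<in> I" for r x
      using S.smult_closed[OF that] by (simp add: regular_module_def)
    show "ideal I R"
    proof (rule idealI)
      show "subgroup I (add_monoid R)"
      proof (rule R.add.subgroupI)
        show "I \<noteq> {}" using zero by blast
      qed (simp_all add: sub neg add)
      show "x \<otimes>\<^bsub>R\<^esub> a \<in> I" "a \<otimes>\<^bsub>R\<^esub> x \<in> I" if "a \<in> I" "x \<in> carrier R" for a x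
        using mult[OF that(2,1)] that(2) subsetD[OF sub that(1)] by (simp_all add: R.m_comm[of a x])
    qed (rule R.ring_axioms)
  qed
qed

section \<open>Graded algebras with a monomial basis\<close>

text \<open>
  The algebra with basis \<open>t\<^sup>0, \<dots>, t\<^sup>N\<^sup>-\<^sup>1\<close> in which \<open>t\<^sup>i t\<^sup>j\<close> is \<open>t\<^sup>i\<^sup>+\<^sup>j\<close> if \<open>c i j\<close> and \<open>i + j < N\<close>, and
  zero otherwise.
\<close>

locale monomial_algebra = coefficient_space K N for K (structure) and N +
  fixes c :: "nat \<Rightarrow> nat \<Rightarrow> bool"
  assumes N_pos: "0 < N"
    and compat_commute: "c i j \<longleftrightarrow> c j i"
    and compat_zero: "j < N \<Longrightarrow> c 0 j"
    and compat_assoc: "i + j + k < N \<Longrightarrow> c i j \<and> c (i + j) k \<longleftrightarrow> c j k \<and> c i (j + k)"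
begin

definition A :: "('a, nat \<Rightarrow> 'a) module" where
  "A = \<lparr>carrier = carrier V, mult = cnv c, one = monom 0, zero = zero V, add = add V, smult = smult V\<rparr>"

text \<open>
  The dual of \<open>A\<close>.  Position \<open>k\<close> holds the value of a functional at \<open>t\<^sup>N\<^sup>-\<^sup>1\<^sup>-\<^sup>k\<close>.  In this numbering
  \<open>(t\<^sup>i \<phi>)(t\<^sup>N\<^sup>-\<^sup>1\<^sup>-\<^sup>k) = \<phi>(t\<^sup>i t\<^sup>N\<^sup>-\<^sup>1\<^sup>-\<^sup>k)\<close> involves position \<open>k - i\<close> of \<open>\<phi>\<close>, so the action is a convolution, and
  it keeps the term with \<open>j = k - i\<close> iff \<open>t\<^sup>i t\<^sup>N\<^sup>-\<^sup>1\<^sup>-\<^sup>i\<^sup>-\<^sup>j\<close> is not zero.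
\<close>

definition \<Omega> :: "(nat \<Rightarrow> 'a, nat \<Rightarrow> 'a) module" where
  "\<Omega> = \<lparr>carrier = carrier V, mult = mult V, one = one V, zero = zero V, add = add V,
     smult = cnv (\<lambda>i j. c i (N - 1 - i - j))\<rparr>"

lemma A_simps [simp]:
  "carrier A = carrier V" "mult A = cnv c" "one A = monom 0" "zero A = zero V" "add A = add V" "smult A = smult V"
  by (simp_all add: A_def)

lemma \<Omega>_simps [simp]:
  "carrier \<Omega> = carrier V" "zero \<Omega> = zero V" "add \<Omega> = add V" "smult \<Omega> = cnv (\<lambda>i j. c i (N - 1 - i - j))"
  by (simp_all add: \<Omega>_def)

lemma cring_A: "cring A"
proof (rule cringI)
  show "abelian_group A" by (rule abelian_group_cong[OF V.M.abelian_group_axioms]) simp_all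
  show "Group.comm_monoid A"
  proof (rule comm_monoidI)
    fix f g h assume "f \<in> carrier A" "g \<in> carrier A" "h \<in> carrier A"
    then show "f \<otimes>\<^bsub>A\<^esub> g \<otimes>\<^bsub>A\<^esub> h = f \<otimes>\<^bsub>A\<^esub> (g \<otimes>\<^bsub>A\<^esub> h)"
      by (simp, intro conv_assoc compat_assoc) simp_all
  next
    fix f g assume "f \<in> carrier A" "g \<in> carrier A"
    then show "f \<otimes>\<^bsub>A\<^esub> g = g \<otimes>\<^bsub>A\<^esub> f"
      by (simp, intro conv_commute compat_commute) simp_all
  qed (simp_all add: conv_one compat_zero)
qed (simp add: conv_add_left)

sublocale A: cring A by (rule cring_A)

lemma algebra_A: "Module.algebra K A"
  by (rule algebraI[OF cring_axioms cring_A])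
    (simp_all add: V.smult_l_distr V.smult_r_distr V.smult_assoc1 conv_smult_left)

lemma structure_map_A: "structure_map A a = a \<odot>\<^bsub>V\<^esub> monom 0"
  by (simp add: structure_map_def)

lemma structure_map_mult: "a \<in> carrier K \<Longrightarrow> f \<in> carrier V \<Longrightarrow> (\<And>j. j < N \<Longrightarrow> w 0 j) \<Longrightarrow> cnv w (structure_map A a) f = a \<odot>\<^bsub>V\<^esub> f"
  by (simp add: structure_map_A conv_smult_left conv_one)

lemma structure_map_closed: "a \<in> carrier K \<Longrightarrow> structure_map A a \<in> carrier V"
  by (simp add: structure_map_A)

lemma structure_map_zero: "structure_map A \<zero> = \<zero>\<^bsub>V\<^esub>"
  by (simp add: structure_map_A)

lemma structure_map_add: "\<lbrakk>a \<in> carrier K; a' \<in> carrier K\<rbrakk> \<Longrightarrow> structure_map A (a \<oplus> a') = structure_map A a \<oplus>\<^bsub>V\<^esub> structure_map A a'"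
  by (simp add: structure_map_A V.smult_l_distr)

lemma structure_map_times:
  "\<lbrakk>a \<in> carrier K; a' \<in> carrier K\<rbrakk> \<Longrightarrow> structure_map A (a \<otimes> a') = cnv c (structure_map A a) (structure_map A a')"
  by (simp add: structure_map_mult structure_map_closed compat_zero) (simp add: structure_map_A V.smult_assoc1)

lemma structure_map_coeff0: "a \<in> carrier K \<Longrightarrow> structure_map A a 0 = a"
  using N_pos by (simp add: structure_map_A)

lemma module_\<Omega>: "Module.module A \<Omega>"
proof (rule Module.moduleI)
  show "abelian_group \<Omega>" by (rule abelian_group_cong[OF V.M.abelian_group_axioms]) simp_all
  fix f g h assume fgh: "f \<in> carrier A" "g \<in> carrier A" "h \<in> carrier \<Omega>"
  have "c i j \<and> c (i + j) (N - 1 - (i + j) - k) \<longleftrightarrow> c j (N - 1 - j - k) \<and> c i (N - 1 - i - (j + k))"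
    if "i + j + k < N" for i j k
  proof -
    have "c j i \<and> c (j + i) (N - 1 - i - j - k) \<longleftrightarrow> c i (N - 1 - i - j - k) \<and> c j (i + (N - 1 - i - j - k))"
      using that by (intro compat_assoc) simp
    moreover have "i + (N - 1 - i - j - k) = N - 1 - j - k" "N - 1 - (i + j) - k = N - 1 - i - j - k"
      "N - 1 - i - (j + k) = N - 1 - i - j - k"
      using that by simp_all
    ultimately show ?thesis using compat_commute[of i j] by (simp add: add.commute) blast
  qed
  then show "f \<otimes>\<^bsub>A\<^esub> g \<odot>\<^bsub>\<Omega>\<^esub> h = f \<odot>\<^bsub>\<Omega>\<^esub> (g \<odot>\<^bsub>\<Omega>\<^esub> h)"
    unfolding A_simps \<Omega>_simps using fgh by (intro conv_assoc) simp_all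
qed (simp_all add: cring_A conv_add_left conv_add_right conv_one compat_zero)

sublocale \<Omega>: Module.module A \<Omega> by (rule module_\<Omega>)

lemma module_regular: "Module.module A (regular_module A)"
  by (rule regular_module_is_module[OF cring_A])

abbreviation D :: "nat \<Rightarrow> (nat \<Rightarrow> 'a) set" where "D \<equiv> degree_part (\<lambda>k. k)"

lemma conv_degree:
  assumes "f \<in> degree_part (\<lambda>k. k) i" "g \<in> degree_part (\<lambda>k. k) j"
  shows "cnv w f g \<in> degree_part (\<lambda>k. k) (i + j)"
proof -
  have fg: "f \<in> carrier V" "g \<in> carrier V" "\<And>k. k < N \<Longrightarrow> k \<noteq> i \<Longrightarrow> f k = \<zero>" "\<And>k. k < N \<Longrightarrow> k \<noteq> j \<Longrightarrow> g k = \<zero>"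
    using assms by (auto simp: degree_part_def)
  have "cnv w f g k = \<zero>" if k: "k < N" "k \<noteq> i + j" for k
  proof (rule conv_coeff_zeroI[OF fg(1,2) k(1)])
    fix l assume "l \<le> k"
    then show "f l = \<zero> \<or> g (k - l) = \<zero>" using fg(3)[of l] fg(4)[of "k - l"] k by (cases "l = i") auto
  qed
  then show ?thesis using fg by (simp add: degree_part_def)
qed

lemma direct_sum_A: "is_direct_sum A D"
proof -
  have "is_direct_sum V D" by (rule V_direct_sum) simp
  then show ?thesis by (subst is_direct_sum_cong[of _ V]) simp_all
qed

lemma graded_\<Omega>: "graded_module A D \<Omega> (degree_part int)"
  unfolding graded_module_def
proof (intro conjI allI ballI module_\<Omega>)
  have "is_direct_sum V (degree_part int)" by (rule V_direct_sum) (simp add: inj_on_def)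
  then show "is_direct_sum \<Omega> (degree_part int)" by (subst is_direct_sum_cong[of _ V]) simp_all
  fix i j f g assume f: "f \<in> D i" and g: "g \<in> degree_part int j"
  show "f \<odot>\<^bsub>\<Omega>\<^esub> g \<in> degree_part int (int i + j)"
  proof (cases "0 \<le> j")
    case True
    then obtain n where n: "j = int n" using nonneg_int_cases by blast
    have "degree_part int (int m) = degree_part (\<lambda>k. k) m" for m by (simp add: degree_part_def)
    then show ?thesis using conv_degree[of f i g n] f g n by (simp flip: of_nat_add)
  next
    case False
    then have "g = \<zero>\<^bsub>V\<^esub>" using g by (intro V_eqI) (auto simp: degree_part_def)
    moreover have "\<zero>\<^bsub>V\<^esub> \<in> degree_part int d" for d by (simp add: degree_part_def)
    ultimately show ?thesis using f by (simp add: degree_part_def)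
  qed
qed

lemma generated_by_monoms:
  "generate_ring A (structure_map A ` carrier K \<union> monom ` {..<N}) = carrier A" (is "generate_ring A ?S = _")
proof
  have "?S \<subseteq> carrier A" by (auto simp: structure_map_A)
  then show "generate_ring A ?S \<subseteq> carrier A" by (rule A.generate_ring_incl)
  show "carrier A \<subseteq> generate_ring A ?S"
  proof
    fix f assume "f \<in> carrier A"
    then have "f \<in> carrier V" by simp
    then show "f \<in> generate_ring A ?S"
    proof (induction f rule: monom_induct)
      case zero
      then show ?case using A.zero_in_generate[of ?S] by simp
    next
      case (add f g)
      then show ?case using generate_ring.eng_add[of f A ?S g] by simp
    next
      case (monom a n)
      have "structure_map A a \<otimes>\<^bsub>A\<^esub> monom n \<in> generate_ring A ?S"
        using monom by (intro generate_ring.eng_mult generate_ring.incl) auto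
      then show ?case using monom by (simp add: structure_map_mult compat_zero)
    qed
  qed
qed

lemma positively_graded_A: "positively_graded_algebra K A D"
  unfolding positively_graded_algebra_def
proof (intro conjI allI ballI)
  show "field K" by (rule field_axioms)
  show "Module.algebra K A" by (rule algebra_A)
  show "\<exists>S\<subseteq>carrier A. finite S \<and> generate_ring A (structure_map A ` carrier K \<union> S) = carrier A"
  proof (intro exI conjI)
    show "monom ` {..<N} \<subseteq> carrier A" by (rule image_subsetI) simp
  qed (simp, rule generated_by_monoms)
  show "is_direct_sum A D" by (rule direct_sum_A)
  show "f \<otimes>\<^bsub>A\<^esub> g \<in> D (i + j)" if "f \<in> D i" "g \<in> D j" for i j f g
    using conv_degree[OF that] by simp
  show "bij_betw (structure_map A) (carrier K) (D 0)"
  proof (rule bij_betw_byWitness[where f' = "\<lambda>f. f 0"])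
    show "\<forall>a\<in>carrier K. structure_map A a 0 = a" using N_pos by (simp add: structure_map_A)
    show "\<forall>f\<in>D 0. structure_map A (f 0) = f"
    proof
      fix f assume f: "f \<in> D 0"
      have fV: "f \<in> carrier V" and f0: "\<And>k. k < N \<Longrightarrow> k \<noteq> 0 \<Longrightarrow> f k = \<zero>"
        using f by (auto simp: degree_part_def)
      show "structure_map A (f 0) = f"
        by (rule V_eqI) (use fV f0 N_pos in \<open>auto simp: structure_map_A\<close>)
    qed
    show "structure_map A ` carrier K \<subseteq> D 0"
      by (auto simp: structure_map_A degree_part_def)
    show "(\<lambda>f. f 0) ` D 0 \<subseteq> carrier K" using N_pos by (auto simp: degree_part_def)
  qed
qed

definition \<mm> :: "(nat \<Rightarrow> 'a) set" where "\<mm> = {f \<in> carrier V. f 0 = \<zero>}"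

lemma conv_at_zero:
  assumes "f \<in> carrier V" "g \<in> carrier V" "w 0 0"
  shows "cnv w f g 0 = f 0 \<otimes> g 0"
  using assms N_pos by (simp add: conv_coeff)

lemma finsum_A: "(\<Oplus>\<^bsub>A\<^esub>i\<in>I. F i) = (\<Oplus>\<^bsub>V\<^esub>i\<in>I. F i)"
  by (simp add: finsum_def finprod_def)

lemma irrelevant_ideal_A: "irrelevant_ideal A D = \<mm>"
proof (intro equalityI subsetI)
  fix f assume "f \<in> irrelevant_ideal A D"
  then obtain I F where f: "f = (\<Oplus>\<^bsub>V\<^esub>i\<in>I. F i)" and I: "finite I" "I \<subseteq> {0<..}" and F: "F \<in> (\<Pi> i\<in>I. D i)"
    by (auto simp: irrelevant_ideal_def finsum_A)
  have FV: "F \<in> I \<rightarrow> carrier V" using F by (auto simp: degree_part_def)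
  have "f 0 = (\<Oplus>i\<in>I. F i 0)" unfolding f by (rule finsum_V_coeff[OF I(1) FV N_pos])
  also have "\<dots> = (\<Oplus>i\<in>I. \<zero>)"
  proof (rule finsum_cong')
    fix i assume i: "i \<in> I"
    then have "F i \<in> D i" "i \<noteq> 0" using F I(2) by auto
    then show "F i 0 = \<zero>" using N_pos by (simp add: degree_part_def)
  qed auto
  finally show "f \<in> \<mm>" using finsum_V_closed[OF FV] by (simp add: f \<mm>_def)
next
  fix f assume f: "f \<in> \<mm>"
  have fV: "f \<in> carrier V" and f0: "f 0 = \<zero>" using f by (auto simp: \<mm>_def)
  define F where "F i = f i \<odot>\<^bsub>V\<^esub> monom i" for i
  have F: "F \<in> (\<Pi> i\<in>{0<..<N}. D i)" using fV by (auto simp: F_def degree_part_def)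
  have FV: "F \<in> {0<..<N} \<rightarrow> carrier V" using fV by (auto simp: F_def)
  have "f = (\<Oplus>\<^bsub>A\<^esub>i\<in>{0<..<N}. F i)" unfolding finsum_A
  proof (rule V_eqI[OF fV finsum_V_closed[OF FV]])
    fix k assume k: "k < N"
    have "(\<Oplus>\<^bsub>V\<^esub>i\<in>{0<..<N}. F i) k = (\<Oplus>i\<in>{0<..<N}. F i k)"
      by (rule finsum_V_coeff[OF _ FV k]) simp
    also have "\<dots> = (\<Oplus>i\<in>{0<..<N}. if k = i then f i else \<zero>)"
      by (rule finsum_cong') (use fV k in \<open>auto simp: F_def\<close>)
    also have "\<dots> = f k"
    proof (cases "k = 0")
      case True
      have "(\<Oplus>i\<in>{0<..<N}. if k = i then f i else \<zero>) = (\<Oplus>i\<in>{0<..<N}. \<zero>)"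
        by (rule finsum_cong') (use True in auto)
      then show ?thesis using True f0 by simp
    next
      case False
      then show ?thesis using fV k by (subst finsum_singleton) auto
    qed
    finally show "f k = (\<Oplus>\<^bsub>V\<^esub>i\<in>{0<..<N}. F i) k" by simp
  qed
  then show "f \<in> irrelevant_ideal A D"
    unfolding irrelevant_ideal_def using F by (intro CollectI exI[of _ "{0<..<N}"] exI[of _ F]) auto
qed

lemma primeideal_\<mm>: "primeideal \<mm> A"
proof -
  have "ideal \<mm> A"
    unfolding ideal_iff_submodule_regular[OF cring_A]
    by (rule submodule.intro[OF module_regular])
      (use N_pos in \<open>auto simp: \<mm>_def regular_module_def conv_at_zero compat_zero\<close>)
  then show ?thesis
  proof (rule primeidealI[OF _ cring_A])
    have "monom 0 \<notin> \<mm>" using N_pos by (simp add: \<mm>_def)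
    then show "carrier A \<noteq> \<mm>" using monom_closed[of 0] A_simps(1) by metis
    fix f g assume "f \<in> carrier A" "g \<in> carrier A" "f \<otimes>\<^bsub>A\<^esub> g \<in> \<mm>"
    then show "f \<in> \<mm> \<or> g \<in> \<mm>"
      using N_pos by (simp add: \<mm>_def conv_at_zero compat_zero integral_iff)
  qed
qed

text \<open>
  An element supported in positive degrees is nilpotent: squaring doubles the least degree of its
  support.  So \<open>P\<close> contains \<open>\<mm>\<close>, and an element outside \<open>\<mm>\<close> differs from a nonzero scalar by an
  element of \<open>\<mm>\<close>.
\<close>

lemma primeideal_unique:
  assumes "primeideal P A" shows "P = \<mm>"
proof -
  interpret P: primeideal P A by fact
  \<comment> \<open>by induction on the order \<open>m\<close> of \<open>f\<close> from above: \<open>f\<^sup>2\<close> has order at least \<open>m + 1\<close>\<close>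
  have nil: "f \<in> P" if "0 < m" "f \<in> carrier V" "\<And>k. k < m \<Longrightarrow> k < N \<Longrightarrow> f k = \<zero>" for m f
    using that
  proof (induction "N - m" arbitrary: m f rule: less_induct)
    case less
    show ?case
    proof (cases "m < N")
      case False
      then have "f = \<zero>\<^bsub>V\<^esub>" using less.prems by (intro V_eqI) auto
      then show ?thesis using P.zero_closed by simp
    next
      case True
      have "cnv c f f \<in> P"
      proof (rule less.hyps[of "Suc m"])
        fix k assume k: "k < Suc m" "k < N"
        show "cnv c f f k = \<zero>"
        proof (rule conv_coeff_zeroI[OF less.prems(2,2) k(2)])
          fix i assume "i \<le> k"
          then have "i < m \<or> k - i < m" using k less.prems(1) by linarith
          then show "f i = \<zero> \<or> f (k - i) = \<zero>" 
            using less.prems(3)[of i] less.prems(3)[OF _ less_imp_diff_less[OF k(2)]] k(2) \<open>i \<le> k\<close> by auto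
        qed
      qed (use less.prems True in auto)
      then show ?thesis using P.I_prime[of f f] less.prems by auto
    qed
  qed
  have sub: "\<mm> \<subseteq> P"
  proof
    fix f assume "f \<in> \<mm>"
    then show "f \<in> P" by (intro nil[of 1]) (auto simp: \<mm>_def)
  qed
  moreover have "f 0 = \<zero>" if f: "f \<in> P" for f
  proof (rule ccontr)
    assume f0: "f 0 \<noteq> \<zero>"
    have fV: "f \<in> carrier V" using f P.a_subset by auto
    have u: "f 0 \<in> Units K" using f0 fV N_pos field_Units by simp
    define g where "g = \<ominus>\<^bsub>V\<^esub> f \<oplus>\<^bsub>V\<^esub> f 0 \<odot>\<^bsub>V\<^esub> monom 0"
    have f0K: "f 0 \<in> carrier K" using fV N_pos by simp
    have "g \<in> \<mm>" using fV N_pos f0K by (simp add: \<mm>_def g_def V_uminus l_neg)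
    then have "f \<oplus>\<^bsub>V\<^esub> g \<in> P" using sub f P.a_closed[of f g] by auto
    moreover have "f \<oplus>\<^bsub>V\<^esub> g = f 0 \<odot>\<^bsub>V\<^esub> monom 0"
      using fV f0K by (simp add: g_def V.M.r_neg2)
    ultimately have "f 0 \<odot>\<^bsub>V\<^esub> monom 0 \<in> P" by simp
    then have "cnv c (structure_map A (inv f 0)) (f 0 \<odot>\<^bsub>V\<^esub> monom 0) \<in> P"
      using P.I_l_closed[of "f 0 \<odot>\<^bsub>V\<^esub> monom 0" "structure_map A (inv f 0)"] u by (simp add: structure_map_A)
    moreover have "cnv c (structure_map A (inv f 0)) (f 0 \<odot>\<^bsub>V\<^esub> monom 0) = monom 0"
      using u f0K by (simp add: structure_map_mult compat_zero flip: V.smult_assoc1)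
    ultimately have "\<one>\<^bsub>A\<^esub> \<in> P" by simp
    then show False using P.one_imp_carrier P.I_notcarr by simp
  qed
  ultimately show ?thesis using P.a_subset by (auto simp: \<mm>_def)
qed

text \<open>
  With \<open>T\<close> trivial this computes the dimension, and with \<open>T\<close> the equality with \<open>\<mm>\<close> the height.
\<close>

lemma prime_chain_iff:
  "(\<exists>P :: nat \<Rightarrow> _. (\<forall>i\<le>n. primeideal (P i) A) \<and> (\<forall>i<n. P i \<subset> P (Suc i)) \<and> T (P n)) \<longleftrightarrow> n = 0 \<and> T \<mm>"
proof
  assume "\<exists>P :: nat \<Rightarrow> _. (\<forall>i\<le>n. primeideal (P i) A) \<and> (\<forall>i<n. P i \<subset> P (Suc i)) \<and> T (P n)"
  then obtain P where P: "\<forall>i\<le>n. primeideal (P i) A" "\<forall>i<n. P i \<subset> P (Suc i)" "T (P n)" by blast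
  then have eq: "P i = \<mm>" if "i \<le> n" for i using that primeideal_unique by blast
  have "n = 0"
  proof (rule ccontr)
    assume "n \<noteq> 0"
    then show False using P(2) eq[of 0] eq[of "Suc 0"] by auto
  qed
  then show "n = 0 \<and> T \<mm>" using P(3) eq[of n] by simp
qed (auto intro!: exI[of _ "\<lambda>_. \<mm>"] primeideal_\<mm>)

lemma krull_dim_A: "krull_dim A = 0"
proof -
  have "{enat n |n. \<exists>P :: nat \<Rightarrow> _. (\<forall>i\<le>n. primeideal (P i) A) \<and> (\<forall>i<n. P i \<subset> P (Suc i))} = {0}"
    using prime_chain_iff[of _ "\<lambda>_. True"] by (simp add: zero_enat_def)
  then show ?thesis by (simp add: krull_dim_def)
qed

lemma height_\<mm>: "height A \<mm> = 0"
proof -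
  have "{enat n |n. \<exists>P :: nat \<Rightarrow> _. (\<forall>i\<le>n. primeideal (P i) A) \<and> (\<forall>i<n. P i \<subset> P (Suc i)) \<and> P n = \<mm>} = {0}"
    using prime_chain_iff[of _ "\<lambda>Q. Q = \<mm>"] by (simp add: zero_enat_def)
  then show ?thesis by (simp add: height_def)
qed

text \<open>
  The basis element of largest degree is killed by \<open>\<mm>\<close>, so no element of \<open>\<mm>\<close> is a nonzerodivisor.
\<close>

lemma grade_\<mm>: "grade A \<mm> = 0"
proof -
  have zero: "Idl\<^bsub>A\<^esub> {} = {\<zero>\<^bsub>V\<^esub>}"
    using A.genideal_minimal[OF A.zeroideal, of "{}"] A.genideal_ideal[of "{}"]
      additive_subgroup.zero_closed[OF ideal.axioms(1)] by fastforce
  have reg: "set xs \<subseteq> \<mm> \<and> regular_sequence A xs \<longleftrightarrow> xs = []" for xs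
  proof
    assume xs: "xs = []"
    have "monom 0 \<noteq> \<zero>\<^bsub>V\<^esub>"
      using N_pos monom_coeff[of 0 0] V_zero[of 0] by (metis zero_not_one)
    then have "{\<zero>\<^bsub>V\<^esub>} \<noteq> carrier V" using monom_closed[of 0] by blast
    then show "set xs \<subseteq> \<mm> \<and> regular_sequence A xs"
      by (simp add: xs regular_sequence_def zero)
  next
    assume xs: "set xs \<subseteq> \<mm> \<and> regular_sequence A xs"
    show "xs = []"
    proof (rule ccontr)
      assume ne: "xs \<noteq> []"
      then have "xs ! 0 \<in> \<mm>" using xs by (meson length_greater_0_conv nth_mem subsetD)
      then have x: "xs ! 0 \<in> carrier V" "(xs ! 0) 0 = \<zero>" by (simp_all add: \<mm>_def)
      \<comment> \<open>the first element of the sequence must not be a zero divisor, but it kills \<open>t\<^sup>N\<^sup>-\<^sup>1\<close>\<close>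
      have "cnv c (monom (N - 1)) (xs ! 0) = \<zero>\<^bsub>V\<^esub>"
        by (rule V_eqI) (use x N_pos in \<open>auto simp: conv_monom_coeff\<close>)
      then have "xs ! 0 \<otimes>\<^bsub>A\<^esub> monom (N - 1) = \<zero>\<^bsub>V\<^esub>"
        using A.m_comm[of "xs ! 0" "monom (N - 1)"] x by simp
      then have "monom (N - 1) \<in> {\<zero>\<^bsub>V\<^esub>}"
        using xs ne zero unfolding regular_sequence_def
        by (metis A_simps(1) length_greater_0_conv monom_closed singletonI empty_set take0)
      then have "monom (N - 1) (N - 1) = \<zero>" using N_pos by simp
      then show False using N_pos by simp
    qed
  qed
  have "{enat (length xs) |xs. set xs \<subseteq> \<mm> \<and> regular_sequence A xs} = {0}"
    unfolding reg by (simp add: zero_enat_def)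
  then show ?thesis by (simp add: grade_def)
qed

abbreviation scalars where "scalars F \<equiv> restrict_scalars A F"

lemma coordinates_regular: "coordinate_space K (scalars (regular_module A)) N (\<lambda>m f. f m)"
proof -
  interpret M: Module.module K "scalars (regular_module A)"
    by (rule restrict_scalars_is_module[OF algebra_A module_regular])
  show ?thesis
  proof unfold_locales
    fix f assume f: "f \<in> carrier (scalars (regular_module A))" "\<And>m. m < N \<Longrightarrow> f m = \<zero>"
    then show "f = \<zero>\<^bsub>scalars (regular_module A)\<^esub>"
      by (intro V_eqI) (auto simp: restrict_scalars_def regular_module_def)
  qed (auto simp: restrict_scalars_def regular_module_def structure_map_mult compat_zero)
qed

lemma coordinates_\<Omega>: "coordinate_space K (scalars \<Omega>) N (\<lambda>m f. f m)"
proof -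
  interpret M: Module.module K "scalars \<Omega>"
    by (rule restrict_scalars_is_module[OF algebra_A module_\<Omega>])
  show ?thesis
  proof unfold_locales
    fix f assume f: "f \<in> carrier (scalars \<Omega>)" "\<And>m. m < N \<Longrightarrow> f m = \<zero>"
    then show "f = \<zero>\<^bsub>scalars \<Omega>\<^esub>"
      by (intro V_eqI) (auto simp: restrict_scalars_def)
  qed (auto simp: restrict_scalars_def structure_map_mult compat_zero)
qed

lemma submodule_scalars:
  "Module.module A F \<Longrightarrow> submodule A S F \<Longrightarrow> submodule K S (scalars F)"
  by (rule submodule_restrict_scalars[OF algebra_A])

lemma noetherian_A: "noetherian_ring A"
proof (rule A.noetherian_ringI)
  interpret coordinate_space K "scalars (regular_module A)" N "\<lambda>m f. f m" by (rule coordinates_regular)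
  have sub: "submodule K I (scalars (regular_module A))" if "ideal I A" for I
    using submodule_scalars[OF module_regular] that ideal_iff_submodule_regular[OF cring_A] by blast
  fix I assume I: "ideal I A"
  then have IA: "I \<subseteq> carrier A" using ideal.axioms(1) additive_subgroup.a_subset by blast
  show "\<exists>F\<subseteq>carrier A. finite F \<and> I = Idl\<^bsub>A\<^esub> F"
  proof (rule submodule_growth_induct[OF sub[OF I], of "\<lambda>T. \<exists>F\<subseteq>carrier A. finite F \<and> T = Idl\<^bsub>A\<^esub> F"])
    fix T assume "\<exists>F\<subseteq>carrier A. finite F \<and> T = Idl\<^bsub>A\<^esub> F"
    then show "submodule K T (scalars (regular_module A))" using sub A.genideal_ideal by blast
  next
    show "\<exists>F\<subseteq>carrier A. finite F \<and> Idl\<^bsub>A\<^esub> {} = Idl\<^bsub>A\<^esub> F" by (rule exI[of _ "{}"]) simp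
    show "Idl\<^bsub>A\<^esub> {} \<subseteq> I" by (rule A.genideal_minimal[OF I]) simp
  next
    fix T s assume "\<exists>F\<subseteq>carrier A. finite F \<and> T = Idl\<^bsub>A\<^esub> F" and T: "T \<subseteq> I" and s: "s \<in> I" "s \<notin> T"
    then obtain F where F: "F \<subseteq> carrier A" "finite F" "T = Idl\<^bsub>A\<^esub> F" by blast
    have sF: "insert s F \<subseteq> carrier A" using F s IA by blast
    have self: "insert s F \<subseteq> Idl\<^bsub>A\<^esub> (insert s F)" by (rule A.genideal_self[OF sF])
    have "T \<subseteq> Idl\<^bsub>A\<^esub> (insert s F)"
      unfolding F(3) by (rule A.genideal_minimal[OF A.genideal_ideal[OF sF]]) (use self in blast)
    moreover have "Idl\<^bsub>A\<^esub> (insert s F) \<subseteq> I"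
      by (rule A.genideal_minimal[OF I]) (use A.genideal_self[OF F(1)] F(3) T s in blast)
    ultimately show "\<exists>T'. (\<exists>F\<subseteq>carrier A. finite F \<and> T' = Idl\<^bsub>A\<^esub> F) \<and> T \<subset> T' \<and> T' \<subseteq> I"
      using sF F(2) s self by (intro exI[of _ "Idl\<^bsub>A\<^esub> (insert s F)"]) blast
  qed
qed

lemma cohen_macaulay_A: "cohen_macaulay A"
  unfolding cohen_macaulay_def
proof (intro conjI allI impI cring_A noetherian_A)
  fix P assume "maximalideal P A"
  then have "P = \<mm>" using A.maximalideal_prime primeideal_unique by blast
  then show "grade A P = height A P" by (simp add: grade_\<mm> height_\<mm>)
qed

section \<open>Free resolutions of the residue field\<close>

abbreviation F where "F n \<equiv> free_module A n"

lemma F_simps: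
  "carrier (F n) = {..<n} \<rightarrow>\<^sub>E carrier V"
  "x \<oplus>\<^bsub>F n\<^esub> y = (\<lambda>i\<in>{..<n}. x i \<oplus>\<^bsub>V\<^esub> y i)"
  "r \<odot>\<^bsub>F n\<^esub> x = (\<lambda>i\<in>{..<n}. cnv c r (x i))"
  "\<zero>\<^bsub>F n\<^esub> = (\<lambda>i\<in>{..<n}. \<zero>\<^bsub>V\<^esub>)"
  by (simp_all add: A.func_space_def)

lemma F_component: "x \<in> carrier (F n) \<Longrightarrow> i < n \<Longrightarrow> x i \<in> carrier V"
  unfolding F_simps by (erule PiE_mem) simp

lemma F_memI: "(\<And>i. i < n \<Longrightarrow> f i \<in> carrier V) \<Longrightarrow> (\<lambda>i\<in>{..<n}. f i) \<in> carrier (F n)"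
  unfolding F_simps by (subst restrict_PiE_iff) simp

lemma F_eqI: "\<lbrakk>x \<in> carrier (F n); y \<in> carrier (F n); \<And>i. i < n \<Longrightarrow> x i = y i\<rbrakk> \<Longrightarrow> x = y"
  unfolding F_simps by (erule PiE_ext, assumption) (blast dest: lessThan_iff[THEN iffD1])

lemma module_F: "Module.module A (F n)"
  by (rule A.func_space_is_module)

lemma coordinates_F: "coordinate_space K (scalars (F n)) (n * N) (\<lambda>m x. x (m div N) (m mod N))"
proof -
  interpret M: Module.module K "scalars (F n)"
    by (rule restrict_scalars_is_module[OF algebra_A module_F])
  have idx: "m div N < n" "m mod N < N" if "m < n * N" for m
    using that N_pos by (simp_all add: less_mult_imp_div_less)
  note comp = F_component[where n = n]
  show ?thesis
  proof unfold_locales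
    fix x assume x: "x \<in> carrier (scalars (F n))" and 0: "\<And>m. m < n * N \<Longrightarrow> x (m div N) (m mod N) = \<zero>"
    then have xF: "x \<in> carrier (F n)" by (simp add: restrict_scalars_def)
    show "x = \<zero>\<^bsub>scalars (F n)\<^esub>"
    proof (rule extensionalityI[of _ "{..<n}"])
      fix i assume i: "i \<in> {..<n}"
      have "x i = \<zero>\<^bsub>V\<^esub>"
      proof (rule V_eqI)
        fix k assume k: "k < N"
        have "i * N + k < Suc i * N" using k by simp
        also have "\<dots> \<le> n * N" using i by (intro mult_le_mono1) simp
        finally show "x i k = \<zero>\<^bsub>V\<^esub> k" using 0[of "i * N + k"] k by simp
      qed (use comp[OF xF] i in auto)
      then show "x i = \<zero>\<^bsub>scalars (F n)\<^esub> i" using i by (simp add: restrict_scalars_def F_simps)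
    qed (use xF in \<open>simp_all add: restrict_scalars_def F_simps PiE_def\<close>)
  qed (simp_all add: restrict_scalars_def idx comp F_simps structure_map_mult compat_zero PiE_mem)
qed

text \<open>
  Noetherianity in the form that resolutions need.  The image of \<open>d\<close> is enlarged by one more column \<open>s\<close>
  until it is all of \<open>S\<close>.
\<close>

lemma submodule_of_free_is_image:
  assumes S: "submodule A S (F n)"
  shows "\<exists>m d. d \<in> module_hom A (F m) (F n) \<and> d ` carrier (F m) = S"
proof -
  interpret C: coordinate_space K "scalars (F n)" "n * N" "\<lambda>m x. x (m div N) (m mod N)"
    by (rule coordinates_F)
  interpret M: Module.module A "F n" by (rule module_F)
  interpret S: submodule A S "F n" by (rule S)
  let ?Q = "\<lambda>T. \<exists>m d. d \<in> module_hom A (F m) (F n) \<and> d ` carrier (F m) = T"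
  show ?thesis
  proof (rule C.submodule_growth_induct[where Q = ?Q and ?T0.0 = "{\<zero>\<^bsub>F n\<^esub>}"])
    show "submodule K S (scalars (F n))" by (rule submodule_scalars[OF module_F S])
    fix T assume "?Q T"
    then obtain m d where d: "d \<in> module_hom A (F m) (F n)" "d ` carrier (F m) = T" by (elim exE conjE)
    interpret d: mod_hom A "F m" "F n" d
      using d(1) module_F by (simp add: mod_hom_def mod_hom_axioms_def)
    have "submodule A T (F n)" using d.im_is_submodule d(2) by (simp add: d.im_def)
    then show "submodule K T (scalars (F n))" by (rule submodule_scalars[OF module_F])
  next
    have "(\<lambda>_. \<zero>\<^bsub>F n\<^esub>) \<in> module_hom A (F 0) (F n)"
      by (simp add: hom_def)
    moreover have "carrier (F 0) = {\<lambda>_. undefined}" unfolding F_simps by simp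
    then have "(\<lambda>_. \<zero>\<^bsub>F n\<^esub>) ` carrier (F 0) = {\<zero>\<^bsub>F n\<^esub>}"
      by (simp only: image_insert image_empty)
    ultimately show "?Q {\<zero>\<^bsub>F n\<^esub>}" by blast
    show "{\<zero>\<^bsub>F n\<^esub>} \<subseteq> S" using S.zero_closed by blast
  next
    fix T s assume Q: "?Q T" and T: "T \<subseteq> S" and s: "s \<in> S" "s \<notin> T"
    from Q obtain m d where d: "d \<in> module_hom A (F m) (F n)" "d ` carrier (F m) = T" by (elim exE conjE)
    interpret d: mod_hom A "F m" "F n" d
      using d(1) module_F by (simp add: mod_hom_def mod_hom_axioms_def)
    have sF: "s \<in> carrier (F n)" by (rule subsetD[OF S.subset s(1)])
    define d' where "d' r = d (restrict r {..<m}) \<oplus>\<^bsub>F n\<^esub> r m \<odot>\<^bsub>F n\<^esub> s" for r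
    have res: "restrict r {..<m} \<in> carrier (F m)" "r m \<in> carrier A" if "r \<in> carrier (F (Suc m))" for r
      using F_component[OF that] by (simp_all add: F_memI)
    have d'c: "d' r \<in> carrier (F n)" if "r \<in> carrier (F (Suc m))" for r
      using res[OF that] sF by (simp only: d'_def M.M.a_closed M.smult_closed d.f_im)
    have hom: "d' \<in> module_hom A (F (Suc m)) (F n)"
    proof -
      have "d' (r \<oplus>\<^bsub>F (Suc m)\<^esub> t) = d' r \<oplus>\<^bsub>F n\<^esub> d' t"
        if r: "r \<in> carrier (F (Suc m))" and t: "t \<in> carrier (F (Suc m))" for r t
      proof -
        have "restrict (r \<oplus>\<^bsub>F (Suc m)\<^esub> t) {..<m} = restrict r {..<m} \<oplus>\<^bsub>F m\<^esub> restrict t {..<m}"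
          unfolding F_simps by (rule ext) simp
        moreover have "(r \<oplus>\<^bsub>F (Suc m)\<^esub> t) m = r m \<oplus>\<^bsub>A\<^esub> t m" by (simp add: F_simps)
        ultimately show ?thesis
          using res[OF r] res[OF t] sF d.f_im
          by (simp only: d'_def d.f_add M.smult_l_distr M.M.a_ac M.M.a_closed M.smult_closed)
      qed
      moreover have "d' (q \<odot>\<^bsub>F (Suc m)\<^esub> r) = q \<odot>\<^bsub>F n\<^esub> d' r"
        if q: "q \<in> carrier A" and r: "r \<in> carrier (F (Suc m))" for q r
      proof -
        have "restrict (q \<odot>\<^bsub>F (Suc m)\<^esub> r) {..<m} = q \<odot>\<^bsub>F m\<^esub> restrict r {..<m}"
          unfolding F_simps by (rule ext) simp
        moreover have "(q \<odot>\<^bsub>F (Suc m)\<^esub> r) m = q \<otimes>\<^bsub>A\<^esub> r m" by (simp add: F_simps)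
        ultimately show ?thesis
          using res[OF r] sF d.f_im q
          by (simp only: d'_def d.f_smult M.smult_r_distr M.smult_assoc1 M.smult_closed)
      qed
      ultimately show ?thesis using d'c by (simp add: hom_def)
    qed
    have sub: "d' ` carrier (F (Suc m)) \<subseteq> S"
    proof (rule image_subsetI)
      fix r assume r: "r \<in> carrier (F (Suc m))"
      have "d (restrict r {..<m}) \<in> S" using T d(2) res[OF r] by blast
      then show "d' r \<in> S" unfolding d'_def using res[OF r] s(1) by (intro S.m_closed S.smult_closed)
    qed
    have T': "T \<subseteq> d' ` carrier (F (Suc m))"
    proof
      fix t assume "t \<in> T"
      then obtain x where x: "x \<in> carrier (F m)" "t = d x" using d(2) by blast
      define r where "r = (\<lambda>i\<in>{..<Suc m}. if i < m then x i else \<zero>\<^bsub>V\<^esub>)"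
      have r: "r \<in> carrier (F (Suc m))"
        unfolding r_def by (rule F_memI) (use F_component[OF x(1)] in simp)
      have "restrict r {..<m} = x"
        by (rule F_eqI[OF res(1)[OF r] x(1)]) (simp add: r_def)
      moreover have "r m = \<zero>\<^bsub>A\<^esub>" by (simp add: r_def)
      ultimately have "d' r = d x" using sF x(1) by (simp only: d'_def M.smult_l_null M.M.r_zero d.f_im)
      then show "t \<in> d' ` carrier (F (Suc m))" using r x(2) by (intro image_eqI[of _ _ r]) simp_all
    qed
    have s': "s \<in> d' ` carrier (F (Suc m))"
    proof -
      define r where "r = (\<lambda>i\<in>{..<Suc m}. if i < m then \<zero>\<^bsub>V\<^esub> else monom 0)"
      have r: "r \<in> carrier (F (Suc m))" unfolding r_def by (rule F_memI) simp
      have "restrict r {..<m} = \<zero>\<^bsub>F m\<^esub>" unfolding F_simps r_def by (rule ext) simp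
      moreover have "r m = \<one>\<^bsub>A\<^esub>" by (simp add: r_def)
      ultimately have "d' r = s" using sF by (simp only: d'_def d.f0_is_0 M.smult_one M.M.l_zero)
      then show ?thesis using r by (intro image_eqI[of _ _ r]) simp_all
    qed
    show "\<exists>T'. ?Q T' \<and> T \<subset> T' \<and> T' \<subseteq> S"
      by (rule exI[of _ "d' ` carrier (F (Suc m))"]) (use sub T' s' s(2) in \<open>intro conjI exI[of _ "Suc m"] exI[of _ d'] hom refl psubsetI; blast?\<close>)
  qed
qed

lemma kernel_of_free_is_image:
  assumes h: "h \<in> module_hom A (F n) Q" and Q: "Module.module A Q"
  shows "\<exists>m d. d \<in> module_hom A (F m) (F n) \<and> d ` carrier (F m) = {x \<in> carrier (F n). h x = \<zero>\<^bsub>Q\<^esub>}"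
proof -
  interpret h: mod_hom A "F n" Q h
    using assms module_F by (simp add: mod_hom_def mod_hom_axioms_def)
  show ?thesis using submodule_of_free_is_image[OF h.ker_is_submodule] by (simp add: h.ker_def)
qed

abbreviation \<kk> where "\<kk> \<equiv> residue_module A D"

lemma submodule_\<mm>: "submodule A \<mm> (regular_module A)"
  using primeideal_\<mm> ideal_iff_submodule_regular[OF cring_A] primeideal.axioms(1) by blast

lemma k_eq: "\<kk> = quotient_module (regular_module A) \<mm>"
  by (simp add: residue_module_def irrelevant_ideal_A)

abbreviation q where "q f \<equiv> \<mm> +>\<^bsub>regular_module A\<^esub> f"

lemma regular_simps [simp]:
  "carrier (regular_module A) = carrier V" "add (regular_module A) = add V" "zero (regular_module A) = zero V"
  "smult (regular_module A) = cnv c"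
  by (simp_all add: regular_module_def)

lemma q_laws:
  "q ` carrier V = carrier \<kk>"
  "\<zero>\<^bsub>\<kk>\<^esub> = q \<zero>\<^bsub>V\<^esub>"
  "f \<in> carrier V \<Longrightarrow> g \<in> carrier V \<Longrightarrow> q (f \<oplus>\<^bsub>V\<^esub> g) = q f \<oplus>\<^bsub>\<kk>\<^esub> q g"
  "f \<in> carrier V \<Longrightarrow> g \<in> carrier V \<Longrightarrow> q (cnv c f g) = f \<odot>\<^bsub>\<kk>\<^esub> q g"
  using quotient_map_onto[OF module_regular submodule_\<mm>]
    quotient_map_zero[OF module_regular submodule_\<mm>]
    quotient_map_add[OF module_regular submodule_\<mm>]
    quotient_map_smult[OF module_regular submodule_\<mm>]
  by (simp_all add: k_eq)

lemma regular_minus: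
  assumes "f \<in> carrier V" "g \<in> carrier V"
  shows "f \<ominus>\<^bsub>regular_module A\<^esub> g \<in> carrier V"
    and "i < N \<Longrightarrow> (f \<ominus>\<^bsub>regular_module A\<^esub> g) i = \<zero> \<longleftrightarrow> f i = g i"
proof -
  have "f \<ominus>\<^bsub>regular_module A\<^esub> g = f \<oplus>\<^bsub>V\<^esub> \<ominus>\<^bsub>V\<^esub> g"
    by (simp add: a_minus_def a_inv_def m_inv_def)
  then show "f \<ominus>\<^bsub>regular_module A\<^esub> g \<in> carrier V"
    and "i < N \<Longrightarrow> (f \<ominus>\<^bsub>regular_module A\<^esub> g) i = \<zero> \<longleftrightarrow> f i = g i"
    using assms minus_other_side[of "f i" "g i"] by (simp_all add: V_uminus a_minus_def)
qed

lemma q_eq_iff: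
  assumes "f \<in> carrier V" "g \<in> carrier V" shows "q f = q g \<longleftrightarrow> f 0 = g 0"
  using quotient_map_eq_iff[OF module_regular submodule_\<mm>] regular_minus[OF assms] assms N_pos
  by (simp add: \<mm>_def)

lemma module_k: "Module.module A \<kk>"
  unfolding k_eq by (rule quotient_is_module[OF module_regular submodule_\<mm>])

lemma resolution_exists: "\<exists>b e d. free_resolution A \<kk> b e d"
proof -
  define e where "e x = q (x 0)" for x :: "nat \<Rightarrow> nat \<Rightarrow> 'a"
  have x0: "x 0 \<in> carrier V" if "x \<in> carrier (F 1)" for x :: "nat \<Rightarrow> nat \<Rightarrow> 'a"
    using F_component[OF that] by simp
  have e: "e \<in> module_hom A (F 1) \<kk>"
    using q_laws(1) by (auto simp: hom_def e_def x0 F_simps(2,3) q_laws(3,4))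
  have e_onto: "e ` carrier (F 1) = carrier \<kk>"
  proof -
    have "q f \<in> e ` carrier (F 1)" if "f \<in> carrier V" for f
      by (rule image_eqI[of _ _ "\<lambda>i\<in>{..<1}. f"]) (use that in \<open>auto simp: e_def F_simps\<close>)
    then have "q ` carrier V \<subseteq> e ` carrier (F 1)" by (rule image_subsetI)
    then show ?thesis using hom_closed[OF e] unfolding q_laws(1) by blast
  qed
  \<comment> \<open>stage \<open>i\<close> of the construction is the triple of \<open>b i\<close>, \<open>b (i + 1)\<close> and \<open>d i\<close>\<close>
  define P where "P i t \<longleftrightarrow> (case t of (n, m, d) \<Rightarrow> d \<in> module_hom A (F m) (F n) \<and>
    (i = 0 \<longrightarrow> n = 1 \<and> d ` carrier (F m) = {x \<in> carrier (F 1). e x = \<zero>\<^bsub>\<kk>\<^esub>}))" for i :: nat and t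
  define next_step where "next_step t t' \<longleftrightarrow> (case (t, t') of ((n, m, d), (n', m', d')) \<Rightarrow>
    n' = m \<and> d' ` carrier (F m') = {x \<in> carrier (F m). d x = \<zero>\<^bsub>F n\<^esub>})"
    for t t' :: "nat \<times> nat \<times> ((nat \<Rightarrow> nat \<Rightarrow> 'a) \<Rightarrow> nat \<Rightarrow> nat \<Rightarrow> 'a)"
  have "\<exists>s. \<forall>i. P i (s i) \<and> next_step (s i) (s (Suc i))"
  proof (rule dependent_nat_choice)
    obtain m d where "d \<in> module_hom A (F m) (F 1)" "d ` carrier (F m) = {x \<in> carrier (F 1). e x = \<zero>\<^bsub>\<kk>\<^esub>}"
      using kernel_of_free_is_image[OF e module_k] by blast
    then have "P 0 (1, m, d)" by (simp add: P_def)
    then show "\<exists>t. P 0 t" by blast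
    fix t i assume P: "P i t"
    obtain n m d where t: "t = (n, m, d)" by (cases t)
    have "d \<in> module_hom A (F m) (F n)" using P by (simp add: P_def t)
    then obtain m' d' where "d' \<in> module_hom A (F m') (F m)"
      "d' ` carrier (F m') = {x \<in> carrier (F m). d x = \<zero>\<^bsub>F n\<^esub>}"
      using kernel_of_free_is_image[OF _ module_F] by blast
    then have "P (Suc i) (m, m', d') \<and> next_step t (m, m', d')" by (simp add: P_def next_step_def t)
    then show "\<exists>t'. P (Suc i) t' \<and> next_step t t'" by blast
  qed
  then obtain s where s: "P i (s i)" "next_step (s i) (s (Suc i))" for i by blast
  define b where "b i = fst (s i)" for i
  define d where "d i = snd (snd (s i))" for i
  have si: "s i = (b i, b (Suc i), d i)" for i
  proof -
    obtain n m f where t: "s i = (n, m, f)" by (cases "s i")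
    obtain n' m' f' where t': "s (Suc i) = (n', m', f')" by (cases "s (Suc i)")
    show ?thesis using s(2)[of i] by (simp add: next_step_def t t' b_def d_def)
  qed
  have "b 0 = 1" using s(1)[of 0] by (simp add: P_def si)
  then have "free_resolution A \<kk> b e d"
    using e e_onto s unfolding free_resolution_def by (simp add: P_def next_step_def si)
  then show ?thesis by blast
qed

text \<open>
  The resolution is an arbitrary choice, so what follows may use only that it is one.
\<close>

lemma Ext_by_resolution:
  "\<exists>b e d. free_resolution A \<kk> b e d \<and> Ext A i \<kk> N' = Ext_of_resolution A b d i N'"
proof -
  define t where "t = (SOME (b, e, d). free_resolution A \<kk> b e d)"
  have "case t of (b, e, d) \<Rightarrow> free_resolution A \<kk> b e d"
    unfolding t_def by (rule someI_ex) (use resolution_exists in simp)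
  then show ?thesis unfolding Ext_def t_def[symmetric] by (cases t) auto
qed

section \<open>Vanishing of the higher Ext modules of the dual\<close>

text \<open>
  The simplifier replaces the operations of \<open>A\<close> by those of \<open>V\<close>; these are the module laws in the
  resulting normal form.
\<close>

lemma A_module_laws:
  assumes "Module.module A M"
  shows "\<lbrakk>r \<in> carrier V; x \<in> carrier M\<rbrakk> \<Longrightarrow> r \<odot>\<^bsub>M\<^esub> x \<in> carrier M"
    and "\<lbrakk>r \<in> carrier V; s \<in> carrier V; x \<in> carrier M\<rbrakk> \<Longrightarrow> (r \<oplus>\<^bsub>V\<^esub> s) \<odot>\<^bsub>M\<^esub> x = r \<odot>\<^bsub>M\<^esub> x \<oplus>\<^bsub>M\<^esub> s \<odot>\<^bsub>M\<^esub> x"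
    and "\<lbrakk>r \<in> carrier V; s \<in> carrier V; x \<in> carrier M\<rbrakk> \<Longrightarrow> cnv c r s \<odot>\<^bsub>M\<^esub> x = r \<odot>\<^bsub>M\<^esub> (s \<odot>\<^bsub>M\<^esub> x)"
    and "\<lbrakk>r \<in> carrier V; x \<in> carrier M; y \<in> carrier M\<rbrakk> \<Longrightarrow> r \<odot>\<^bsub>M\<^esub> (x \<oplus>\<^bsub>M\<^esub> y) = r \<odot>\<^bsub>M\<^esub> x \<oplus>\<^bsub>M\<^esub> r \<odot>\<^bsub>M\<^esub> y"
    and "x \<in> carrier M \<Longrightarrow> \<zero>\<^bsub>V\<^esub> \<odot>\<^bsub>M\<^esub> x = \<zero>\<^bsub>M\<^esub>"
    and "x \<in> carrier M \<Longrightarrow> monom 0 \<odot>\<^bsub>M\<^esub> x = x"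
    and "r \<in> carrier V \<Longrightarrow> r \<odot>\<^bsub>M\<^esub> \<zero>\<^bsub>M\<^esub> = \<zero>\<^bsub>M\<^esub>"
  using assms Module.module.smult_closed[OF assms, of r x] Module.module.smult_l_distr[OF assms, of r s x]
    Module.module.smult_assoc1[OF assms, of r s x] Module.module.smult_r_distr[OF assms, of r x y]
    Module.module.smult_l_null[OF assms, of x] Module.module.smult_one[OF assms, of x]
    Module.module.smult_r_null[OF assms, of r]
  by simp_all

text \<open>
  The elements of the algebra whose action commutes with \<open>g\<close> form a subspace, so the basis suffices.
\<close>

lemma hom_if_commutes_with_monoms:
  assumes M: "Module.module A M" and M': "Module.module A M'"
    and closed: "\<And>x. x \<in> carrier M \<Longrightarrow> g x \<in> carrier M'"
    and add: "\<And>x y. \<lbrakk>x \<in> carrier M; y \<in> carrier M\<rbrakk> \<Longrightarrow> g (x \<oplus>\<^bsub>M\<^esub> y) = g x \<oplus>\<^bsub>M'\<^esub> g y"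
    and scalar: "\<And>a x. \<lbrakk>a \<in> carrier K; x \<in> carrier M\<rbrakk> \<Longrightarrow>
      g (structure_map A a \<odot>\<^bsub>M\<^esub> x) = structure_map A a \<odot>\<^bsub>M'\<^esub> g x"
    and monom: "\<And>n x. \<lbrakk>n < N; x \<in> carrier M\<rbrakk> \<Longrightarrow> g (monom n \<odot>\<^bsub>M\<^esub> x) = monom n \<odot>\<^bsub>M'\<^esub> g x"
  shows "g \<in> module_hom A M M'"
proof -
  have "g (r \<odot>\<^bsub>M\<^esub> x) = r \<odot>\<^bsub>M'\<^esub> g x" if x: "x \<in> carrier M" and r: "r \<in> carrier V" for r x
    using r
  proof (induction r rule: monom_induct)
    case zero
    then show ?case using scalar[OF zero_closed x] by (simp add: structure_map_zero)
  next
    case (add r s)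
    then show ?case
      using assms(4)[of "r \<odot>\<^bsub>M\<^esub> x" "s \<odot>\<^bsub>M\<^esub> x"] x closed[OF x]
      by (simp add: A_module_laws[OF M] A_module_laws[OF M'])
  next
    case (monom a n)
    have "a \<odot>\<^bsub>V\<^esub> monom n = cnv c (structure_map A a) (monom n)"
      using monom by (simp add: structure_map_mult compat_zero)
    then show ?case
      using monom x closed[OF x] scalar[of a "monom n \<odot>\<^bsub>M\<^esub> x"] assms(6)[of n x]
      by (simp add: A_module_laws[OF M] A_module_laws[OF M'] structure_map_closed)
  qed
  then show ?thesis using closed add by (simp add: hom_def)
qed

lemma cocycles_submodule:
  assumes N': "Module.module A N'" and d: "d i \<in> module_hom A (F (b (Suc i))) (F (b i))"
  shows "submodule A (Ext_cocycles A b d i N') (Hom_module A (F (b i)) N')"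
proof -
  interpret N': Module.module A N' by fact
  let ?H = "Hom_module A (F (b i)) N'" and ?Z = "Ext_cocycles A b d i N'"
  interpret H: Module.module A ?H by (rule Hom_is_module[OF module_F N'])
  have dc: "d i x \<in> carrier (F (b i))" if "x \<in> carrier (F (b (Suc i)))" for x
    using hom_closed[OF d] that by blast
  show ?thesis
  proof (rule submodule.intro[OF H.module_axioms])
    show "?Z \<subseteq> carrier ?H" by (auto simp: Ext_cocycles_def)
    show "\<zero>\<^bsub>?H\<^esub> \<in> ?Z"
      using H.M.zero_closed dc by (simp add: Ext_cocycles_def) (simp add: Hom_module_def)
    fix f assume f: "f \<in> ?Z"
    then have fH: "f \<in> carrier ?H"
      and f0: "\<And>x. x \<in> carrier (F (b (Suc i))) \<Longrightarrow> f (d i x) = \<zero>\<^bsub>N'\<^esub>" by (auto simp: Ext_cocycles_def)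
    show "r \<odot>\<^bsub>?H\<^esub> f \<in> ?Z" if r: "r \<in> carrier A" for r
    proof -
      have "(r \<odot>\<^bsub>?H\<^esub> f) (d i x) = \<zero>\<^bsub>N'\<^esub>" if "x \<in> carrier (F (b (Suc i)))" for x
        using that r by (simp add: Hom_module_def dc f0 N'.smult_r_null del: A_simps)
      then show ?thesis using H.smult_closed[OF r fH] by (simp add: Ext_cocycles_def)
    qed
    fix g assume g: "g \<in> ?Z"
    then have gH: "g \<in> carrier ?H"
      and g0: "\<And>x. x \<in> carrier (F (b (Suc i))) \<Longrightarrow> g (d i x) = \<zero>\<^bsub>N'\<^esub>" by (auto simp: Ext_cocycles_def)
    have "(f \<oplus>\<^bsub>?H\<^esub> g) (d i x) = \<zero>\<^bsub>N'\<^esub>" if "x \<in> carrier (F (b (Suc i)))" for x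
      using that by (simp add: Hom_module_def dc f0 g0)
    then show "f \<oplus>\<^bsub>?H\<^esub> g \<in> ?Z"
      using H.M.a_closed[OF fH gH] by (simp add: Ext_cocycles_def)
  qed
qed

lemma F_smult_smult:
  "\<lbrakk>r \<in> carrier V; s \<in> carrier V; x \<in> carrier (F n)\<rbrakk> \<Longrightarrow> r \<odot>\<^bsub>F n\<^esub> (s \<odot>\<^bsub>F n\<^esub> x) = cnv c r s \<odot>\<^bsub>F n\<^esub> x"
  by (simp add: A_module_laws[OF module_F])

lemma conv_monom_monom:
  assumes "i < N" "j < N"
  shows "cnv w (monom i) (monom j) = (if i + j < N \<and> w i j then monom (i + j) else \<zero>\<^bsub>V\<^esub>)"
  by (rule V_eqI) (use assms in \<open>auto simp: conv_monom_coeff\<close>)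

text \<open>
  Half of the isomorphism \<open>Hom\<^sub>\<bbbK>(F, \<bbbK>) \<cong> Hom\<^sub>A(F, Hom\<^sub>\<bbbK>(A, \<bbbK>))\<close>: a functional \<open>g0\<close> becomes the map
  that sends \<open>x\<close> to the functional \<open>r \<mapsto> g0 (r x)\<close>.
\<close>

lemma lift_functional:
  assumes g0: "\<And>x. x \<in> carrier (F n) \<Longrightarrow> g0 x \<in> carrier K"
      "\<And>x y. \<lbrakk>x \<in> carrier (F n); y \<in> carrier (F n)\<rbrakk> \<Longrightarrow> g0 (x \<oplus>\<^bsub>F n\<^esub> y) = g0 x \<oplus> g0 y"
      "\<And>a x. \<lbrakk>a \<in> carrier K; x \<in> carrier (F n)\<rbrakk> \<Longrightarrow> g0 (structure_map A a \<odot>\<^bsub>F n\<^esub> x) = a \<otimes> g0 x"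
  shows "(\<lambda>x\<in>carrier (F n). \<lambda>k\<in>{..<N}. g0 (monom (N - 1 - k) \<odot>\<^bsub>F n\<^esub> x)) \<in> carrier (Hom_module A (F n) \<Omega>)"
proof -
  interpret M: Module.module A "F n" by (rule module_F)
  have sc: "r \<odot>\<^bsub>F n\<^esub> x \<in> carrier (F n)" if "r \<in> carrier V" "x \<in> carrier (F n)" for r x
    using M.smult_closed[of r x] that by simp
  define g where "g x = (\<lambda>k\<in>{..<N}. g0 (monom (N - 1 - k) \<odot>\<^bsub>F n\<^esub> x))" for x
  have gV: "g x \<in> carrier V" if "x \<in> carrier (F n)" for x
    unfolding g_def by (rule V_memI) (simp add: g0(1) sc that)
  have gk: "g x k = g0 (monom (N - 1 - k) \<odot>\<^bsub>F n\<^esub> x)" if "k < N" for x k using that by (simp add: g_def)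
  have g00: "g0 \<zero>\<^bsub>F n\<^esub> = \<zero>"
    using g0(3)[of \<zero> "\<zero>\<^bsub>F n\<^esub>"] g0(1)[OF M.M.zero_closed] M.smult_r_null[of "\<zero>\<^bsub>V\<^esub>"]
    by (simp add: structure_map_zero)
  have "g \<in> module_hom A (F n) \<Omega>"
  proof (rule hom_if_commutes_with_monoms[OF module_F module_\<Omega>])
    show "g x \<in> carrier \<Omega>" if "x \<in> carrier (F n)" for x using gV[OF that] by simp
    show "g (x \<oplus>\<^bsub>F n\<^esub> y) = g x \<oplus>\<^bsub>\<Omega>\<^esub> g y" if x: "x \<in> carrier (F n)" and y: "y \<in> carrier (F n)" for x y
      unfolding \<Omega>_simps
    proof (rule V_eqI)
      fix k assume k: "k < N"
      have "monom (N - 1 - k) \<odot>\<^bsub>F n\<^esub> (x \<oplus>\<^bsub>F n\<^esub> y) = monom (N - 1 - k) \<odot>\<^bsub>F n\<^esub> x \<oplus>\<^bsub>F n\<^esub> monom (N - 1 - k) \<odot>\<^bsub>F n\<^esub> y"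
        using M.smult_r_distr[of "monom (N - 1 - k)"] x y by simp
      then show "g (x \<oplus>\<^bsub>F n\<^esub> y) k = (g x \<oplus>\<^bsub>V\<^esub> g y) k"
        using k x y by (simp add: gk g0(2) sc)
    qed (simp_all add: gV x y M.M.a_closed)
    show "g (structure_map A a \<odot>\<^bsub>F n\<^esub> x) = structure_map A a \<odot>\<^bsub>\<Omega>\<^esub> g x"
      if a: "a \<in> carrier K" and x: "x \<in> carrier (F n)" for a x
    proof -
      have "g (structure_map A a \<odot>\<^bsub>F n\<^esub> x) = a \<odot>\<^bsub>V\<^esub> g x"
      proof (rule V_eqI)
        fix k assume k: "k < N"
        have "monom (N - 1 - k) \<odot>\<^bsub>F n\<^esub> (structure_map A a \<odot>\<^bsub>F n\<^esub> x) =
            structure_map A a \<odot>\<^bsub>F n\<^esub> (monom (N - 1 - k) \<odot>\<^bsub>F n\<^esub> x)"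
          using F_smult_smult[OF monom_closed structure_map_closed[OF a] x]
            F_smult_smult[OF structure_map_closed[OF a] monom_closed x]
            A.m_comm[of "monom (N - 1 - k)" "structure_map A a"] structure_map_closed[OF a] by simp
        then show "g (structure_map A a \<odot>\<^bsub>F n\<^esub> x) k = (a \<odot>\<^bsub>V\<^esub> g x) k"
          using k by (simp add: gk g0(3) sc a x)
      qed (simp_all add: gV x a sc structure_map_closed)
      then show ?thesis using a gV[OF x] by (simp add: structure_map_mult compat_zero)
    qed
    show "g (monom j \<odot>\<^bsub>F n\<^esub> x) = monom j \<odot>\<^bsub>\<Omega>\<^esub> g x" if j: "j < N" and x: "x \<in> carrier (F n)" for j x
      unfolding \<Omega>_simps
    proof (rule V_eqI)
      fix k assume k: "k < N"
      have k': "N - 1 - k < N" using k by simp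
      have null: "\<zero>\<^bsub>V\<^esub> \<odot>\<^bsub>F n\<^esub> x = \<zero>\<^bsub>F n\<^esub>" using M.smult_l_null[OF x] by simp
      have "g (monom j \<odot>\<^bsub>F n\<^esub> x) k = g0 (cnv c (monom (N - 1 - k)) (monom j) \<odot>\<^bsub>F n\<^esub> x)"
        using k x by (simp add: gk F_smult_smult)
      also have "\<dots> = (if j \<le> k \<and> c j (N - 1 - k) then g0 (monom (N - 1 - k + j) \<odot>\<^bsub>F n\<^esub> x) else \<zero>)"
        unfolding conv_monom_monom[OF k' j] using k j by (auto simp: null g00 compat_commute[of j])
      also have "\<dots> = cnv (\<lambda>i j. c i (N - 1 - i - j)) (monom j) (g x) k"
        unfolding conv_monom_coeff[OF gV[OF x] k j] using k j
        by (auto simp: gk intro!: arg_cong[of _ _ g0] arg_cong2[of _ _ _ _ "smult (F n)"] arg_cong[of _ _ monom])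
      finally show "g (monom j \<odot>\<^bsub>F n\<^esub> x) k = cnv (\<lambda>i j. c i (N - 1 - i - j)) (monom j) (g x) k" .
    qed (simp_all add: gV x sc)
  qed
  then have "restrict g (carrier (F n)) \<in> carrier (Hom_module A (F n) \<Omega>)"
    using restrict_hom[OF _ module_F] by (simp add: Hom_module_def)
  then show ?thesis unfolding g_def .
qed

text \<open>
  Evaluation at \<open>1\<close>, which is position \<open>N - 1\<close>, turns a cocycle \<open>f\<close> into a functional that factors
  through the image of \<open>d i\<close>.  Extending the factor to the whole free module and lifting it back gives
  the required preimage of \<open>f\<close>.
\<close>

lemma dual_cocycle_is_coboundary:
  assumes res: "free_resolution A \<kk> b e d"
  shows "Ext_cocycles A b d (Suc i) \<Omega> = Ext_coboundaries A b d (Suc i) \<Omega>"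
proof
  have d: "d i \<in> module_hom A (F (b (Suc i))) (F (b i))" for i
    using res by (simp add: free_resolution_def)
  let ?F = "F (b i)" and ?G = "F (b (Suc i))"
  have exact: "d (Suc i) ` carrier (F (b (Suc (Suc i)))) = {x \<in> carrier ?G. d i x = \<zero>\<^bsub>?F\<^esub>}"
    using res by (simp add: free_resolution_def)
  interpret G: Module.module A ?G by (rule module_F)
  interpret d: mod_hom A ?G ?F "d i"
    using d module_F by (simp add: mod_hom_def mod_hom_axioms_def)
  show "Ext_coboundaries A b d (Suc i) \<Omega> \<subseteq> Ext_cocycles A b d (Suc i) \<Omega>"
  proof
    fix f assume "f \<in> Ext_coboundaries A b d (Suc i) \<Omega>"
    then obtain g where f: "f = compose (carrier ?G) g (d i)"
      and g: "g \<in> carrier (Hom_module A ?F \<Omega>)" by auto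
    interpret g: mod_hom A ?F \<Omega> g
      using g module_F module_\<Omega> by (simp add: mod_hom_def mod_hom_axioms_def Hom_module_def)
    have "(\<lambda>x. g (d i x)) \<in> module_hom A ?G \<Omega>" by (rule hom_compose[OF d g.f_hom])
    then have "f \<in> module_hom A ?G \<Omega>"
      unfolding f compose_def by (rule restrict_hom[OF _ module_F])
    moreover have "f (d (Suc i) x) = \<zero>\<^bsub>\<Omega>\<^esub>" if "x \<in> carrier (F (b (Suc (Suc i))))" for x
    proof -
      have "d (Suc i) x \<in> {x \<in> carrier ?G. d i x = \<zero>\<^bsub>?F\<^esub>}" using exact that by blast
      then show ?thesis using g.f0_is_0 by (simp add: f compose_def)
    qed
    ultimately show "f \<in> Ext_cocycles A b d (Suc i) \<Omega>"
      by (simp add: Ext_cocycles_def Hom_module_def f compose_extensional)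
  qed
  show "Ext_cocycles A b d (Suc i) \<Omega> \<subseteq> Ext_coboundaries A b d (Suc i) \<Omega>"
  proof
    fix f assume f: "f \<in> Ext_cocycles A b d (Suc i) \<Omega>"
    then have fh: "f \<in> module_hom A ?G \<Omega>" and fe: "f \<in> extensional (carrier ?G)"
      and f0: "\<And>x. x \<in> carrier (F (b (Suc (Suc i)))) \<Longrightarrow> f (d (Suc i) x) = \<zero>\<^bsub>V\<^esub>"
      by (simp_all add: Ext_cocycles_def Hom_module_def)
    interpret f: mod_hom A ?G \<Omega> f
      using fh module_F module_\<Omega> by (simp add: mod_hom_def mod_hom_axioms_def)
    have fV: "f y \<in> carrier V" if "y \<in> carrier ?G" for y using f.f_im[OF that] by simp
    have well: "f y = f y'" if y: "y \<in> carrier ?G" "y' \<in> carrier ?G" and eq: "d i y = d i y'" for y y'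
    proof -
      have "d i (y \<ominus>\<^bsub>?G\<^esub> y') = \<zero>\<^bsub>?F\<^esub>"
        using y eq d.f_minus d.f_im d.N.M.minus_other_side by metis
      then have "y \<ominus>\<^bsub>?G\<^esub> y' \<in> d (Suc i) ` carrier (F (b (Suc (Suc i))))"
        unfolding exact using y G.M.minus_closed by blast
      then have "f (y \<ominus>\<^bsub>?G\<^esub> y') = \<zero>\<^bsub>\<Omega>\<^esub>" using f0 by auto
      then show ?thesis using y f.f_minus f.f_im \<Omega>.M.minus_other_side by metis
    qed
    let ?S = "d i ` carrier ?G"
    define h where "h s = f (inv_into (carrier ?G) (d i) s) (N - 1)" for s
    have h: "h (d i y) = f y (N - 1)" if y: "y \<in> carrier ?G" for y
    proof -
      have "f (inv_into (carrier ?G) (d i) (d i y)) = f y"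
        by (rule well[OF inv_into_into[OF imageI[OF y]] y f_inv_into_f[OF imageI[OF y]]])
      then show ?thesis by (simp add: h_def)
    qed
    interpret C: coordinate_space K "scalars ?F" "b i * N" "\<lambda>m x. x (m div N) (m mod N)"
      by (rule coordinates_F)
    have sc: "carrier (scalars ?F) = carrier ?F" "add (scalars ?F) = add ?F"
      "a \<odot>\<^bsub>scalars ?F\<^esub> x = structure_map A a \<odot>\<^bsub>?F\<^esub> x" for a x
      by (simp_all add: restrict_scalars_def)
    have N1: "N - 1 < N" using N_pos by simp
    have "submodule A ?S ?F" using d.im_is_submodule by (simp add: d.im_def)
    then have sub: "submodule K ?S (scalars ?F)" by (rule submodule_scalars[OF module_F])
    have h1: "h s \<in> carrier K" if "s \<in> ?S" for s using that h fV N1 by auto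
    have h2: "h (s \<oplus>\<^bsub>scalars ?F\<^esub> t) = h s \<oplus> h t" if st: "s \<in> ?S" "t \<in> ?S" for s t
    proof -
      obtain x y where xy: "x \<in> carrier ?G" "s = d i x" "y \<in> carrier ?G" "t = d i y"
        using st by blast
      have "s \<oplus>\<^bsub>?F\<^esub> t = d i (x \<oplus>\<^bsub>?G\<^esub> y)"
        unfolding xy(2,4) by (rule d.f_add[OF xy(1,3), symmetric])
      then have "h (s \<oplus>\<^bsub>?F\<^esub> t) = f (x \<oplus>\<^bsub>?G\<^esub> y) (N - 1)"
        by (simp only: h[OF G.M.a_closed[OF xy(1,3)]])
      also have "\<dots> = h s \<oplus> h t"
        by (simp only: f.f_add[OF xy(1,3)] \<Omega>_simps V_add[OF N1] xy(2,4) h[OF xy(1)] h[OF xy(3)])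
      finally show ?thesis by (simp only: sc)
    qed
    have h3: "h (a \<odot>\<^bsub>scalars ?F\<^esub> s) = a \<otimes> h s" if a: "a \<in> carrier K" and s: "s \<in> ?S" for a s
    proof -
      obtain x where x: "x \<in> carrier ?G" "s = d i x" using s by blast
      have aA: "structure_map A a \<in> carrier A" using structure_map_closed[OF a] by simp
      have "structure_map A a \<odot>\<^bsub>?F\<^esub> s = d i (structure_map A a \<odot>\<^bsub>?G\<^esub> x)"
        unfolding x(2) by (rule d.f_smult[OF aA x(1), symmetric])
      then have "h (structure_map A a \<odot>\<^bsub>?F\<^esub> s) = f (structure_map A a \<odot>\<^bsub>?G\<^esub> x) (N - 1)"
        by (simp only: h[OF G.smult_closed[OF aA x(1)]])
      also have "f (structure_map A a \<odot>\<^bsub>?G\<^esub> x) = a \<odot>\<^bsub>V\<^esub> f x"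
        unfolding f.f_smult[OF aA x(1)] \<Omega>_simps
        by (rule structure_map_mult[OF a fV[OF x(1)]]) (simp add: compat_zero)
      also have "(a \<odot>\<^bsub>V\<^esub> f x) (N - 1) = a \<otimes> h s"
        by (simp only: V_smult[OF N1] x(2) h[OF x(1)])
      finally show ?thesis by (simp only: sc)
    qed
    obtain g0 where g0: "\<And>v. v \<in> carrier ?F \<Longrightarrow> g0 v \<in> carrier K"
      "\<And>v w. \<lbrakk>v \<in> carrier ?F; w \<in> carrier ?F\<rbrakk> \<Longrightarrow> g0 (v \<oplus>\<^bsub>?F\<^esub> w) = g0 v \<oplus> g0 w"
      "\<And>a v. \<lbrakk>a \<in> carrier K; v \<in> carrier ?F\<rbrakk> \<Longrightarrow> g0 (structure_map A a \<odot>\<^bsub>?F\<^esub> v) = a \<otimes> g0 v"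
      "\<And>s. s \<in> ?S \<Longrightarrow> g0 s = h s"
      using C.extend_functional[OF sub h1 h2 h3, unfolded sc] by blast
    define g where "g = (\<lambda>x\<in>carrier ?F. \<lambda>k\<in>{..<N}. g0 (monom (N - 1 - k) \<odot>\<^bsub>?F\<^esub> x))"
    have gH: "g \<in> carrier (Hom_module A ?F \<Omega>)"
      unfolding g_def by (rule lift_functional[OF g0(1,2,3)])
    have "f = compose (carrier ?G) g (d i)"
    proof (rule extensionalityI[OF fe compose_extensional])
      fix y assume y: "y \<in> carrier ?G"
      have "f y = g (d i y)"
      proof (rule V_eqI)
        have "g \<in> carrier ?F \<rightarrow> carrier \<Omega>" using gH hom_closed[of g A ?F \<Omega>] by (simp add: Hom_module_def)
        then show "g (d i y) \<in> carrier V" using d.f_im[OF y] by auto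
        show "f y \<in> carrier V" by (rule fV[OF y])
        fix k assume k: "k < N"
        let ?t = "monom (N - 1 - k)"
        have tA: "?t \<in> carrier A" by simp
        have ty: "?t \<odot>\<^bsub>?G\<^esub> y \<in> carrier ?G" by (rule G.smult_closed[OF tA y])
        have "g (d i y) k = g0 (?t \<odot>\<^bsub>?F\<^esub> d i y)" using k d.f_im[OF y] by (simp add: g_def)
        also have "?t \<odot>\<^bsub>?F\<^esub> d i y = d i (?t \<odot>\<^bsub>?G\<^esub> y)" by (rule d.f_smult[OF tA y, symmetric])
        also have "g0 \<dots> = f (?t \<odot>\<^bsub>?G\<^esub> y) (N - 1)" using g0(4)[OF imageI[OF ty]] h[OF ty] by simp
        also have "f (?t \<odot>\<^bsub>?G\<^esub> y) = ?t \<odot>\<^bsub>\<Omega>\<^esub> f y" by (rule f.f_smult[OF tA y])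
        also have "(?t \<odot>\<^bsub>\<Omega>\<^esub> f y) (N - 1) = f y k"
        proof -
          have "N - 1 - k \<le> N - 1" by simp
          then show ?thesis
            using k fV[OF y] compat_zero[of "N - 1 - k"] compat_commute[of "N - 1 - k" 0]
            by (simp add: conv_monom_coeff)
        qed
        finally show "f y k = g (d i y) k" by simp
      qed
      then show "f y = compose (carrier ?G) g (d i) y" using y by (simp add: compose_def)
    qed
    then show "f \<in> Ext_coboundaries A b d (Suc i) \<Omega>" using gH by auto
  qed
qed

lemma Ext_\<Omega>_vanishes: "carrier (Ext A (Suc i) \<kk> \<Omega>) = {\<zero>\<^bsub>Ext A (Suc i) \<kk> \<Omega>\<^esub>}"
proof -
  obtain b e d where res: "free_resolution A \<kk> b e d" and E: "Ext A (Suc i) \<kk> \<Omega> = Ext_of_resolution A b d (Suc i) \<Omega>"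
    using Ext_by_resolution by blast
  let ?H = "Hom_module A (F (b (Suc i))) \<Omega>" and ?Z = "Ext_cocycles A b d (Suc i) \<Omega>"
  have d: "d (Suc i) \<in> module_hom A (F (b (Suc (Suc i)))) (F (b (Suc i)))"
    using res by (simp add: free_resolution_def)
  interpret H: Module.module A ?H by (rule Hom_is_module[OF module_F module_\<Omega>])
  have Z: "Module.module A (?H\<lparr>carrier := ?Z\<rparr>)"
    by (rule H.submodule_is_module[OF cocycles_submodule[where d = d and b = b and i = "Suc i", OF module_\<Omega> d]])
  interpret Z: Module.module A "?H\<lparr>carrier := ?Z\<rparr>" by (rule Z)
  have sub: "submodule A ?Z (?H\<lparr>carrier := ?Z\<rparr>)"
    by (rule submodule.intro[OF Z])
      (use Z.M.a_closed Z.M.zero_closed Z.smult_closed in simp_all)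
  let ?q = "\<lambda>x. ?Z +>\<^bsub>?H\<lparr>carrier := ?Z\<rparr>\<^esub> x"
  have Q: "Ext A (Suc i) \<kk> \<Omega> = quotient_module (?H\<lparr>carrier := ?Z\<rparr>) ?Z"
    unfolding E Ext_of_resolution_def dual_cocycle_is_coboundary[OF res, symmetric] ..
  have const: "?q x = ?q \<zero>\<^bsub>?H\<lparr>carrier := ?Z\<rparr>\<^esub>" if "x \<in> carrier (?H\<lparr>carrier := ?Z\<rparr>)" for x
    using quotient_map_eq_iff[OF Z sub that Z.M.zero_closed] Z.M.minus_closed[OF that Z.M.zero_closed] by simp
  have "carrier (quotient_module (?H\<lparr>carrier := ?Z\<rparr>) ?Z) = {?q \<zero>\<^bsub>?H\<lparr>carrier := ?Z\<rparr>\<^esub>}"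
    unfolding quotient_map_onto[OF Z sub, symmetric] using const Z.M.zero_closed by blast
  then show ?thesis unfolding Q quotient_map_zero[OF Z sub] .
qed

section \<open>Ext in degree zero and the socle\<close>

definition socle :: "(nat \<Rightarrow> 'a, 'x, 'y) module_scheme \<Rightarrow> 'x set" where
  "socle M = {s \<in> carrier M. \<forall>r\<in>\<mm>. r \<odot>\<^bsub>M\<^esub> s = \<zero>\<^bsub>M\<^esub>}"

text \<open>
  The difference of \<open>r\<close> and its constant coefficient lies in \<open>\<mm>\<close> and kills \<open>s\<close>.
\<close>

lemma socle_smult:
  assumes M: "Module.module A M" and r: "r \<in> carrier V" and s: "s \<in> socle M"
  shows "r \<odot>\<^bsub>M\<^esub> s = structure_map A (r 0) \<odot>\<^bsub>M\<^esub> s"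
proof -
  interpret M: Module.module A M by fact
  have r0: "r 0 \<in> carrier K" using r N_pos by simp
  define t where "t = (\<lambda>k\<in>{..<N}. if k = 0 then \<zero> else r k)"
  have t: "t \<in> \<mm>" using r N_pos unfolding \<mm>_def t_def by (auto intro!: V_memI)
  then have tV: "t \<in> carrier V" by (simp add: \<mm>_def)
  have "r = structure_map A (r 0) \<oplus>\<^bsub>V\<^esub> t"
    by (rule V_eqI) (use r r0 tV in \<open>simp_all add: structure_map_A t_def\<close>)
  then have "r \<odot>\<^bsub>M\<^esub> s = structure_map A (r 0) \<odot>\<^bsub>M\<^esub> s \<oplus>\<^bsub>M\<^esub> t \<odot>\<^bsub>M\<^esub> s"
    using A_module_laws(2)[OF M structure_map_closed[OF r0] tV, of s] s by (simp add: socle_def)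
  then show ?thesis
    using s t A_module_laws(1)[OF M structure_map_closed[OF r0], of s] by (simp add: socle_def)
qed

lemma socle_submodule:
  assumes M: "Module.module A M" shows "submodule A (socle M) M"
proof -
  interpret M: Module.module A M by fact
  have mV: "r \<in> carrier V" if "r \<in> \<mm>" for r using that by (simp add: \<mm>_def)
  show ?thesis
  proof (rule submodule.intro[OF M])
    show "socle M \<subseteq> carrier M" by (auto simp: socle_def)
    show "\<zero>\<^bsub>M\<^esub> \<in> socle M" by (simp add: socle_def A_module_laws(7)[OF M] mV)
    show "s \<oplus>\<^bsub>M\<^esub> t \<in> socle M" if "s \<in> socle M" "t \<in> socle M" for s t
      using that by (simp add: socle_def A_module_laws(4)[OF M] mV)
    fix r s assume r: "r \<in> carrier A" and s: "s \<in> socle M"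
    have rs: "r \<odot>\<^bsub>M\<^esub> s \<in> carrier M" using r s by (simp add: socle_def A_module_laws(1)[OF M])
    have "t \<odot>\<^bsub>M\<^esub> (r \<odot>\<^bsub>M\<^esub> s) = \<zero>\<^bsub>M\<^esub>" if t: "t \<in> \<mm>" for t
    proof -
      have "t \<odot>\<^bsub>M\<^esub> (r \<odot>\<^bsub>M\<^esub> s) = cnv c t r \<odot>\<^bsub>M\<^esub> s"
        using r s mV[OF t] by (simp add: socle_def A_module_laws(3)[OF M])
      also have "cnv c t r = cnv c r t" using A.m_comm[of t r] r mV[OF t] by simp
      also have "cnv c r t \<odot>\<^bsub>M\<^esub> s = r \<odot>\<^bsub>M\<^esub> (t \<odot>\<^bsub>M\<^esub> s)"
        using r s mV[OF t] by (simp add: socle_def A_module_laws(3)[OF M])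
      finally show ?thesis using s t r by (simp add: socle_def A_module_laws(7)[OF M])
    qed
    then show "r \<odot>\<^bsub>M\<^esub> s \<in> socle M" using rs by (simp add: socle_def)
  qed
qed

text \<open>
  A cocycle is a homomorphism on the first free module that vanishes on the kernel of \<open>e\<close>, hence a
  homomorphism from the residue field.  It is determined by the image of \<open>1\<close>, which is an arbitrary
  element killed by \<open>\<mm>\<close>.
\<close>

lemma Ext_0_socle:
  assumes M: "Module.module A M"
  obtains \<pi> where "\<pi> \<in> module_hom A (M\<lparr>carrier := socle M\<rparr>) (Ext A 0 \<kk> M)"
    "bij_betw \<pi> (socle M) (carrier (Ext A 0 \<kk> M))" "\<pi> \<zero>\<^bsub>M\<^esub> = \<zero>\<^bsub>Ext A 0 \<kk> M\<^esub>"
proof -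
  obtain b e d where res: "free_resolution A \<kk> b e d" and E: "Ext A 0 \<kk> M = Ext_of_resolution A b d 0 M"
    using Ext_by_resolution by blast
  interpret M: Module.module A M by fact
  let ?F = "F (b 0)"
  let ?H = "Hom_module A ?F M" and ?Z = "Ext_cocycles A b d 0 M"
  let ?HZ = "?H\<lparr>carrier := ?Z\<rparr>"
  have d: "d 0 \<in> module_hom A (F (b (Suc 0))) ?F" and e: "e \<in> module_hom A ?F \<kk>"
    and e_onto: "e ` carrier ?F = carrier \<kk>"
    and exact: "d 0 ` carrier (F (b (Suc 0))) = {x \<in> carrier ?F. e x = \<zero>\<^bsub>\<kk>\<^esub>}"
    using res by (simp_all add: free_resolution_def)
  interpret G: Module.module A ?F by (rule module_F)
  interpret e: mod_hom A ?F \<kk> e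
    using e module_F module_k by (simp add: mod_hom_def mod_hom_axioms_def)
  have dc: "d 0 y \<in> carrier ?F" "e (d 0 y) = \<zero>\<^bsub>\<kk>\<^esub>" if "y \<in> carrier (F (b (Suc 0)))" for y
    using exact that by blast+
  interpret H: Module.module A ?H by (rule Hom_is_module[OF module_F M])
  have Z: "Module.module A ?HZ"
    by (rule H.submodule_is_module[OF cocycles_submodule[where d = d and b = b and i = 0, OF M d]])
  interpret Z: Module.module A ?HZ by (rule Z)
  \<comment> \<open>the augmentation as a map to \<open>\<bbbK>\<close>: the constant coefficient of a representative of \<open>e x\<close>\<close>
  define \<epsilon> where "\<epsilon> x = (SOME f. f \<in> carrier V \<and> e x = q f) 0" for x
  have eps: "\<epsilon> x = f 0" if x: "e x = q f" and f: "f \<in> carrier V" for x f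
  proof -
    let ?g = "SOME g. g \<in> carrier V \<and> e x = q g"
    have g: "?g \<in> carrier V \<and> e x = q ?g" by (rule someI[of _ f]) (use x f in simp)
    then have "q ?g = q f" using x by simp
    then show ?thesis using q_eq_iff[of ?g f] g f by (simp add: \<epsilon>_def)
  qed
  have rep: "\<exists>f\<in>carrier V. e x = q f" if "x \<in> carrier ?F" for x
    using e.f_im[OF that] unfolding q_laws(1)[symmetric] by blast
  have epsK: "\<epsilon> x \<in> carrier K" if "x \<in> carrier ?F" for x
    using rep[OF that] eps N_pos by auto
  have eps_add: "\<epsilon> (x \<oplus>\<^bsub>?F\<^esub> y) = \<epsilon> x \<oplus> \<epsilon> y" if x: "x \<in> carrier ?F" and y: "y \<in> carrier ?F" for x y
  proof -
    obtain f g where fg: "f \<in> carrier V" "e x = q f" "g \<in> carrier V" "e y = q g" using rep[OF x] rep[OF y] by blast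
    have "e (x \<oplus>\<^bsub>?F\<^esub> y) = q (f \<oplus>\<^bsub>V\<^esub> g)" using x y fg by (simp add: q_laws(3))
    then have "\<epsilon> (x \<oplus>\<^bsub>?F\<^esub> y) = (f \<oplus>\<^bsub>V\<^esub> g) 0" by (rule eps) (use fg in simp)
    then show ?thesis using eps[OF fg(2,1)] eps[OF fg(4,3)] N_pos by simp
  qed
  have eps_smult: "\<epsilon> (r \<odot>\<^bsub>?F\<^esub> x) = r 0 \<otimes> \<epsilon> x" if r: "r \<in> carrier V" and x: "x \<in> carrier ?F" for r x
  proof -
    obtain f where f: "f \<in> carrier V" "e x = q f" using rep[OF x] by blast
    have "e (r \<odot>\<^bsub>?F\<^esub> x) = q (cnv c r f)" using x f r e.f_smult[of r x] by (simp add: q_laws(4))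
    then have "\<epsilon> (r \<odot>\<^bsub>?F\<^esub> x) = cnv c r f 0" by (rule eps) (use f r in simp)
    then show ?thesis using eps[OF f(2,1)] f r by (simp add: conv_at_zero compat_zero N_pos)
  qed
  have eps_0: "\<epsilon> x = \<zero>" if "e x = \<zero>\<^bsub>\<kk>\<^esub>" for x
    using eps[of x "\<zero>\<^bsub>V\<^esub>"] that N_pos by (simp add: q_laws(2))
  have "q (monom 0) \<in> e ` carrier ?F" unfolding e_onto q_laws(1)[symmetric] by simp
  then obtain x0 where x0': "q (monom 0) = e x0" "x0 \<in> carrier ?F" by (rule imageE)
  note x0 = x0'(2) x0'(1)[symmetric]
  have eps_x0: "\<epsilon> x0 = \<one>" using eps[OF x0(2)] N_pos by simp
  have sM: "s \<in> carrier M" if "s \<in> socle M" for s using that by (simp add: socle_def)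
  define \<theta> where "\<theta> s = (\<lambda>x\<in>carrier ?F. structure_map A (\<epsilon> x) \<odot>\<^bsub>M\<^esub> s)" for s
  have \<theta>_hom: "\<theta> s \<in> carrier ?H" if s: "s \<in> socle M" for s
  proof -
    have "(\<lambda>x. structure_map A (\<epsilon> x) \<odot>\<^bsub>M\<^esub> s) \<in> module_hom A ?F M"
    proof -
      have "structure_map A (\<epsilon> (r \<odot>\<^bsub>?F\<^esub> x)) \<odot>\<^bsub>M\<^esub> s = r \<odot>\<^bsub>M\<^esub> (structure_map A (\<epsilon> x) \<odot>\<^bsub>M\<^esub> s)"
        if r: "r \<in> carrier V" and x: "x \<in> carrier ?F" for r x
      proof -
        have r0: "r 0 \<in> carrier K" using r N_pos by simp
        have "structure_map A (\<epsilon> x) \<odot>\<^bsub>M\<^esub> s \<in> socle M"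
          using submodule.smult_closed[OF socle_submodule[OF M] _ s, of "structure_map A (\<epsilon> x)"]
            structure_map_closed[OF epsK[OF x]] by simp
        then have "r \<odot>\<^bsub>M\<^esub> (structure_map A (\<epsilon> x) \<odot>\<^bsub>M\<^esub> s) =
            structure_map A (r 0) \<odot>\<^bsub>M\<^esub> (structure_map A (\<epsilon> x) \<odot>\<^bsub>M\<^esub> s)"
          by (rule socle_smult[OF M r])
        then show ?thesis
          using epsK[OF x] r0 sM[OF s]
          by (simp add: eps_smult[OF r x] structure_map_times A_module_laws(3)[OF M] structure_map_closed)
      qed
      then show ?thesis
        using sM[OF s] epsK
        by (simp add: hom_def Pi_iff structure_map_closed structure_map_add eps_add
            A_module_laws(1,2)[OF M])
    qed
    then show ?thesis unfolding \<theta>_def using restrict_hom[OF _ module_F] by (simp add: Hom_module_def)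
  qed
  have \<theta>_Z: "\<theta> s \<in> ?Z" if s: "s \<in> socle M" for s
    using \<theta>_hom[OF s] dc sM[OF s]
    by (simp add: Ext_cocycles_def) (simp add: \<theta>_def eps_0 structure_map_zero A_module_laws(5)[OF M])
  have \<theta>_x0: "\<theta> s x0 = s" if s: "s \<in> socle M" for s
    using x0 sM[OF s] by (simp add: \<theta>_def eps_x0 structure_map_A A_module_laws(6)[OF M])
  have \<theta>_add: "\<theta> (s \<oplus>\<^bsub>M\<^esub> t) = \<theta> s \<oplus>\<^bsub>?H\<^esub> \<theta> t" if "s \<in> socle M" "t \<in> socle M" for s t
    using sM[OF that(1)] sM[OF that(2)] epsK
    by (auto simp: \<theta>_def Hom_module_def A_module_laws(4)[OF M] structure_map_closed intro!: restrict_ext)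
  have \<theta>_smult: "\<theta> (r \<odot>\<^bsub>M\<^esub> s) = r \<odot>\<^bsub>?H\<^esub> \<theta> s" if r: "r \<in> carrier V" and s: "s \<in> socle M" for r s
  proof -
    have "structure_map A (\<epsilon> x) \<odot>\<^bsub>M\<^esub> (r \<odot>\<^bsub>M\<^esub> s) = r \<odot>\<^bsub>M\<^esub> (structure_map A (\<epsilon> x) \<odot>\<^bsub>M\<^esub> s)"
      if x: "x \<in> carrier ?F" for x
      using r sM[OF s] structure_map_closed[OF epsK[OF x]] A.m_comm[of r "structure_map A (\<epsilon> x)"]
      by (simp flip: A_module_laws(3)[OF M])
    then show ?thesis by (auto simp: \<theta>_def Hom_module_def intro!: restrict_ext)
  qed
  have \<theta>_onto: "f = \<theta> (f x0) \<and> f x0 \<in> socle M" if f: "f \<in> ?Z" for f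
  proof -
    have fh: "f \<in> module_hom A ?F M" and fe: "f \<in> extensional (carrier ?F)"
      and f0: "\<And>y. y \<in> carrier (F (b (Suc 0))) \<Longrightarrow> f (d 0 y) = \<zero>\<^bsub>M\<^esub>"
      using f by (simp_all add: Ext_cocycles_def Hom_module_def)
    interpret f: mod_hom A ?F M f
      using fh module_F M by (simp add: mod_hom_def mod_hom_axioms_def)
    have ker: "f x = \<zero>\<^bsub>M\<^esub>" if "x \<in> carrier ?F" "e x = \<zero>\<^bsub>\<kk>\<^esub>" for x
    proof -
      have "x \<in> d 0 ` carrier (F (b (Suc 0)))" unfolding exact using that by simp
      then show ?thesis using f0 by blast
    qed
    have same: "f x = f y" if xy: "x \<in> carrier ?F" "y \<in> carrier ?F" and eq: "e x = e y" for x y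
    proof -
      have "e (x \<ominus>\<^bsub>?F\<^esub> y) = \<zero>\<^bsub>\<kk>\<^esub>"
        using xy eq e.f_minus e.f_im e.N.M.minus_other_side by metis
      then have "f (x \<ominus>\<^bsub>?F\<^esub> y) = \<zero>\<^bsub>M\<^esub>" using xy by (intro ker G.M.minus_closed)
      then show ?thesis using xy f.f_minus f.f_im M.M.minus_other_side by metis
    qed
    have "r \<odot>\<^bsub>M\<^esub> f x0 = \<zero>\<^bsub>M\<^esub>" if r: "r \<in> \<mm>" for r
    proof -
      have rV: "r \<in> carrier V" and r0: "r 0 = \<zero>" using r by (simp_all add: \<mm>_def)
      have "e (r \<odot>\<^bsub>?F\<^esub> x0) = r \<odot>\<^bsub>\<kk>\<^esub> q (monom 0)" using x0 rV e.f_smult[of r x0] by simp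
      also have "\<dots> = q (cnv c r (monom 0))" using rV by (simp add: q_laws(4))
      also have "\<dots> = q \<zero>\<^bsub>V\<^esub>"
        using rV r0 N_pos by (subst q_eq_iff) (simp_all add: conv_at_zero compat_zero)
      finally have "f (r \<odot>\<^bsub>?F\<^esub> x0) = \<zero>\<^bsub>M\<^esub>"
        using x0 rV by (intro ker) (simp_all add: q_laws(2) A_module_laws(1)[OF module_F])
      then show ?thesis using f.f_smult[of r x0] x0 rV by simp
    qed
    then have soc: "f x0 \<in> socle M" using f.f_im[OF x0(1)] by (simp add: socle_def)
    moreover have "f = \<theta> (f x0)"
    proof (rule extensionalityI[OF fe])
      show "\<theta> (f x0) \<in> extensional (carrier ?F)" by (simp add: \<theta>_def)
      fix x assume x: "x \<in> carrier ?F"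
      obtain g where g: "g \<in> carrier V" "e x = q g" using rep[OF x] by blast
      have sx: "structure_map A (\<epsilon> x) \<in> carrier V" by (rule structure_map_closed[OF epsK[OF x]])
      have "e (structure_map A (\<epsilon> x) \<odot>\<^bsub>?F\<^esub> x0) = structure_map A (\<epsilon> x) \<odot>\<^bsub>\<kk>\<^esub> q (monom 0)"
        using x0 sx e.f_smult[of "structure_map A (\<epsilon> x)" x0] by simp
      also have "\<dots> = q (cnv c (structure_map A (\<epsilon> x)) (monom 0))" using sx by (simp add: q_laws(4))
      also have "\<dots> = q g"
        using sx g epsK[OF x] N_pos eps[OF g(2,1)]
        by (subst q_eq_iff) (simp_all add: conv_at_zero compat_zero structure_map_coeff0)
      finally have "e x = e (structure_map A (\<epsilon> x) \<odot>\<^bsub>?F\<^esub> x0)" using g by simp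
      then have "f x = f (structure_map A (\<epsilon> x) \<odot>\<^bsub>?F\<^esub> x0)"
        using x x0 sx by (intro same) (simp_all add: A_module_laws(1)[OF module_F])
      also have "\<dots> = structure_map A (\<epsilon> x) \<odot>\<^bsub>M\<^esub> f x0"
        using f.f_smult[of "structure_map A (\<epsilon> x)" x0] x0 sx by simp
      finally show "f x = \<theta> (f x0) x" using x by (simp add: \<theta>_def)
    qed
    ultimately show ?thesis by simp
  qed
  have Q: "Ext A 0 \<kk> M = quotient_module ?HZ {\<zero>\<^bsub>?HZ\<^esub>}"
    unfolding E Ext_of_resolution_def by simp
  have sub0: "submodule A {\<zero>\<^bsub>?HZ\<^esub>} ?HZ"
    by (rule submodule.intro[OF Z]) (use Z.M.zero_closed Z.smult_r_null in simp_all)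
  define p where "p f = {\<zero>\<^bsub>?HZ\<^esub>} +>\<^bsub>?HZ\<^esub> f" for f
  have p: "p ` ?Z = carrier (Ext A 0 \<kk> M)"
    using quotient_map_onto[OF Z sub0] unfolding p_def Q by simp
  have p_inj: "f = g" if "f \<in> ?Z" "g \<in> ?Z" "p f = p g" for f g
    using quotient_map_eq_iff[OF Z sub0, of f g] that Z.M.minus_other_side[of f g] by (simp add: p_def)
  have p_add: "p (f \<oplus>\<^bsub>?H\<^esub> g) = p f \<oplus>\<^bsub>Ext A 0 \<kk> M\<^esub> p g" if "f \<in> ?Z" "g \<in> ?Z" for f g
    using quotient_map_add[OF Z sub0, of f g] that unfolding p_def Q by simp
  have p_smult: "p (r \<odot>\<^bsub>?H\<^esub> f) = r \<odot>\<^bsub>Ext A 0 \<kk> M\<^esub> p f" if "r \<in> carrier V" "f \<in> ?Z" for r f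
    using quotient_map_smult[OF Z sub0, of r f] that unfolding p_def Q by simp
  show thesis
  proof (rule that[of "\<lambda>s. p (\<theta> s)"])
    show "(\<lambda>s. p (\<theta> s)) \<in> module_hom A (M\<lparr>carrier := socle M\<rparr>) (Ext A 0 \<kk> M)"
      using p \<theta>_Z by (auto simp: hom_def \<theta>_add \<theta>_smult p_add p_smult)
    show "bij_betw (\<lambda>s. p (\<theta> s)) (socle M) (carrier (Ext A 0 \<kk> M))"
    proof (rule bij_betwI')
      fix s t assume s: "s \<in> socle M" and t: "t \<in> socle M"
      show "p (\<theta> s) = p (\<theta> t) \<longleftrightarrow> s = t"
        using p_inj[OF \<theta>_Z[OF s] \<theta>_Z[OF t]] \<theta>_x0[OF s] \<theta>_x0[OF t] by metis
    next
      show "p (\<theta> s) \<in> carrier (Ext A 0 \<kk> M)" if "s \<in> socle M" for s using p \<theta>_Z[OF that] by blast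
      fix y assume "y \<in> carrier (Ext A 0 \<kk> M)"
      then obtain f where f: "f \<in> ?Z" "y = p f" unfolding p[symmetric] by blast
      show "\<exists>s\<in>socle M. y = p (\<theta> s)"
        using \<theta>_onto[OF f(1)] f(2) by (intro bexI[of _ "f x0"]) simp_all
    qed
    have "\<theta> \<zero>\<^bsub>M\<^esub> = \<zero>\<^bsub>?HZ\<^esub>"
      using epsK by (auto simp: \<theta>_def Hom_module_def A_module_laws(7)[OF M] structure_map_closed intro!: restrict_ext)
    then show "p (\<theta> \<zero>\<^bsub>M\<^esub>) = \<zero>\<^bsub>Ext A 0 \<kk> M\<^esub>"
      using quotient_map_zero[OF Z sub0] unfolding p_def Q by simp
  qed
qed

section \<open>Canonical module, type and colength\<close>

text \<open>
  A functional is killed by \<open>\<mm>\<close> iff it vanishes on \<open>\<mm>\<close>, that is, at all \<open>t\<^sup>n\<close> with \<open>n > 0\<close>.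
\<close>

lemma socle_\<Omega>: "socle \<Omega> = {s \<in> carrier V. \<forall>k<N - 1. s k = \<zero>}"
proof (intro equalityI subsetI)
  fix s assume s: "s \<in> socle \<Omega>"
  have sV: "s \<in> carrier V" using s by (simp add: socle_def)
  have "s k = \<zero>" if k: "k < N - 1" for k
  proof -
    have m: "monom (N - 1 - k) \<in> \<mm>" using k by (simp add: \<mm>_def)
    have N1: "N - 1 < N" "N - 1 - k < N" using N_pos by simp_all
    have "cnv (\<lambda>i j. c i (N - 1 - i - j)) (monom (N - 1 - k)) s (N - 1) = \<zero>\<^bsub>V\<^esub> (N - 1)"
      using s m by (simp add: socle_def)
    moreover have eqs: "N - 1 - (N - 1 - k) = k" "N - 1 - (N - 1 - k) - k = 0" using k by simp_all
    moreover have "c (N - 1 - k) 0" using compat_zero[OF N1(2)] compat_commute[of "N - 1 - k" 0] by simp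
    moreover have "N - 1 - k \<le> N - 1" by simp
    ultimately show ?thesis using N1 unfolding conv_monom_coeff[OF sV N1] eqs by simp
  qed
  then show "s \<in> {s \<in> carrier V. \<forall>k<N - 1. s k = \<zero>}" using sV by simp
next
  fix s assume "s \<in> {s \<in> carrier V. \<forall>k<N - 1. s k = \<zero>}"
  then have sV: "s \<in> carrier V" and s0: "\<And>k. k < N - 1 \<Longrightarrow> s k = \<zero>" by auto
  have "cnv w r s = \<zero>\<^bsub>V\<^esub>" if r: "r \<in> \<mm>" for r w
  proof (rule V_eqI)
    have rV: "r \<in> carrier V" "r 0 = \<zero>" using r by (simp_all add: \<mm>_def)
    then show "cnv w r s \<in> carrier V" using sV by simp
    fix k assume k: "k < N"
    have "cnv w r s k = \<zero>"
    proof (rule conv_coeff_zeroI[OF rV(1) sV k])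
      fix i assume "i \<le> k"
      then show "r i = \<zero> \<or> s (k - i) = \<zero>" using rV(2) s0[of "k - i"] k by (cases "i = 0") auto
    qed
    then show "cnv w r s k = \<zero>\<^bsub>V\<^esub> k" using k by simp
  qed simp
  then show "s \<in> socle \<Omega>" using sV by (simp add: socle_def)
qed

lemma module_on_socle: "Module.module A M \<Longrightarrow> Module.module A (M\<lparr>carrier := socle M\<rparr>)"
  by (rule LinearCombinations.module.submodule_is_module[OF _ socle_submodule])

lemma Ext_0_\<Omega>: "module_isomorphic A (Ext A 0 \<kk> \<Omega>) \<kk>"
proof -
  obtain \<pi> where \<pi>: "\<pi> \<in> module_hom A (\<Omega>\<lparr>carrier := socle \<Omega>\<rparr>) (Ext A 0 \<kk> \<Omega>)"
    "bij_betw \<pi> (socle \<Omega>) (carrier (Ext A 0 \<kk> \<Omega>))"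
    by (rule Ext_0_socle[OF module_\<Omega>])
  let ?S = "\<Omega>\<lparr>carrier := socle \<Omega>\<rparr>"
  have N1: "N - 1 < N" using N_pos by simp
  have bij: "bij_betw \<pi> (carrier ?S) (carrier (Ext A 0 \<kk> \<Omega>))" using \<pi>(2) by simp
  note inv = inverse_module_hom[OF \<pi>(1) bij module_on_socle[OF module_\<Omega>]]
  have inv_bij: "bij_betw (inv_into (carrier ?S) \<pi>) (carrier (Ext A 0 \<kk> \<Omega>)) (carrier ?S)"
    by (rule bij_betw_inv_into[OF bij])
  define \<sigma> where "\<sigma> s = q (structure_map A (s (N - 1)))" for s :: "nat \<Rightarrow> 'a"
  have sV: "s \<in> carrier V" "s (N - 1) \<in> carrier K" if "s \<in> socle \<Omega>" for s
    using that N1 by (simp_all add: socle_\<Omega>)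
  have "\<sigma> \<in> module_hom A ?S \<kk>"
  proof -
    have "\<sigma> s \<in> carrier \<kk>" if "s \<in> socle \<Omega>" for s
      unfolding \<sigma>_def q_laws(1)[symmetric] by (rule imageI[OF structure_map_closed[OF sV(2)[OF that]]])
    moreover have "\<sigma> (s \<oplus>\<^bsub>V\<^esub> t) = \<sigma> s \<oplus>\<^bsub>\<kk>\<^esub> \<sigma> t" if "s \<in> socle \<Omega>" "t \<in> socle \<Omega>" for s t
      unfolding \<sigma>_def V_add[OF N1] structure_map_add[OF sV(2)[OF that(1)] sV(2)[OF that(2)]]
      by (rule q_laws(3)[OF structure_map_closed[OF sV(2)[OF that(1)]] structure_map_closed[OF sV(2)[OF that(2)]]])
    moreover have "\<sigma> (r \<odot>\<^bsub>\<Omega>\<^esub> s) = r \<odot>\<^bsub>\<kk>\<^esub> \<sigma> s" if r: "r \<in> carrier V" and s: "s \<in> socle \<Omega>" for r s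
    proof -
      have r0: "r 0 \<in> carrier K" using r N_pos by simp
      have "r \<odot>\<^bsub>\<Omega>\<^esub> s = structure_map A (r 0) \<odot>\<^bsub>\<Omega>\<^esub> s" by (rule socle_smult[OF module_\<Omega> r s])
      also have "\<dots> = r 0 \<odot>\<^bsub>V\<^esub> s"
        unfolding \<Omega>_simps by (rule structure_map_mult[OF r0 sV(1)[OF s]]) (simp add: compat_zero)
      finally have "(r \<odot>\<^bsub>\<Omega>\<^esub> s) (N - 1) = r 0 \<otimes> s (N - 1)" using N1 by simp
      then have "\<sigma> (r \<odot>\<^bsub>\<Omega>\<^esub> s) = q (structure_map A (r 0 \<otimes> s (N - 1)))" by (simp only: \<sigma>_def)
      also have "\<dots> = q (cnv c r (structure_map A (s (N - 1))))"
        using r r0 sV(2)[OF s]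
        by (subst q_eq_iff) (simp_all add: structure_map_closed structure_map_coeff0 conv_at_zero compat_zero N_pos)
      also have "\<dots> = r \<odot>\<^bsub>\<kk>\<^esub> \<sigma> s" unfolding \<sigma>_def by (rule q_laws(4)[OF r structure_map_closed[OF sV(2)[OF s]]])
      finally show ?thesis .
    qed
    ultimately show ?thesis by (simp add: hom_def)
  qed
  note hom = hom_compose[OF inv this]
  have "bij_betw \<sigma> (carrier ?S) (carrier \<kk>)"
  proof (rule bij_betwI')
    fix s t assume st: "s \<in> carrier ?S" "t \<in> carrier ?S"
    then have st': "s \<in> socle \<Omega>" "t \<in> socle \<Omega>" by simp_all
    show "\<sigma> s = \<sigma> t \<longleftrightarrow> s = t"
    proof
      assume "\<sigma> s = \<sigma> t"
      then have "s (N - 1) = t (N - 1)"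
        unfolding \<sigma>_def using sV(2)[OF st'(1)] sV(2)[OF st'(2)]
        by (subst (asm) q_eq_iff) (simp_all add: structure_map_closed structure_map_coeff0)
      then show "s = t"
      proof (intro V_eqI sV(1)[OF st'(1)] sV(1)[OF st'(2)])
        fix k assume "k < N" and eq: "s (N - 1) = t (N - 1)"
        then consider "k < N - 1" | "k = N - 1" by linarith
        then show "s k = t k" using st' eq by cases (simp_all add: socle_\<Omega>)
      qed
    qed simp
  next
    show "\<sigma> s \<in> carrier \<kk>" if "s \<in> carrier ?S" for s
      unfolding \<sigma>_def q_laws(1)[symmetric] using that by (intro imageI structure_map_closed sV(2)) simp
    fix y assume "y \<in> carrier \<kk>"
    then obtain f where f: "f \<in> carrier V" "y = q f" unfolding q_laws(1)[symmetric] by blast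
    have f0: "f 0 \<in> carrier K" using f N_pos by simp
    define s where "s = f 0 \<odot>\<^bsub>V\<^esub> monom (N - 1)"
    have "s \<in> socle \<Omega>" using f0 by (simp add: socle_\<Omega> s_def)
    moreover have "y = \<sigma> s"
      using f f0 N1 by (simp add: \<sigma>_def s_def) (subst q_eq_iff; simp add: structure_map_closed structure_map_coeff0)
    ultimately show "\<exists>s\<in>carrier ?S. y = \<sigma> s" by (intro bexI[of _ s]) simp_all
  qed
  then have "bij_betw (\<lambda>x. \<sigma> (inv_into (carrier ?S) \<pi> x)) (carrier (Ext A 0 \<kk> \<Omega>)) (carrier \<kk>)"
    using bij_betw_trans[OF inv_bij] by (simp add: comp_def)
  then show ?thesis using hom unfolding module_isomorphic_def by blast
qed

lemma finitely_generated_\<Omega>: "finitely_generated_module A \<Omega>"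
proof -
  interpret C: coordinate_space K "scalars \<Omega>" N "\<lambda>m f. f m" by (rule coordinates_\<Omega>)
  let ?Q = "\<lambda>T. \<exists>S\<subseteq>carrier \<Omega>. finite S \<and> \<Omega>.span S = T"
  have carr: "submodule A (carrier \<Omega>) \<Omega>"
    by (rule submodule.intro[OF module_\<Omega>]) simp_all
  have "?Q (carrier \<Omega>)"
  proof (rule C.submodule_growth_induct[where Q = ?Q and ?T0.0 = "\<Omega>.span {}"])
    show "submodule K (carrier \<Omega>) (scalars \<Omega>)" by (rule submodule_scalars[OF module_\<Omega> carr])
    fix T assume "?Q T"
    then obtain S where "S \<subseteq> carrier \<Omega>" "\<Omega>.span S = T" by (elim exE conjE)
    then show "submodule K T (scalars \<Omega>)"
      using submodule_scalars[OF module_\<Omega>] \<Omega>.span_is_submodule by metis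
  next
    show "?Q (\<Omega>.span {})" by (rule exI[of _ "{}"]) simp
    show "\<Omega>.span {} \<subseteq> carrier \<Omega>" using submodule.subset[OF \<Omega>.span_is_submodule, of "{}"] by simp
  next
    fix T s assume Q: "?Q T" and s: "s \<in> carrier \<Omega>" "s \<notin> T"
    from Q obtain S where S: "S \<subseteq> carrier \<Omega>" "finite S" "\<Omega>.span S = T" by (elim exE conjE)
    have sub: "insert s S \<subseteq> carrier \<Omega>" using s S by simp
    have "s \<in> \<Omega>.span (insert s S)" using \<Omega>.in_own_span[OF sub] by blast
    moreover have "T \<subseteq> \<Omega>.span (insert s S)" unfolding S(3)[symmetric] by (rule \<Omega>.span_is_monotone) blast
    moreover have "\<Omega>.span (insert s S) \<subseteq> carrier \<Omega>" by (rule submodule.subset[OF \<Omega>.span_is_submodule[OF sub]])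
    ultimately show "\<exists>T'. ?Q T' \<and> T \<subset> T' \<and> T' \<subseteq> carrier \<Omega>"
      using sub S(2) s(2) by (intro exI[of _ "\<Omega>.span (insert s S)"] conjI exI[of _ "insert s S"]) auto
  qed
  then show ?thesis unfolding finitely_generated_module_def using module_\<Omega> by blast
qed

lemma canonical_\<Omega>: "canonical_module A D \<Omega>"
  unfolding canonical_module_def
proof (intro conjI allI finitely_generated_\<Omega>)
  show "\<exists>E. graded_module A D \<Omega> E" using graded_\<Omega> by blast
  fix i
  show "if enat i = krull_dim A then module_isomorphic A (Ext A i \<kk> \<Omega>) \<kk>
        else carrier (Ext A i \<kk> \<Omega>) = {\<zero>\<^bsub>Ext A i \<kk> \<Omega>\<^esub>}"
  proof (cases i)
    case 0
    then show ?thesis using Ext_0_\<Omega> by (simp add: krull_dim_A zero_enat_def)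
  next
    case (Suc j)
    then show ?thesis using Ext_\<Omega>_vanishes[of j] by (simp add: krull_dim_A zero_enat_def)
  qed
qed

text \<open>
  In dimension \<open>0\<close> the type is the dimension of the socle, for which \<open>\<iota>\<close> provides linear coordinates.
\<close>

lemma cm_type_by_socle_coordinates:
  assumes \<iota>: "\<iota> \<in> carrier (func_space {..<n}) \<rightarrow> socle (regular_module A)"
      "bij_betw \<iota> (carrier (func_space {..<n})) (socle (regular_module A))"
      "\<And>x y. \<lbrakk>x \<in> carrier (func_space {..<n}); y \<in> carrier (func_space {..<n})\<rbrakk> \<Longrightarrow>
        \<iota> (x \<oplus>\<^bsub>func_space {..<n}\<^esub> y) = \<iota> x \<oplus>\<^bsub>V\<^esub> \<iota> y"
      "\<And>r x. \<lbrakk>r \<in> carrier K; x \<in> carrier (func_space {..<n})\<rbrakk> \<Longrightarrow>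
        \<iota> (r \<odot>\<^bsub>func_space {..<n}\<^esub> x) = r \<odot>\<^bsub>V\<^esub> \<iota> x"
  shows "cm_type K A D = enat n"
proof -
  interpret U: coefficient_space K n ..
  let ?U = "func_space {..<n}" and ?R = "regular_module A"
  obtain \<pi> where \<pi>: "\<pi> \<in> module_hom A (?R\<lparr>carrier := socle ?R\<rparr>) (Ext A 0 \<kk> ?R)"
    "bij_betw \<pi> (socle ?R) (carrier (Ext A 0 \<kk> ?R))" "\<pi> \<zero>\<^bsub>?R\<^esub> = \<zero>\<^bsub>Ext A 0 \<kk> ?R\<^esub>"
    by (rule Ext_0_socle[OF module_regular])
  define \<psi> where "\<psi> x = \<pi> (\<iota> x)" for x
  have \<iota>S: "\<iota> x \<in> socle ?R" if "x \<in> carrier ?U" for x using \<iota>(1) that by blast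
  have sV: "socle ?R \<subseteq> carrier V" by (auto simp: socle_def)
  have \<psi>_add: "\<psi> (x \<oplus>\<^bsub>?U\<^esub> y) = \<psi> x \<oplus>\<^bsub>Ext A 0 \<kk> ?R\<^esub> \<psi> y" if "x \<in> carrier ?U" "y \<in> carrier ?U" for x y
    using hom_add[OF \<pi>(1), of "\<iota> x" "\<iota> y"] that \<iota>S by (simp add: \<psi>_def \<iota>(3))
  have \<psi>_smult: "\<psi> (r \<odot>\<^bsub>?U\<^esub> x) = structure_map A r \<odot>\<^bsub>Ext A 0 \<kk> ?R\<^esub> \<psi> x"
    if r: "r \<in> carrier K" and x: "x \<in> carrier ?U" for r x
  proof -
    have "cnv c (structure_map A r) (\<iota> x) = r \<odot>\<^bsub>V\<^esub> \<iota> x"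
      using sV \<iota>S[OF x] by (intro structure_map_mult[OF r]) (auto simp: compat_zero)
    then show ?thesis
      using hom_smult[OF \<pi>(1), of "structure_map A r" "\<iota> x"] r x \<iota>S[OF x]
      by (simp add: \<psi>_def \<iota>(4) structure_map_closed)
  qed
  have bij: "bij_betw \<psi> (carrier ?U) (carrier (Ext A 0 \<kk> ?R))"
    using bij_betw_trans[OF \<iota>(2) \<pi>(2)] unfolding \<psi>_def[abs_def] comp_def .
  have z: "\<iota> \<zero>\<^bsub>?U\<^esub> = \<zero>\<^bsub>V\<^esub>"
  proof -
    have "\<iota> (\<zero> \<odot>\<^bsub>?U\<^esub> \<zero>\<^bsub>?U\<^esub>) = \<zero> \<odot>\<^bsub>V\<^esub> \<iota> \<zero>\<^bsub>?U\<^esub>" by (rule \<iota>(4)) simp_all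
    then show ?thesis using sV \<iota>S[of "\<zero>\<^bsub>?U\<^esub>"] by (simp add: U.V.smult_l_null V.smult_l_null subsetD)
  qed
  have "vector_dim K (scalars (Ext A 0 \<kk> ?R)) = enat (vectorspace.dim K ?U)"
  proof (rule vector_dim_iso(1)[OF field_axioms U.V.module_axioms U.dim_V(1)])
    show "\<psi> \<in> module_hom K ?U (scalars (Ext A 0 \<kk> ?R))"
      using bij \<psi>_add \<psi>_smult unfolding hom_def restrict_scalars_def by (auto simp: bij_betw_def)
    show "bij_betw \<psi> (carrier ?U) (carrier (scalars (Ext A 0 \<kk> ?R)))"
      using bij by (simp add: restrict_scalars_def)
    show "\<psi> \<zero>\<^bsub>?U\<^esub> = \<zero>\<^bsub>scalars (Ext A 0 \<kk> ?R)\<^esub>"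
      using z \<pi>(3) by (simp add: \<psi>_def restrict_scalars_def)
  qed
  then show ?thesis
    by (simp add: cm_type_def krull_dim_A zero_enat_def U.dim_V(2))
qed

text \<open>
  The elements of order at least \<open>j\<close>, for the degree as order; past \<open>N\<close> this is the zero ideal.
\<close>

definition order_ideal :: "nat \<Rightarrow> (nat \<Rightarrow> 'a) set" where
  "order_ideal j = {f \<in> carrier V. \<forall>i<N. i < j \<longrightarrow> f i = \<zero>}"

lemma order_ideal_submodule: "submodule A (order_ideal j) (regular_module A)"
proof (rule submodule.intro[OF module_regular])
  fix r f assume r: "r \<in> carrier A" and f: "f \<in> order_ideal j"
  have fV: "f \<in> carrier V" and f0: "\<And>i. i < N \<Longrightarrow> i < j \<Longrightarrow> f i = \<zero>" using f by (auto simp: order_ideal_def)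
  have rV: "r \<in> carrier V" using r by simp
  have "cnv c r f i = \<zero>" if i: "i < N" "i < j" for i
    by (rule conv_coeff_zeroI[OF rV fV i(1)]) (use f0 i in auto)
  then show "r \<odot>\<^bsub>regular_module A\<^esub> f \<in> order_ideal j" using r fV by (simp add: order_ideal_def)
qed (auto simp: order_ideal_def)

text \<open>
  The order ideals between the whole algebra and \<open>order_ideal b\<close> form a chain of length \<open>b\<close>.  A chain
  in the quotient lifts to one above \<open>order_ideal b\<close>, which already has \<open>N - b\<close> pivots out of \<open>N\<close>.
\<close>

lemma length_mod_order_ideal:
  assumes b: "b \<le> N"
  shows "module_length A (quotient_module (regular_module A) (order_ideal b)) = enat b"
proof -
  let ?R = "regular_module A" and ?J = "order_ideal b"
  let ?Q = "quotient_module ?R ?J"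
  note J = order_ideal_submodule[of b]
  define p where "p f = ?J +>\<^bsub>?R\<^esub> f" for f
  have p: "p ` carrier V = carrier ?Q" "\<zero>\<^bsub>?Q\<^esub> = p \<zero>\<^bsub>V\<^esub>"
    "\<And>f g. f \<in> carrier V \<Longrightarrow> g \<in> carrier V \<Longrightarrow> p (f \<oplus>\<^bsub>V\<^esub> g) = p f \<oplus>\<^bsub>?Q\<^esub> p g"
    "\<And>r f. r \<in> carrier V \<Longrightarrow> f \<in> carrier V \<Longrightarrow> p (cnv c r f) = r \<odot>\<^bsub>?Q\<^esub> p f"
    using quotient_map_onto[OF module_regular J] quotient_map_zero[OF module_regular J]
      quotient_map_add[OF module_regular J] quotient_map_smult[OF module_regular J]
    by (simp_all add: p_def)
  have Q: "Module.module A ?Q" by (rule quotient_is_module[OF module_regular J])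
  interpret C: coordinate_space K "scalars ?R" N "\<lambda>m f. f m" by (rule coordinates_regular)
  interpret R: Module.module A ?R by (rule module_regular)
  have p_eq: "p f = p g \<longleftrightarrow> (\<forall>i<b. f i = g i)" if fg: "f \<in> carrier V" "g \<in> carrier V" for f g
  proof -
    have "p f = p g \<longleftrightarrow> f \<ominus>\<^bsub>?R\<^esub> g \<in> ?J"
      using quotient_map_eq_iff[OF module_regular J] fg by (simp add: p_def)
    then show ?thesis using regular_minus[OF fg] b by (auto simp: order_ideal_def)
  qed
  have image: "submodule A (p ` S) ?Q" if S: "submodule A S ?R" for S
  proof -
    have "S \<subseteq> carrier V" using submodule.subset[OF S] by simp
    then interpret h: mod_hom A "?R\<lparr>carrier := S\<rparr>" ?Q p
      unfolding mod_hom_def mod_hom_axioms_def hom_def using R.submodule_is_module[OF S] Q p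
      by (auto simp: subset_iff)
    show ?thesis using h.im_is_submodule by (simp add: h.im_def)
  qed
  have lower: "\<exists>X. (\<forall>i\<le>b. submodule A (X i) ?Q) \<and> (\<forall>i<b. X i \<subset> X (Suc i))"
  proof (intro exI[of _ "\<lambda>i. p ` order_ideal (b - i)"] conjI allI impI image order_ideal_submodule)
    fix i assume i: "i < b"
    have "order_ideal (b - i) \<subseteq> order_ideal (b - Suc i)" by (auto simp: order_ideal_def)
    then have sub: "p ` order_ideal (b - i) \<subseteq> p ` order_ideal (b - Suc i)" by (rule image_mono)
    have in1: "p (monom (b - Suc i)) \<in> p ` order_ideal (b - Suc i)"
      by (rule imageI) (simp add: order_ideal_def)
    have "p (monom (b - Suc i)) \<notin> p ` order_ideal (b - i)"
    proof
      assume "p (monom (b - Suc i)) \<in> p ` order_ideal (b - i)"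
      then obtain g where g: "p (monom (b - Suc i)) = p g" "g \<in> order_ideal (b - i)" by (rule imageE)
      have gV: "g \<in> carrier V" using g(2) by (simp add: order_ideal_def)
      have lt: "b - Suc i < b" "b - Suc i < N" "b - Suc i < b - i" using i b by simp_all
      have "monom (b - Suc i) (b - Suc i) = g (b - Suc i)"
        using g(1) p_eq[OF monom_closed gV] lt(1) by blast
      also have "\<dots> = \<zero>" using g(2) lt by (simp add: order_ideal_def)
      finally show False using lt by simp
    qed
    then show "p ` order_ideal (b - i) \<subset> p ` order_ideal (b - Suc i)" using sub in1 by blast
  qed
  have upper: "n \<le> b" if X: "\<forall>i\<le>n. submodule A (X i) ?Q" "\<forall>i<n. X i \<subset> X (Suc i)" for n X
  proof -
    \<comment> \<open>the preimages of the chain in the algebra\<close>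
    define Y where "Y i = {f \<in> carrier V. p f \<in> X i}" for i
    have Y: "submodule K (Y i) (scalars ?R)" if i: "i \<le> n" for i
    proof -
      interpret X: submodule A "X i" ?Q using X(1) i by blast
      have "submodule A (Y i) ?R"
        by (rule submodule.intro[OF module_regular])
          (use X.m_closed X.zero_closed X.smult_closed in \<open>auto simp: Y_def p(2,3,4)\<close>)
      then show ?thesis by (rule submodule_scalars[OF module_regular])
    qed
    have strict: "Y i \<subset> Y (Suc i)" if i: "i < n" for i
    proof -
      have sub: "X i \<subset> X (Suc i)" using X(2) i by blast
      then obtain x where x: "x \<in> X (Suc i)" "x \<notin> X i" by blast
      have "X (Suc i) \<subseteq> carrier ?Q" using submodule.subset X(1) i by (metis Suc_leI)
      then obtain f where "f \<in> carrier V" "x = p f" using x(1) unfolding p(1)[symmetric] by blast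
      then have "f \<in> Y (Suc i)" "f \<notin> Y i" using x by (simp_all add: Y_def)
      moreover have "Y i \<subseteq> Y (Suc i)" using sub by (auto simp: Y_def)
      ultimately show ?thesis by blast
    qed
    have "N - b + i \<le> card (C.leading (Y i))" if "i \<le> n" for i
      using that
    proof (induction i)
      case 0
      have "{b..<N} \<subseteq> C.leading (Y 0)"
      proof
        fix j assume j: "j \<in> {b..<N}"
        have "p (monom j) = p \<zero>\<^bsub>V\<^esub>" using j by (subst p_eq) auto
        moreover have "\<zero>\<^bsub>?Q\<^esub> \<in> X 0" using submodule.zero_closed X(1) by blast
        ultimately have "monom j \<in> Y 0" by (simp add: Y_def p(2))
        then show "j \<in> C.leading (Y 0)"
          unfolding C.leading_def using j by (intro CollectI conjI bexI[of _ "monom j"]) auto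
      qed
      then have "card {b..<N} \<le> card (C.leading (Y 0))" by (rule card_mono[OF C.finite_leading])
      then show ?case by simp
    next
      case (Suc i)
      have "C.leading (Y i) \<subset> C.leading (Y (Suc i))"
        using Suc.prems by (intro C.leading_strict_mono Y strict) simp_all
      then have "card (C.leading (Y i)) < card (C.leading (Y (Suc i)))"
        by (rule psubset_card_mono[OF C.finite_leading])
      then show ?case using Suc by simp
    qed
    from this[of n] have "N - b + n \<le> card (C.leading (Y n))" by simp
    also have "\<dots> \<le> card {..<N}"
      by (rule card_mono) (auto simp: C.leading_def)
    finally show "n \<le> b" using b by simp
  qed
  show ?thesis unfolding module_length_def
  proof (rule antisym)
    show "Sup {enat n |n. \<exists>X. (\<forall>i\<le>n. submodule A (X i) ?Q) \<and> (\<forall>i<n. X i \<subset> X (Suc i))} \<le> enat b"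
      by (rule Sup_least) (use upper in auto)
    show "enat b \<le> Sup {enat n |n. \<exists>X. (\<forall>i\<le>n. submodule A (X i) ?Q) \<and> (\<forall>i<n. X i \<subset> X (Suc i))}"
      by (rule Sup_upper) (use lower in blast)
  qed
qed

end

section \<open>The tensor product of a square-zero algebra and a truncated polynomial algebra\<close>

text \<open>
  With \<open>i = p b + r\<close> and \<open>j = q b + s\<close> for \<open>r, s < b\<close>: the product of \<open>x\<^sub>p y\<^sup>r\<close> and \<open>x\<^sub>q y\<^sup>s\<close> is not zero iff
  one of \<open>p\<close>, \<open>q\<close> is \<open>0\<close> and \<open>r + s < b\<close>.
\<close>

definition compat :: "nat \<Rightarrow> nat \<Rightarrow> nat \<Rightarrow> bool" where
  "compat b i j \<longleftrightarrow> (i < b \<or> j < b) \<and> i mod b + j mod b < b"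

text \<open>
  The right-hand side does not change when \<open>i\<close>, \<open>j\<close>, \<open>k\<close> are permuted, which gives associativity.
\<close>

lemma compat_assoc_iff:
  assumes "0 < b"
  shows "compat b i j \<and> compat b (i + j) k \<longleftrightarrow>
    (i < b \<and> j < b \<or> i < b \<and> k < b \<or> j < b \<and> k < b) \<and> i mod b + j mod b + k mod b < b"
proof (cases "i mod b + j mod b < b")
  case True
  have "(i + j) mod b = (i mod b + j mod b) mod b" by (simp add: mod_add_eq)
  then have m: "(i + j) mod b = i mod b + j mod b" using True by simp
  have "i + j < b \<longleftrightarrow> i < b \<and> j < b"
    using True by (metis add_lessD1 add.commute mod_less)
  then show ?thesis using True m by (auto simp: compat_def)
next
  case False
  then show ?thesis by (auto simp: compat_def)
qed

text \<open>
  The size \<open>N\<close> is a parameter, and not the term \<open>a * b + b\<close>, so that rewriting treats it as an atom.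
\<close>

locale truncated_tensor_algebra = coefficient_space K N for K (structure) and N +
  fixes a b :: nat
  assumes a: "2 \<le> a" and b: "1 \<le> b" and N_eq: "N = a * b + b"

sublocale truncated_tensor_algebra \<subseteq> monomial_algebra K N "compat b"
proof unfold_locales
  show "0 < N" using b N_eq by simp
  show "compat b i j \<longleftrightarrow> compat b j i" for i j by (auto simp: compat_def add.commute)
  show "compat b 0 j" for j using b by (auto simp: compat_def)
  show "compat b i j \<and> compat b (i + j) k \<longleftrightarrow> compat b j k \<and> compat b i (j + k)" for i j k
  proof -
    have "compat b i (j + k) \<longleftrightarrow> compat b (j + k) i" by (auto simp: compat_def add.commute)
    then show ?thesis
      using compat_assoc_iff[of b i j k] compat_assoc_iff[of b j k i] b by (auto simp: add.commute add.left_commute)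
  qed
qed

context truncated_tensor_algebra
begin

lemma compat_with_order:
  assumes "n < b" "j mod b = 0" shows "compat b j n"
  using assms by (simp add: compat_def)

text \<open>
  The coefficients of \<open>f\<close> at the powers \<open>y\<^sup>j\<close> reappear in \<open>x\<^sub>i f\<close> as the coefficients at \<open>x\<^sub>i y\<^sup>j\<close>.
\<close>

lemma order_ideal_if_annihilated:
  assumes f: "f \<in> carrier V" and i: "i \<le> a" and 0: "cnv (compat b) (monom (i * b)) f = \<zero>\<^bsub>V\<^esub>"
  shows "f \<in> order_ideal b"
proof -
  have "f j = \<zero>" if j: "j < b" for j
  proof -
    have "i * b \<le> a * b" using i by (rule mult_le_mono1)
    then have lt: "i * b < N" "i * b + j < N" unfolding N_eq using j by linarith+
    have "cnv (compat b) (monom (i * b)) f (i * b + j) = f j"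
      unfolding conv_monom_coeff[OF f lt(2) lt(1)] using j compat_with_order[of j "i * b"] by simp
    then show ?thesis using 0 lt by simp
  qed
  then show ?thesis using f by (simp add: order_ideal_def)
qed

text \<open>
  The ideal \<open>order_ideal b\<close> is \<open>(x\<^sub>1, \<dots>, x\<^sub>a)\<close>.  Positions below \<open>b\<close> of a functional are its values at
  \<open>x\<^sub>a y\<^sup>j\<close>.  The part \<open>u\<close> of \<open>w\<close> in these positions is killed by \<open>x\<^sub>1\<close> since \<open>a \<noteq> 1\<close>, and the rest \<open>v\<close>
  is killed by \<open>x\<^sub>a\<close>.
\<close>

lemma hom_into_order_ideal:
  assumes \<phi>: "\<phi> \<in> module_hom A \<Omega> (regular_module A)" and w: "w \<in> carrier V"
  shows "\<phi> w \<in> order_ideal b"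
proof -
  interpret \<phi>: mod_hom A \<Omega> "regular_module A" \<phi>
    using \<phi> module_\<Omega> module_regular by (simp add: mod_hom_def mod_hom_axioms_def)
  interpret J: submodule A "order_ideal b" "regular_module A" by (rule order_ideal_submodule)
  define u where "u = (\<lambda>k\<in>{..<N}. if k < b then w k else \<zero>)"
  define v where "v = (\<lambda>k\<in>{..<N}. if k < b then \<zero> else w k)"
  have uV: "u \<in> carrier V" and vV: "v \<in> carrier V"
    unfolding u_def v_def using w by (intro V_memI; simp)+
  have w_eq: "w = u \<oplus>\<^bsub>V\<^esub> v"
    by (rule V_eqI) (use w uV vV in \<open>simp_all add: u_def v_def\<close>)
  have annih: "\<phi> x \<in> order_ideal b"
    if x: "x \<in> carrier V" and i: "i \<le> a" and 0: "monom (i * b) \<odot>\<^bsub>\<Omega>\<^esub> x = \<zero>\<^bsub>V\<^esub>" for x i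
  proof (rule order_ideal_if_annihilated[OF _ i])
    show "\<phi> x \<in> carrier V" using \<phi>.f_im[of x] x by simp
    have "\<phi> (monom (i * b) \<odot>\<^bsub>\<Omega>\<^esub> x) = monom (i * b) \<odot>\<^bsub>regular_module A\<^esub> \<phi> x"
      using x by (intro \<phi>.f_smult) simp_all
    then show "cnv (compat b) (monom (i * b)) (\<phi> x) = \<zero>\<^bsub>V\<^esub>" using 0 \<phi>.f0_is_0 by simp
  qed
  have "monom (1 * b) \<odot>\<^bsub>\<Omega>\<^esub> u = \<zero>\<^bsub>V\<^esub>"
    unfolding \<Omega>_simps
  proof (rule V_eqI)
    fix k assume k: "k < N"
    have ab: "2 * b \<le> a * b" using a by (rule mult_le_mono1)
    have lt: "1 * b < N" using ab b N_eq by linarith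
    have "\<not> compat b (1 * b) (N - 1 - 1 * b - (k - 1 * b))" if "1 * b \<le> k" "k - 1 * b < b"
    proof -
      have "b \<le> N - 1 - 1 * b - (k - 1 * b)" using that k ab b N_eq by linarith
      then show ?thesis by (simp add: compat_def)
    qed
    then show "cnv (\<lambda>i j. compat b i (N - 1 - i - j)) (monom (1 * b)) u k = \<zero>\<^bsub>V\<^esub> k"
      unfolding conv_monom_coeff[OF uV k lt] using k by (auto simp: u_def)
  qed (simp_all add: uV)
  then have \<phi>u: "\<phi> u \<in> order_ideal b" using a by (intro annih[OF uV, of 1]) simp_all
  have "monom (a * b) \<odot>\<^bsub>\<Omega>\<^esub> v = \<zero>\<^bsub>V\<^esub>"
    unfolding \<Omega>_simps
  proof (rule V_eqI)
    fix k assume k: "k < N"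
    have lt: "a * b < N" using b N_eq by simp
    have "k - a * b < b" if "a * b \<le> k" using that k N_eq by linarith
    then show "cnv (\<lambda>i j. compat b i (N - 1 - i - j)) (monom (a * b)) v k = \<zero>\<^bsub>V\<^esub> k"
      unfolding conv_monom_coeff[OF vV k lt] using k by (auto simp: v_def)
  qed (simp_all add: vV)
  then have \<phi>v: "\<phi> v \<in> order_ideal b" by (intro annih[OF vV, of a]) simp_all
  have "\<phi> w = \<phi> u \<oplus>\<^bsub>V\<^esub> \<phi> v" unfolding w_eq using \<phi>.f_add[of u v] uV vV by simp
  then show ?thesis using J.m_closed[OF \<phi>u \<phi>v] by simp
qed

text \<open>
  Sends a functional \<open>\<phi>\<close> to the sum of the \<open>\<phi>(x\<^sub>a\<^sub>-\<^sub>q y\<^sup>b\<^sup>-\<^sup>1\<^sup>-\<^sup>r) x\<^sub>q\<^sub>+\<^sub>1 y\<^sup>r\<close> over \<open>q < a\<close> and \<open>r < b\<close>; the values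
  of \<open>\<phi>\<close> at the powers of \<open>y\<close> are pushed out at the top.
\<close>

definition shift :: "(nat \<Rightarrow> 'a) \<Rightarrow> nat \<Rightarrow> 'a" where
  "shift f = (\<lambda>k\<in>{..<N}. if k < b then \<zero> else f (k - b))"

lemma shift_closed: "f \<in> carrier V \<Longrightarrow> shift f \<in> carrier V"
  unfolding shift_def by (rule V_memI) simp

text \<open>
  Both sides say that multiplication by \<open>t\<^sup>j\<close> moves position \<open>k - j\<close> to position \<open>k\<close>, on the left in
  the dual and on the right, after the shift by \<open>b\<close>, in the algebra.  For \<open>k < a b\<close> either holds iff
  \<open>t\<^sup>j\<close> is a power of \<open>y\<close> and \<open>k\<close>, \<open>k - j\<close> lie in the same block of length \<open>b\<close>.
\<close>

lemma shift_compat: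
  assumes "j \<le> k" "k < a * b"
  shows "compat b j (N - 1 - j - (k - j)) \<longleftrightarrow> compat b j (k + b - j)"
proof -
  have b0: "0 < b" using b by simp
  have "N - 1 - k = (a - k div b) * b + (b - 1 - k mod b)" and pos: "k div b < a"
  proof -
    show pos: "k div b < a" using assms(2) b0 by (simp add: less_mult_imp_div_less)
    have "k div b * b + k mod b = k" by simp
    moreover have "k mod b < b" using b0 by simp
    moreover have "(a - k div b) * b = a * b - k div b * b" by (simp add: diff_mult_distrib)
    moreover have "k div b * b \<le> a * b" using pos by (intro mult_le_mono1) simp
    ultimately show "N - 1 - k = (a - k div b) * b + (b - 1 - k mod b)" using N_eq by linarith
  qed
  moreover have "b - 1 - k mod b < b" using b0 by simp
  ultimately have m1: "(N - 1 - k) mod b = b - 1 - k mod b" by simp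
  have big1: "\<not> N - 1 - k < b" using assms(2) N_eq by linarith
  have big2: "\<not> k + b - j < b" using assms(1) by simp
  have idx: "N - 1 - j - (k - j) = N - 1 - k" using assms by simp
  have "k mod b < b" using b0 by simp
  have lhs: "compat b j (N - 1 - k) \<longleftrightarrow> j < b \<and> j \<le> k mod b"
    using big1 m1 \<open>k mod b < b\<close> by (auto simp: compat_def)
  have rhs: "compat b j (k + b - j) \<longleftrightarrow> j < b \<and> j \<le> k mod b"
  proof (cases "j < b")
    case True
    have m: "(k + b - j) mod b = (k - j) mod b"
      using assms(1) by (metis Nat.add_diff_assoc2 mod_add_self2)
    show ?thesis
    proof (cases "j \<le> k mod b")
      case le: True
      have "k - j = k div b * b + (k mod b - j)" using le div_mult_mod_eq[of k b] by linarith
      then have "(k - j) mod b = (k mod b - j) mod b" by (metis mod_mult_self3)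
      also have "\<dots> = k mod b - j" using \<open>k mod b < b\<close> by simp
      finally show ?thesis using True le \<open>k mod b < b\<close> m by (simp add: compat_def)
    next
      case gt: False
      have "0 < k div b"
      proof (rule ccontr)
        assume "\<not> 0 < k div b"
        then have "k mod b = k" using div_mult_mod_eq[of k b] by simp
        then show False using gt assms(1) by simp
      qed
      then obtain d where d: "k div b = Suc d" using gr0_conv_Suc by blast
      have "k - j = d * b + (b + k mod b - j)" using d div_mult_mod_eq[of k b] True by simp
      then have "(k - j) mod b = (b + k mod b - j) mod b" by (metis mod_mult_self3)
      also have "\<dots> = b + k mod b - j" using gt True by simp
      finally show ?thesis using gt True m by (simp add: compat_def)
    qed
  next
    case False
    then show ?thesis using big2 by (simp add: compat_def)
  qed
  show ?thesis unfolding idx lhs rhs ..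
qed

lemma shift_hom: "shift \<in> module_hom A \<Omega> (regular_module A)"
proof (rule hom_if_commutes_with_monoms[OF module_\<Omega> module_regular])
  show "shift f \<in> carrier (regular_module A)" if "f \<in> carrier \<Omega>" for f using shift_closed that by simp
  show "shift (f \<oplus>\<^bsub>\<Omega>\<^esub> g) = shift f \<oplus>\<^bsub>regular_module A\<^esub> shift g" if "f \<in> carrier \<Omega>" "g \<in> carrier \<Omega>" for f g
    using that by (simp, intro V_eqI) (simp_all add: shift_closed, simp add: shift_def)
  have sm: "shift (r \<odot>\<^bsub>V\<^esub> f) = r \<odot>\<^bsub>V\<^esub> shift f" if "r \<in> carrier K" "f \<in> carrier V" for r f
    using that by (intro V_eqI) (simp_all add: shift_closed, simp add: shift_def)
  show "shift (structure_map A r \<odot>\<^bsub>\<Omega>\<^esub> f) = structure_map A r \<odot>\<^bsub>regular_module A\<^esub> shift f"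
    if "r \<in> carrier K" "f \<in> carrier \<Omega>" for r f
    using that sm by (simp add: structure_map_mult compat_zero shift_closed)
  show "shift (monom n \<odot>\<^bsub>\<Omega>\<^esub> f) = monom n \<odot>\<^bsub>regular_module A\<^esub> shift f"
    if n: "n < N" and f: "f \<in> carrier \<Omega>" for n f
    unfolding \<Omega>_simps regular_simps
  proof (rule V_eqI)
    have fV: "f \<in> carrier V" using f by simp
    show "shift (cnv (\<lambda>i j. compat b i (N - 1 - i - j)) (monom n) f) \<in> carrier V" using fV by (simp add: shift_closed)
    show "cnv (compat b) (monom n) (shift f) \<in> carrier V" using fV by (simp add: shift_closed)
    fix k assume k: "k < N"
    show "shift (cnv (\<lambda>i j. compat b i (N - 1 - i - j)) (monom n) f) k = cnv (compat b) (monom n) (shift f) k"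
    proof (cases "k < b")
      case True
      then have "k - n < b" "k - n < N" using k by linarith+
      then show ?thesis
        unfolding conv_monom_coeff[OF shift_closed[OF fV] k n] using True k by (simp add: shift_def)
    next
      case False
      define l where "l = k - b"
      then have l: "k = l + b" using False by simp
      have lN: "l < N" "l < a * b" using k l N_eq by linarith+
      have "shift (cnv (\<lambda>i j. compat b i (N - 1 - i - j)) (monom n) f) k =
          cnv (\<lambda>i j. compat b i (N - 1 - i - j)) (monom n) f l"
        using k l by (simp add: shift_def)
      also have "\<dots> = (if n \<le> l \<and> compat b n (N - 1 - n - (l - n)) then f (l - n) else \<zero>)"
        by (rule conv_monom_coeff[OF fV lN(1) n])
      also have "\<dots> = (if n \<le> k \<and> compat b n (k - n) then shift f (k - n) else \<zero>)"
      proof (cases "n \<le> l")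
        case True
        then have "shift f (k - n) = f (l - n)" using l k by (auto simp: shift_def)
        then show ?thesis using True shift_compat[OF True lN(2)] l by simp
      next
        case nl: False
        then have "n \<le> k \<Longrightarrow> shift f (k - n) = \<zero>" using l k by (auto simp: shift_def)
        then show ?thesis using nl by simp
      qed
      also have "\<dots> = cnv (compat b) (monom n) (shift f) k"
        by (rule conv_monom_coeff[OF shift_closed[OF fV] k n, symmetric])
      finally show ?thesis .
    qed
  qed
qed

text \<open>
  The image of the single homomorphism \<^term>\<open>shift\<close> is already the whole ideal.
\<close>

lemma trace_ideal_tensor: "trace_ideal A \<Omega> = order_ideal b"
proof
  let ?U = "\<Union>\<phi> \<in> module_hom A \<Omega> (regular_module A). \<phi> ` carrier \<Omega>"
  have J: "ideal (order_ideal b) A"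
    using order_ideal_submodule ideal_iff_submodule_regular[OF cring_A] by blast
  have U: "?U \<subseteq> order_ideal b" using hom_into_order_ideal by auto
  then have UA: "?U \<subseteq> carrier A" by (auto simp: order_ideal_def)
  show "trace_ideal A \<Omega> \<subseteq> order_ideal b"
    unfolding trace_ideal_def by (rule A.genideal_minimal[OF J U])
  show "order_ideal b \<subseteq> trace_ideal A \<Omega>"
  proof
    fix f assume f: "f \<in> order_ideal b"
    define g where "g = (\<lambda>k\<in>{..<N}. if k + b < N then f (k + b) else \<zero>)"
    have fV: "f \<in> carrier V" and f0: "\<And>i. i < N \<Longrightarrow> i < b \<Longrightarrow> f i = \<zero>" using f by (auto simp: order_ideal_def)
    have gV: "g \<in> carrier V" unfolding g_def by (rule V_memI) (use fV in simp)
    have "f = shift g"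
    proof (rule V_eqI[OF fV shift_closed[OF gV]])
      fix k assume "k < N"
      then show "f k = shift g k" using f0 by (auto simp: shift_def g_def)
    qed
    then have "f \<in> shift ` carrier \<Omega>" using gV by simp
    then have "f \<in> ?U" using shift_hom by blast
    then show "f \<in> trace_ideal A \<Omega>"
      unfolding trace_ideal_def using A.genideal_self[OF UA] by blast
  qed
qed

lemma residue_tensor: "residue_via A \<Omega> = enat b"
  unfolding residue_via_def trace_ideal_tensor by (rule length_mod_order_ideal) (simp add: N_eq)

text \<open>
  An element of the socle is killed by \<open>y\<close>, so only exponents \<open>b - 1\<close> of \<open>y\<close> occur in it, and by \<open>x\<^sub>1\<close>,
  which excludes \<open>y\<^sup>b\<^sup>-\<^sup>1\<close>.
\<close>

lemma socle_tensor:
  "socle (regular_module A) = {f \<in> carrier V. \<forall>k<N. \<not> (b \<le> k \<and> k mod b = b - 1) \<longrightarrow> f k = \<zero>}"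
proof (intro equalityI subsetI)
  have b0: "0 < b" using b by simp
  fix f assume f: "f \<in> socle (regular_module A)"
  have fV: "f \<in> carrier V" using f by (simp add: socle_def)
  have ann: "f j = \<zero>" if n: "0 < n" "n + j < N" and cmp: "compat b n j" for n j
  proof -
    have "monom n \<in> \<mm>" using n by (simp add: \<mm>_def)
    then have "cnv (compat b) (monom n) f (n + j) = \<zero>" using f n by (simp add: socle_def)
    moreover have "n < N" using n by simp
    ultimately show ?thesis using conv_monom_coeff[OF fV n(2), of n "compat b"] cmp by simp
  qed
  have "f k = \<zero>" if k: "k < N" and nk: "\<not> (b \<le> k \<and> k mod b = b - 1)" for k
  proof (cases "k mod b = b - 1")
    case True
    then have kb: "k < b" using nk by simp
    have "2 * b \<le> a * b" using a by (rule mult_le_mono1)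
    then have "b + k < N" using kb N_eq b0 by linarith
    then show ?thesis using kb b0 by (intro ann[of b]) (simp_all add: compat_def)
  next
    case False
    then have lt: "k mod b + 1 < b" using mod_less_divisor[OF b0, of k] by linarith
    have "1 + k < N"
    proof (rule ccontr)
      assume "\<not> 1 + k < N"
      then have "k = a * b + (b - 1)" using k b0 N_eq by linarith
      then have "k mod b = (b - 1) mod b" by (simp only: mod_mult_self3)
      then have "k mod b = b - 1" using b0 by simp
      then show False using False by simp
    qed
    then show ?thesis using lt by (intro ann[of 1]) (simp_all add: compat_def)
  qed
  then show "f \<in> {f \<in> carrier V. \<forall>k<N. \<not> (b \<le> k \<and> k mod b = b - 1) \<longrightarrow> f k = \<zero>}" using fV by simp
next
  fix f assume "f \<in> {f \<in> carrier V. \<forall>k<N. \<not> (b \<le> k \<and> k mod b = b - 1) \<longrightarrow> f k = \<zero>}"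
  then have fV: "f \<in> carrier V" and f0: "\<And>k. k < N \<Longrightarrow> \<not> (b \<le> k \<and> k mod b = b - 1) \<Longrightarrow> f k = \<zero>" by auto
  have "cnv (compat b) r f = \<zero>\<^bsub>V\<^esub>" if r: "r \<in> \<mm>" for r
  proof (rule V_eqI)
    have rV: "r \<in> carrier V" "r 0 = \<zero>" using r by (simp_all add: \<mm>_def)
    then show "cnv (compat b) r f \<in> carrier V" using fV by simp
    fix k assume k: "k < N"
    have "cnv (compat b) r f k = \<zero>"
    proof (rule conv_coeff_zeroI[OF rV(1) fV k])
      fix i assume "compat b i (k - i)"
      then have "i = 0 \<or> \<not> (b \<le> k - i \<and> (k - i) mod b = b - 1)" by (auto simp: compat_def)
      then show "r i = \<zero> \<or> f (k - i) = \<zero>" using rV(2) f0[OF less_imp_diff_less[OF k]] by auto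
    qed
    then show "cnv (compat b) r f k = \<zero>\<^bsub>V\<^esub> k" using k by simp
  qed simp
  then show "f \<in> socle (regular_module A)" using fV by (simp add: socle_def)
qed

lemma cm_type_tensor: "cm_type K A D = enat a"
proof -
  interpret U: coefficient_space K a ..
  have b0: "0 < b" using b by simp
  let ?U = "func_space {..<a}"
  define P where "P k \<longleftrightarrow> b \<le> k \<and> k mod b = b - 1" for k
  define \<iota> where "\<iota> x = (\<lambda>k\<in>{..<N}. if P k then x (k div b - 1) else \<zero>)" for x :: "nat \<Rightarrow> 'a"
  have idx: "k div b - 1 < a" if "k < N" "P k" for k
  proof -
    have "k < (a + 1) * b" using that(1) N_eq by simp
    then have "k div b < a + 1" by (rule less_mult_imp_div_less)
    then show ?thesis using a by simp
  qed
  have \<iota>V: "\<iota> x \<in> carrier V" if "x \<in> carrier ?U" for x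
    unfolding \<iota>_def by (rule V_memI) (use that idx in simp)
  have soc: "\<iota> x \<in> socle (regular_module A)" if "x \<in> carrier ?U" for x
    unfolding socle_tensor using \<iota>V[OF that] by (simp add: \<iota>_def P_def)
  \<comment> \<open>the position of \<open>x\<^sub>i\<^sub>+\<^sub>1 y\<^sup>b\<^sup>-\<^sup>1\<close>\<close>
  define pos where "pos i = (i + 1) * b + (b - 1)" for i
  have pos: "pos i < N" "P (pos i)" "pos i div b - 1 = i" if "i < a" for i
  proof -
    have "(i + 1) * b \<le> a * b" using that by (intro mult_le_mono1) simp
    then show "pos i < N" using b0 N_eq unfolding pos_def by linarith
    have "pos i div b = i + 1" unfolding pos_def using b0 by (subst div_mult_self3) simp_all
    then show "pos i div b - 1 = i" by simp
    have "pos i mod b = b - 1" unfolding pos_def using b0 by (subst mod_mult_self3) simp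
    then show "P (pos i)" by (simp add: P_def pos_def)
  qed
  have pos_div: "pos (k div b - 1) = k" if "P k" for k
  proof -
    have "1 \<le> k div b" using that b0 by (simp add: P_def Suc_le_eq div_greater_zero_iff)
    then show ?thesis using that div_mult_mod_eq[of k b] by (simp add: pos_def P_def)
  qed
  have \<iota>_pos: "\<iota> x (pos i) = x i" if "i < a" for x i
    using pos[OF that] by (simp add: \<iota>_def)
  show ?thesis
  proof (rule cm_type_by_socle_coordinates[of \<iota>])
    show "\<iota> \<in> carrier ?U \<rightarrow> socle (regular_module A)" using soc by simp
    show "bij_betw \<iota> (carrier ?U) (socle (regular_module A))"
    proof (rule bij_betwI')
      fix x y assume x: "x \<in> carrier ?U" and y: "y \<in> carrier ?U"
      show "\<iota> x = \<iota> y \<longleftrightarrow> x = y"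
      proof
        assume eq: "\<iota> x = \<iota> y"
        show "x = y"
        proof (rule U.V_eqI[OF x y])
          fix i assume "i < a"
          then show "x i = y i" using \<iota>_pos[of i x] \<iota>_pos[of i y] eq by simp
        qed
      qed simp
    next
      show "\<iota> x \<in> socle (regular_module A)" if "x \<in> carrier ?U" for x by (rule soc[OF that])
      fix s assume s: "s \<in> socle (regular_module A)"
      then have sV: "s \<in> carrier V" and s0: "\<And>k. k < N \<Longrightarrow> \<not> P k \<Longrightarrow> s k = \<zero>"
        unfolding socle_tensor P_def by auto
      define x where "x = (\<lambda>i\<in>{..<a}. s (pos i))"
      have x: "x \<in> carrier ?U" unfolding x_def by (rule U.V_memI) (use sV pos in simp)
      have "s = \<iota> x"
      proof (rule V_eqI[OF sV \<iota>V[OF x]])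
        fix k assume k: "k < N"
        show "s k = \<iota> x k"
        proof (cases "P k")
          case True
          then show ?thesis using k idx[OF k True] pos_div[OF True] by (simp add: \<iota>_def x_def)
        next
          case False
          then show ?thesis using k s0[OF k False] by (simp add: \<iota>_def)
        qed
      qed
      then show "\<exists>x\<in>carrier ?U. s = \<iota> x" using x by blast
    qed
    show "\<iota> (x \<oplus>\<^bsub>?U\<^esub> y) = \<iota> x \<oplus>\<^bsub>V\<^esub> \<iota> y" if "x \<in> carrier ?U" "y \<in> carrier ?U" for x y
    proof (rule V_eqI)
      fix k assume "k < N"
      then show "\<iota> (x \<oplus>\<^bsub>?U\<^esub> y) k = (\<iota> x \<oplus>\<^bsub>V\<^esub> \<iota> y) k" using idx[of k] by (simp add: \<iota>_def)
    qed (simp_all add: \<iota>V that)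
    show "\<iota> (r \<odot>\<^bsub>?U\<^esub> x) = r \<odot>\<^bsub>V\<^esub> \<iota> x" if "r \<in> carrier K" "x \<in> carrier ?U" for r x
    proof (rule V_eqI)
      fix k assume "k < N"
      then show "\<iota> (r \<odot>\<^bsub>?U\<^esub> x) k = (r \<odot>\<^bsub>V\<^esub> \<iota> x) k" using idx[of k] that(1) by (simp add: \<iota>_def)
    qed (simp_all add: \<iota>V that)
  qed
qed

end

theorem proposition2p1:
  fixes K :: "('k, 'm) ring_scheme" and a b :: nat
  assumes "field K" and "a \<ge> 2" and "b \<ge> 1"
  shows "\<exists>(R :: ('k, nat \<Rightarrow> 'k) module) (D :: nat \<Rightarrow> (nat \<Rightarrow> 'k) set)
            (\<omega> :: (nat \<Rightarrow> 'k, nat \<Rightarrow> 'k) module).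
           positively_graded_algebra K R D \<and> cohen_macaulay R \<and> canonical_module R D \<omega> \<and>
           cm_type K R D = enat a \<and> residue_via R \<omega> = enat b"
proof -
  interpret truncated_tensor_algebra K "a * b + b" a b
    using assms by (simp add: truncated_tensor_algebra_def truncated_tensor_algebra_axioms_def coefficient_space_def)
  show ?thesis
    by (intro exI[of _ A] exI[of _ D] exI[of _ \<Omega>] conjI
        positively_graded_A cohen_macaulay_A canonical_\<Omega> cm_type_tensor residue_tensor)
qed

end
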